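(* Let $G$ be a digraph and $x$ a vertex of $G$. Define $\mathbb{K}$-linear maps $$\epsilon\colon\mathcal{Q}_x(G)\to\mathbb{K},\quad \oint_x u\mapsto\oint_{r_x}u,$$ where $r_x$ is the trivial arrow (constant loop) at $x$, $$\Delta\colon\mathcal{Q}_x(G)\to\mathcal{Q}_x(G)\otimes\mathcal{Q}_x(G),\quad \oint_x\omega_1\cdots\omega_r\mapsto\sum_{0\le i\le r}\oint_x\omega_1\cdots\omega_i\otimes\oint_x\omega_{i+1}\cdots\omega_r,$$ $$j\colon\mathcal{Q}_x(G)\to\mathcal{Q}_x(G),\quad \oint_x\omega_1\cdots\omega_r\mapsto(-1)^r\oint_x\omega_r\cdots\omega_1.$$ Then $\mathcal{Q}_x(G)$ is a Hopf algebra with counit $\epsilon$, comultiplication $\Delta$, and antipode $j$.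
   Context: $\mathbb{K}$ is a fixed field of characteristic $0$. A digraph $G=(G_0,G_1)$ has a finite vertex set $G_0$ and arrow set $G_1\subset (G_0\times G_0)\setminus\{(v,v)\}$ (no self-loops; both $u\to v$ and $v\to u$ may be arrows). A digraph map $f\colon G\to H$ is a map $G_0\to H_0$ such that for each arrow $u\to v$ of $G$ either $f(u)=f(v)$ or $f(u)\to f(v)$ is an arrow of $H$. A line digraph $I_n$ ($n\ge 0$) has vertices $0,\ldots,n$ and, for each $0\le i<n$, exactly one of the arrows $i\to i+1$, $i+1\to i$, and no other arrows. A loop at $x$ is a digraph map $\alpha\colon I_n\to G$ for some line digraph $I_n$ with $\alpha(0)=\alpha(n)=x$. A $1$-form on $G$ is a function $\omega\colon G_1\to\mathbb{K}$. For $\alpha\colon I_n\to G$ and $1\le t\le n$, set $\langle\omega,\alpha_t\rangle=0$ if $\alpha(t-1)=\alpha(t)$; otherwise $\langle\omega,\alpha_t\rangle=\omega(\alpha(t-1)\to\alpha(t))$ if $(t-1)\to t$ is in $I_n$, and $\langle\omega,\alpha_t\rangle=-\omega(\alpha(t)\to\alpha(t-1))$ if $t\to (t-1)$ is in $I_n$. With $\tau(t_1,\ldots,t_r)=\prod_{k\ge1}\varphi_k!$, $\varphi_k$ the multiplicity of $k$ in $(t_1,\ldots,t_r)$, define $$\oint_\alpha\omega_1\cdots\omega_r=\sum_{1\le t_1\le\cdots\le t_r\le n}\frac{\prod_{i=1}^r\langle\omega_i,\alpha_{t_i}\rangle}{\tau(t_1,\ldots,t_r)},$$ and the integral of the empty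 word ($r=0$) is $1$. Integrals extend linearly to linear combinations $u$ of words $\omega_1\cdots\omega_r$. $\oint_x\omega_1\cdots\omega_r$ denotes the function $\alpha\mapsto\oint_\alpha\omega_1\cdots\omega_r$ on loops at $x$. $\mathcal{Q}_x(G)$ is the $\mathbb{K}$-algebra of functions on loops at $x$ generated by all $\oint_x\omega_1\cdots\omega_r$, $r\ge1$, with unit the constant function $1$ and multiplication the shuffle product $\oint_x\omega_1\cdots\omega_r\oint_x\omega_{r+1}\cdots\omega_{r+s}=\sum_\sigma\oint_x\omega_{\sigma(1)}\cdots\omega_{\sigma(r+s)}$, $\sigma$ running over permutations with $\sigma^{-1}(1)<\cdots<\sigma^{-1}(r)$ and $\sigma^{-1}(r+1)<\cdots<\sigma^{-1}(r+s)$ (this is the pointwise product of functions). *)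

theory Defs
  imports
    "HOL-Algebra.Algebraic_Closure_Type"
    "Graph_Theory.Pair_Digraph"
begin

section \<open>Linear maps and tensor products of modules\<close>

text \<open>Linear maps are extensional outside the carrier of their domain, so that two of them are
  equal as soon as they agree on the carrier.\<close>

definition linear_maps ::
  "('r, 'x) ring_scheme \<Rightarrow> ('r, 'a, 'y) module_scheme \<Rightarrow> ('r, 'b, 'z) module_scheme \<Rightarrow> ('a \<Rightarrow> 'b) set"
  where "linear_maps R M N =
    {f \<in> carrier M \<rightarrow>\<^sub>E carrier N.
      (\<forall>x\<in>carrier M. \<forall>y\<in>carrier M. f (x \<oplus>\<^bsub>M\<^esub> y) = f x \<oplus>\<^bsub>N\<^esub> f y) \<and>
      (\<forall>a\<in>carrier R. \<forall>x\<in>carrier M. f (a \<odot>\<^bsub>M\<^esub> x) = a \<odot>\<^bsub>N\<^esub> f x)}"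

definition regular_module :: "('r, 'x) ring_scheme \<Rightarrow> ('r, 'r) module"
  where "regular_module R =
    \<lparr>carrier = carrier R, monoid.mult = (\<otimes>\<^bsub>R\<^esub>), one = \<one>\<^bsub>R\<^esub>,
     ring.zero = \<zero>\<^bsub>R\<^esub>, add = (\<oplus>\<^bsub>R\<^esub>), module.smult = (\<otimes>\<^bsub>R\<^esub>)\<rparr>"

text \<open>The records below that only describe modules leave their multiplicative part unspecified.\<close>

definition free_module :: "('r, 'x) ring_scheme \<Rightarrow> 's set \<Rightarrow> ('r, 's \<Rightarrow> 'r) module"
  where "free_module R S =
    \<lparr>carrier = {f. range f \<subseteq> carrier R \<and> finite {s. f s \<noteq> \<zero>\<^bsub>R\<^esub>} \<and> {s. f s \<noteq> \<zero>\<^bsub>R\<^esub>} \<subseteq> S},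
     monoid.mult = undefined, one = undefined,
     ring.zero = (\<lambda>s. \<zero>\<^bsub>R\<^esub>), add = (\<lambda>f g s. f s \<oplus>\<^bsub>R\<^esub> g s),
     module.smult = (\<lambda>a f s. a \<otimes>\<^bsub>R\<^esub> f s)\<rparr>"

definition free_gen :: "('r, 'x) ring_scheme \<Rightarrow> 's \<Rightarrow> 's \<Rightarrow> 'r"
  where "free_gen R s = (\<lambda>t. if t = s then \<one>\<^bsub>R\<^esub> else \<zero>\<^bsub>R\<^esub>)"

definition submodule_generated ::
  "('r, 'x) ring_scheme \<Rightarrow> ('r, 'a, 'y) module_scheme \<Rightarrow> 'a set \<Rightarrow> 'a set"
  where "submodule_generated R M S = \<Inter>{H. submodule H R M \<and> S \<subseteq> H}"

definition quotient_module ::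
  "('r, 'a, 'y) module_scheme \<Rightarrow> 'a set \<Rightarrow> ('r, 'a set) module"
  where "quotient_module M N =
    \<lparr>carrier = a_rcosets\<^bsub>M\<^esub> N, monoid.mult = undefined, one = undefined,
     ring.zero = N, add = set_add M,
     module.smult = (\<lambda>a S. \<Union>v\<in>S. N +>\<^bsub>M\<^esub> (a \<odot>\<^bsub>M\<^esub> v))\<rparr>"

definition tensor_relations ::
  "('r, 'x) ring_scheme \<Rightarrow> ('r, 'a, 'y) module_scheme \<Rightarrow> ('r, 'b, 'z) module_scheme
    \<Rightarrow> ('a \<times> 'b \<Rightarrow> 'r) set"
  where "tensor_relations R M N =
    (let F = free_module R (carrier M \<times> carrier N); e = (\<lambda>m n. free_gen R (m, n)) in
      {e (m \<oplus>\<^bsub>M\<^esub> m') n \<ominus>\<^bsub>F\<^esub> (e m n \<oplus>\<^bsub>F\<^esub> e m' n) | m m' n.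
          m \<in> carrier M \<and> m' \<in> carrier M \<and> n \<in> carrier N} \<union>
      {e m (n \<oplus>\<^bsub>N\<^esub> n') \<ominus>\<^bsub>F\<^esub> (e m n \<oplus>\<^bsub>F\<^esub> e m n') | m n n'.
          m \<in> carrier M \<and> n \<in> carrier N \<and> n' \<in> carrier N} \<union>
      {e (a \<odot>\<^bsub>M\<^esub> m) n \<ominus>\<^bsub>F\<^esub> (a \<odot>\<^bsub>F\<^esub> e m n) | a m n.
          a \<in> carrier R \<and> m \<in> carrier M \<and> n \<in> carrier N} \<union>
      {e m (a \<odot>\<^bsub>N\<^esub> n) \<ominus>\<^bsub>F\<^esub> (a \<odot>\<^bsub>F\<^esub> e m n) | a m n.
          a \<in> carrier R \<and> m \<in> carrier M \<and> n \<in> carrier N})"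

definition tensor_kernel ::
  "('r, 'x) ring_scheme \<Rightarrow> ('r, 'a, 'y) module_scheme \<Rightarrow> ('r, 'b, 'z) module_scheme
    \<Rightarrow> ('a \<times> 'b \<Rightarrow> 'r) set"
  where "tensor_kernel R M N =
    submodule_generated R (free_module R (carrier M \<times> carrier N)) (tensor_relations R M N)"

definition tensor ::
  "('r, 'x) ring_scheme \<Rightarrow> ('r, 'a, 'y) module_scheme \<Rightarrow> ('r, 'b, 'z) module_scheme
    \<Rightarrow> ('r, ('a \<times> 'b \<Rightarrow> 'r) set) module"
  where "tensor R M N =
    quotient_module (free_module R (carrier M \<times> carrier N)) (tensor_kernel R M N)"

definition pure_tensor ::
  "('r, 'x) ring_scheme \<Rightarrow> ('r, 'a, 'y) module_scheme \<Rightarrow> ('r, 'b, 'z) module_scheme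
    \<Rightarrow> 'a \<Rightarrow> 'b \<Rightarrow> ('a \<times> 'b \<Rightarrow> 'r) set"
  where "pure_tensor R M N m n =
    tensor_kernel R M N +>\<^bsub>free_module R (carrier M \<times> carrier N)\<^esub> free_gen R (m, n)"

text \<open>The linear map out of a tensor product that a bilinear map \<open>b\<close> induces by the universal
  property.\<close>

definition tensor_lift ::
  "('r, 'x) ring_scheme \<Rightarrow> ('r, 'a, 'y) module_scheme \<Rightarrow> ('r, 'b, 'z) module_scheme
    \<Rightarrow> ('r, 'c, 'w) module_scheme \<Rightarrow> ('a \<Rightarrow> 'b \<Rightarrow> 'c) \<Rightarrow> ('a \<times> 'b \<Rightarrow> 'r) set \<Rightarrow> 'c"
  where "tensor_lift R M N P b =
    (THE f. f \<in> linear_maps R (tensor R M N) P \<and>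
      (\<forall>m\<in>carrier M. \<forall>n\<in>carrier N. f (pure_tensor R M N m n) = b m n))"

definition tensor_map ::
  "('r, 'x) ring_scheme \<Rightarrow> ('r, 'a, 'y) module_scheme \<Rightarrow> ('r, 'b, 'z) module_scheme
    \<Rightarrow> ('r, 'c, 'v) module_scheme \<Rightarrow> ('r, 'd, 'w) module_scheme
    \<Rightarrow> ('a \<Rightarrow> 'c) \<Rightarrow> ('b \<Rightarrow> 'd) \<Rightarrow> ('a \<times> 'b \<Rightarrow> 'r) set \<Rightarrow> ('c \<times> 'd \<Rightarrow> 'r) set"
  where "tensor_map R M N M' N' f g =
    tensor_lift R M N (tensor R M' N') (\<lambda>m n. pure_tensor R M' N' (f m) (g n))"

definition tensor_assoc ::
  "('r, 'x) ring_scheme \<Rightarrow> ('r, 'a, 'y) module_scheme \<Rightarrow> ('r, 'b, 'z) module_scheme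
    \<Rightarrow> ('r, 'c, 'w) module_scheme
    \<Rightarrow> (('a \<times> 'b \<Rightarrow> 'r) set \<times> 'c \<Rightarrow> 'r) set \<Rightarrow> ('a \<times> ('b \<times> 'c \<Rightarrow> 'r) set \<Rightarrow> 'r) set"
  where "tensor_assoc R M N P =
    tensor_lift R (tensor R M N) P (tensor R M (tensor R N P))
      (\<lambda>t p. tensor_lift R M N (tensor R M (tensor R N P))
        (\<lambda>m n. pure_tensor R M (tensor R N P) m (pure_tensor R N P n p)) t)"

text \<open>\<open>(a \<otimes> b) (c \<otimes> d) = a c \<otimes> b d\<close>, extended bilinearly.\<close>

definition tensor_algebra ::
  "('r, 'x) ring_scheme \<Rightarrow> ('r, 'a, 'y) module_scheme \<Rightarrow> ('r, 'b, 'z) module_scheme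
    \<Rightarrow> ('r, ('a \<times> 'b \<Rightarrow> 'r) set) module"
  where "tensor_algebra R A B =
    (tensor R A B)
      \<lparr>monoid.mult := (\<lambda>S T.
         tensor_lift R A B (tensor R A B)
           (\<lambda>a b. tensor_lift R A B (tensor R A B)
             (\<lambda>c d. pure_tensor R A B (a \<otimes>\<^bsub>A\<^esub> c) (b \<otimes>\<^bsub>B\<^esub> d)) T) S),
       one := pure_tensor R A B \<one>\<^bsub>A\<^esub> \<one>\<^bsub>B\<^esub>\<rparr>"


section \<open>Hopf algebras\<close>

text \<open>The locale \<^locale>\<open>algebra\<close> of the library is restricted to commutative algebras.\<close>

locale assoc_algebra = module R A + ring A for R (structure) and A (structure) +
  assumes smult_mult_left:
      "\<lbrakk>a \<in> carrier R; x \<in> carrier A; y \<in> carrier A\<rbrakk> \<Longrightarrow>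
        (a \<odot>\<^bsub>A\<^esub> x) \<otimes>\<^bsub>A\<^esub> y = a \<odot>\<^bsub>A\<^esub> (x \<otimes>\<^bsub>A\<^esub> y)"
    and smult_mult_right:
      "\<lbrakk>a \<in> carrier R; x \<in> carrier A; y \<in> carrier A\<rbrakk> \<Longrightarrow>
        x \<otimes>\<^bsub>A\<^esub> (a \<odot>\<^bsub>A\<^esub> y) = a \<odot>\<^bsub>A\<^esub> (x \<otimes>\<^bsub>A\<^esub> y)"

locale coalgebra = module R C for R (structure) and C (structure) +
  fixes comult :: "'c \<Rightarrow> ('c \<times> 'c \<Rightarrow> 'a) set" and counit :: "'c \<Rightarrow> 'a"
  assumes comult_linear: "comult \<in> linear_maps R C (tensor R C C)"
    and counit_linear: "counit \<in> linear_maps R C (regular_module R)"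
    and coassoc:
      "c \<in> carrier C \<Longrightarrow>
        tensor_assoc R C C C (tensor_map R C C (tensor R C C) C comult (\<lambda>y. y) (comult c)) =
        tensor_map R C C C (tensor R C C) (\<lambda>y. y) comult (comult c)"
    and counit_left:
      "c \<in> carrier C \<Longrightarrow> tensor_lift R C C C (\<lambda>y z. counit y \<odot>\<^bsub>C\<^esub> z) (comult c) = c"
    and counit_right:
      "c \<in> carrier C \<Longrightarrow> tensor_lift R C C C (\<lambda>y z. counit z \<odot>\<^bsub>C\<^esub> y) (comult c) = c"

locale bialgebra = assoc_algebra R A + coalgebra R A comult counit
  for R (structure) and A (structure) and comult and counit +
  assumes comult_ring_hom: "comult \<in> ring_hom A (tensor_algebra R A A)"
    and counit_ring_hom: "counit \<in> ring_hom A R"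

locale hopf_algebra = bialgebra R H comult counit
  for R (structure) and H (structure) and comult and counit +
  fixes antipode :: "'c \<Rightarrow> 'c"
  assumes antipode_linear: "antipode \<in> linear_maps R H H"
    and antipode_left:
      "h \<in> carrier H \<Longrightarrow>
        tensor_lift R H H H (\<lambda>y z. antipode y \<otimes>\<^bsub>H\<^esub> z) (comult h) = counit h \<odot>\<^bsub>H\<^esub> \<one>\<^bsub>H\<^esub>"
    and antipode_right:
      "h \<in> carrier H \<Longrightarrow>
        tensor_lift R H H H (\<lambda>y z. y \<otimes>\<^bsub>H\<^esub> antipode z) (comult h) = counit h \<odot>\<^bsub>H\<^esub> \<one>\<^bsub>H\<^esub>"


section \<open>Loops in digraphs and iterated integrals\<close>

definition digraph_maps :: "'u pair_pre_digraph \<Rightarrow> 'v pair_pre_digraph \<Rightarrow> ('u \<Rightarrow> 'v) set"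
  where "digraph_maps G H =
    {f \<in> pverts G \<rightarrow>\<^sub>E pverts H. \<forall>(u, v)\<in>parcs G. f u = f v \<or> (f u, f v) \<in> parcs H}"

definition line_digraph :: "nat \<Rightarrow> nat pair_pre_digraph \<Rightarrow> bool"
  where "line_digraph n I \<longleftrightarrow>
    pverts I = {0..n} \<and>
    parcs I \<subseteq> (\<Union>i<n. {(i, i + 1), (i + 1, i)}) \<and>
    (\<forall>i<n. (i, i + 1) \<in> parcs I \<longleftrightarrow> (i + 1, i) \<notin> parcs I)"

text \<open>A map \<open>I\<^sub>n \<rightarrow> G\<close> is stored together with its domain, since integrals depend on the
  directions of the arrows of \<open>I\<^sub>n\<close>.\<close>

record 'v line_map =
  len :: nat
  line :: "nat pair_pre_digraph"
  vertex :: "nat \<Rightarrow> 'v"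

definition loops :: "'v pair_pre_digraph \<Rightarrow> 'v \<Rightarrow> 'v line_map set"
  where "loops G x =
    {\<alpha>. line_digraph (len \<alpha>) (line \<alpha>) \<and> vertex \<alpha> \<in> digraph_maps (line \<alpha>) G \<and>
         vertex \<alpha> 0 = x \<and> vertex \<alpha> (len \<alpha>) = x}"

definition trivial_loop :: "'v \<Rightarrow> 'v line_map"
  where "trivial_loop x =
    \<lparr>len = 0, line = \<lparr>pverts = {0}, parcs = {}\<rparr>, vertex = (\<lambda>i\<in>{0}. x)\<rparr>"

definition one_forms :: "'v pair_pre_digraph \<Rightarrow> ('v \<times> 'v \<Rightarrow> 'k) set"
  where "one_forms G = (parcs G \<rightarrow>\<^sub>E UNIV)"

definition form_pairing :: "('v \<times> 'v \<Rightarrow> 'k::field_char_0) \<Rightarrow> 'v line_map \<Rightarrow> nat \<Rightarrow> 'k"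
  where "form_pairing \<omega> \<alpha> t =
    (if vertex \<alpha> (t - 1) = vertex \<alpha> t then 0
     else if (t - 1, t) \<in> parcs (line \<alpha>) then \<omega> (vertex \<alpha> (t - 1), vertex \<alpha> t)
     else - \<omega> (vertex \<alpha> t, vertex \<alpha> (t - 1)))"

definition multiplicity_factor :: "nat list \<Rightarrow> nat"
  where "multiplicity_factor ts = (\<Prod>k\<in>set ts. fact (count_list ts k))"

definition line_integral :: "('v \<times> 'v \<Rightarrow> 'k::field_char_0) list \<Rightarrow> 'v line_map \<Rightarrow> 'k"
  where "line_integral ws \<alpha> =
    (\<Sum>ts | length ts = length ws \<and> sorted ts \<and> set ts \<subseteq> {1..len \<alpha>}.
      (\<Prod>i<length ws. form_pairing (ws ! i) \<alpha> (ts ! i)) / of_nat (multiplicity_factor ts))"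

definition loop_integral ::
  "'v pair_pre_digraph \<Rightarrow> 'v \<Rightarrow> ('v \<times> 'v \<Rightarrow> 'k::field_char_0) list \<Rightarrow> 'v line_map \<Rightarrow> 'k"
  where "loop_integral G x ws = (\<lambda>\<alpha>\<in>loops G x. line_integral ws \<alpha>)"


section \<open>The algebra generated by iterated integrals\<close>

definition function_algebra :: "'s set \<Rightarrow> ('k::field, 's \<Rightarrow> 'k) module"
  where "function_algebra S =
    \<lparr>carrier = S \<rightarrow>\<^sub>E UNIV,
     monoid.mult = (\<lambda>f g. \<lambda>s\<in>S. f s * g s), one = (\<lambda>s\<in>S. 1),
     ring.zero = (\<lambda>s\<in>S. 0), add = (\<lambda>f g. \<lambda>s\<in>S. f s + g s),
     module.smult = (\<lambda>a f. \<lambda>s\<in>S. a * f s)\<rparr>"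

inductive_set subalgebra_generated ::
  "('r, 'x) ring_scheme \<Rightarrow> ('r, 'a, 'y) module_scheme \<Rightarrow> 'a set \<Rightarrow> 'a set"
  for R and A and S
  where
    generator: "a \<in> S \<Longrightarrow> a \<in> subalgebra_generated R A S"
  | one: "\<one>\<^bsub>A\<^esub> \<in> subalgebra_generated R A S"
  | add: "a \<in> subalgebra_generated R A S \<Longrightarrow> b \<in> subalgebra_generated R A S \<Longrightarrow>
      a \<oplus>\<^bsub>A\<^esub> b \<in> subalgebra_generated R A S"
  | mult: "a \<in> subalgebra_generated R A S \<Longrightarrow> b \<in> subalgebra_generated R A S \<Longrightarrow>
      a \<otimes>\<^bsub>A\<^esub> b \<in> subalgebra_generated R A S"
  | smult: "c \<in> carrier R \<Longrightarrow> a \<in> subalgebra_generated R A S \<Longrightarrow>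
      c \<odot>\<^bsub>A\<^esub> a \<in> subalgebra_generated R A S"

text \<open>The multiplication is the pointwise one, which by the shuffle formula agrees with the
  shuffle product of words of forms.\<close>

definition loop_algebra ::
  "'v pair_pre_digraph \<Rightarrow> 'v \<Rightarrow> ('k::field_char_0, 'v line_map \<Rightarrow> 'k) module"
  where "loop_algebra G x =
    (function_algebra (loops G x))
      \<lparr>carrier := subalgebra_generated ring_of_type_algebra (function_algebra (loops G x))
        {loop_integral G x ws | ws. ws \<in> lists (one_forms G) \<and> ws \<noteq> []}\<rparr>"


section \<open>The three structure maps\<close>

text \<open>The empty word is included; its integral is the unit.\<close>

definition is_loop_counit ::
  "'v pair_pre_digraph \<Rightarrow> 'v \<Rightarrow> (('v line_map \<Rightarrow> 'k::field_char_0) \<Rightarrow> 'k) \<Rightarrow> bool"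
  where "is_loop_counit G x \<epsilon> \<longleftrightarrow>
    \<epsilon> \<in> linear_maps ring_of_type_algebra (loop_algebra G x) (regular_module ring_of_type_algebra) \<and>
    (\<forall>ws\<in>lists (one_forms G). \<epsilon> (loop_integral G x ws) = line_integral ws (trivial_loop x))"

definition is_loop_comult ::
  "'v pair_pre_digraph \<Rightarrow> 'v
    \<Rightarrow> (('v line_map \<Rightarrow> 'k::field_char_0)
        \<Rightarrow> (('v line_map \<Rightarrow> 'k) \<times> ('v line_map \<Rightarrow> 'k) \<Rightarrow> 'k) set) \<Rightarrow> bool"
  where "is_loop_comult G x \<Delta> \<longleftrightarrow>
    (let K = ring_of_type_algebra; Q = loop_algebra G x in
      \<Delta> \<in> linear_maps K Q (tensor K Q Q) \<and>
      (\<forall>ws\<in>lists (one_forms G).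
        \<Delta> (loop_integral G x ws) =
        (\<Oplus>\<^bsub>tensor K Q Q\<^esub> i\<in>{0..length ws}.
          pure_tensor K Q Q (loop_integral G x (take i ws)) (loop_integral G x (drop i ws)))))"

definition is_loop_antipode ::
  "'v pair_pre_digraph \<Rightarrow> 'v
    \<Rightarrow> (('v line_map \<Rightarrow> 'k::field_char_0) \<Rightarrow> ('v line_map \<Rightarrow> 'k)) \<Rightarrow> bool"
  where "is_loop_antipode G x j \<longleftrightarrow>
    j \<in> linear_maps ring_of_type_algebra (loop_algebra G x) (loop_algebra G x) \<and>
    (\<forall>ws\<in>lists (one_forms G).
      j (loop_integral G x ws) =
      (- 1) ^ length ws \<odot>\<^bsub>loop_algebra G x\<^esub> loop_integral G x (rev ws))"

end

theory Submission
  imports Defs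
begin

text \<open>
  The loops at \<open>x\<close> carry a concatenation, a trivial loop and a reversal, and the three structure maps
  are dual to them: viewed as functions of loops, \<open>\<Delta> f (\<alpha>, \<beta>) = f (\<alpha> \<beta>)\<close>, \<open>\<epsilon> f = f r\<^sub>x\<close> and
  \<open>j f (\<alpha>) = f (\<alpha>\<inverse>)\<close>. The Hopf algebra axioms then follow as for the representative functions of
  a group. Each axiom is an identity in \<open>Q\<close>, \<open>Q \<otimes> Q\<close> or \<open>Q \<otimes> Q \<otimes> Q\<close>; evaluated at one, two or three
  loops it becomes a law of the form \<open>f ((\<alpha> \<beta>) \<gamma>) = f (\<alpha> (\<beta> \<gamma>))\<close> or \<open>f (\<alpha>\<inverse> \<alpha>) = f r\<^sub>x\<close>. Loops do not form
  a group, but iterated integrals cannot tell the two sides of these laws apart.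

  Evaluation loses nothing because over a field the products of two separating families of
  functionals separate the points of a tensor product (\<open>tensor_separating\<close>). This also makes \<open>\<Delta>\<close>
  well defined, although nothing is known about the linear relations between iterated integrals:
  an element of \<open>Q \<otimes> Q\<close> that represents \<open>f (\<alpha> \<beta>)\<close> is unique.

  The facts about integrals all come from one formula. For fixed \<open>\<alpha>\<close> the function sending a word to
  its integral is a product of exponential series, one for each step of \<open>\<alpha>\<close>, in the algebra of
  functions on words whose product \<open>conv\<close> is dual to deconcatenation (\<open>iterated_sum_eq_chen\<close>).
  Associativity of \<open>conv\<close> gives the integral over a concatenation. Reversal of words with sign is an
  antihomomorphism that inverts every exponential, which gives the integral over a reversed loop
  and the cancellation of \<open>\<alpha>\<inverse> \<alpha>\<close>. Exponentials are multiplicative for the shuffle product, and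
  \<open>conv\<close> preserves this property (\<open>shuffle_sum_conv\<close>). The resulting shuffle formula shows that the
  integrals of words span \<open>Q\<close>, so that linear maps are determined by their values on words.
\<close>

section \<open>Linear maps\<close>

lemma linear_mapsI:
  assumes "\<And>x. x \<in> carrier M \<Longrightarrow> f x \<in> carrier N"
    and "\<And>x. x \<notin> carrier M \<Longrightarrow> f x = undefined"
    and "\<And>x y. x \<in> carrier M \<Longrightarrow> y \<in> carrier M \<Longrightarrow> f (x \<oplus>\<^bsub>M\<^esub> y) = f x \<oplus>\<^bsub>N\<^esub> f y"
    and "\<And>a x. a \<in> carrier R \<Longrightarrow> x \<in> carrier M \<Longrightarrow> f (a \<odot>\<^bsub>M\<^esub> x) = a \<odot>\<^bsub>N\<^esub> f x"
  shows "f \<in> linear_maps R M N"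
  using assms by (auto simp: linear_maps_def PiE_def extensional_def)

lemma linear_maps_restrictI:
  assumes "module R M"
    and "\<And>x. x \<in> carrier M \<Longrightarrow> f x \<in> carrier N"
    and "\<And>x y. x \<in> carrier M \<Longrightarrow> y \<in> carrier M \<Longrightarrow> f (x \<oplus>\<^bsub>M\<^esub> y) = f x \<oplus>\<^bsub>N\<^esub> f y"
    and "\<And>a x. a \<in> carrier R \<Longrightarrow> x \<in> carrier M \<Longrightarrow> f (a \<odot>\<^bsub>M\<^esub> x) = a \<odot>\<^bsub>N\<^esub> f x"
  shows "(\<lambda>x\<in>carrier M. f x) \<in> linear_maps R M N"
proof -
  interpret module R M by fact
  show ?thesis by (rule linear_mapsI) (auto simp: assms)
qed

lemma linear_maps_closed: "f \<in> linear_maps R M N \<Longrightarrow> x \<in> carrier M \<Longrightarrow> f x \<in> carrier N"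
  by (auto simp: linear_maps_def)

lemma linear_maps_add:
  "f \<in> linear_maps R M N \<Longrightarrow> x \<in> carrier M \<Longrightarrow> y \<in> carrier M \<Longrightarrow>
    f (x \<oplus>\<^bsub>M\<^esub> y) = f x \<oplus>\<^bsub>N\<^esub> f y"
  by (auto simp: linear_maps_def)

lemma linear_maps_smult:
  "f \<in> linear_maps R M N \<Longrightarrow> a \<in> carrier R \<Longrightarrow> x \<in> carrier M \<Longrightarrow>
    f (a \<odot>\<^bsub>M\<^esub> x) = a \<odot>\<^bsub>N\<^esub> f x"
  by (auto simp: linear_maps_def)

lemma linear_maps_eqI:
  assumes "f \<in> linear_maps R M N" "g \<in> linear_maps R M N" "\<And>x. x \<in> carrier M \<Longrightarrow> f x = g x"
  shows "f = g"
  by (rule PiE_ext[of f "carrier M" "\<lambda>_. carrier N" g]) (use assms in \<open>auto simp: linear_maps_def\<close>)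

lemma linear_maps_zero:
  assumes "module R M" "module R N" "f \<in> linear_maps R M N"
  shows "f \<zero>\<^bsub>M\<^esub> = \<zero>\<^bsub>N\<^esub>"
proof -
  interpret M: module R M by fact
  interpret N: module R N by fact
  have "f (\<zero>\<^bsub>R\<^esub> \<odot>\<^bsub>M\<^esub> \<zero>\<^bsub>M\<^esub>) = \<zero>\<^bsub>R\<^esub> \<odot>\<^bsub>N\<^esub> f \<zero>\<^bsub>M\<^esub>"
    by (rule linear_maps_smult[OF assms(3)]) auto
  thus ?thesis using linear_maps_closed[OF assms(3), of "\<zero>\<^bsub>M\<^esub>"] by simp
qed

lemma linear_maps_minus:
  assumes "module R M" "module R N" "f \<in> linear_maps R M N" "x \<in> carrier M"
  shows "f (\<ominus>\<^bsub>M\<^esub> x) = \<ominus>\<^bsub>N\<^esub> f x"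
proof -
  interpret M: module R M by fact
  interpret N: module R N by fact
  have "f (\<ominus>\<^bsub>M\<^esub> x) = f ((\<ominus>\<^bsub>R\<^esub> \<one>\<^bsub>R\<^esub>) \<odot>\<^bsub>M\<^esub> x)" using assms(4) by (simp add: M.smult_l_minus)
  also have "\<dots> = (\<ominus>\<^bsub>R\<^esub> \<one>\<^bsub>R\<^esub>) \<odot>\<^bsub>N\<^esub> f x" by (rule linear_maps_smult[OF assms(3)]) (use assms in auto)
  also have "\<dots> = \<ominus>\<^bsub>N\<^esub> f x" using linear_maps_closed[OF assms(3,4)] by (simp add: N.smult_l_minus)
  finally show ?thesis .
qed

lemma linear_maps_finsum:
  assumes "module R M" "module R N" "f \<in> linear_maps R M N" "finite A" "g \<in> A \<rightarrow> carrier M"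
  shows "f (\<Oplus>\<^bsub>M\<^esub>i\<in>A. g i) = (\<Oplus>\<^bsub>N\<^esub>i\<in>A. f (g i))"
proof -
  interpret M: module R M by fact
  interpret N: module R N by fact
  show ?thesis using assms(4,5)
  proof (induction A rule: finite_induct)
    case empty
    then show ?case using linear_maps_zero[OF assms(1-3)] by simp
  next
    case (insert x F)
    then have "(\<Oplus>\<^bsub>M\<^esub>i\<in>F. g i) \<in> carrier M" by (intro M.finsum_closed) auto
    with insert show ?case
      using linear_maps_closed[OF assms(3)] by (subst M.finsum_insert N.finsum_insert; auto simp: Pi_def linear_maps_add[OF assms(3)])+
  qed
qed

lemma linear_maps_comp:
  assumes "module R M" "f \<in> linear_maps R M N" "g \<in> linear_maps R N P"
  shows "(\<lambda>x\<in>carrier M. g (f x)) \<in> linear_maps R M P"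
  by (rule linear_maps_restrictI[OF assms(1)])
    (simp_all add: linear_maps_closed[OF assms(2)] linear_maps_closed[OF assms(3)]
      linear_maps_add[OF assms(2)] linear_maps_add[OF assms(3)]
      linear_maps_smult[OF assms(2)] linear_maps_smult[OF assms(3)])

lemma submodule_kernel:
  assumes "module R M" "module R N" "f \<in> linear_maps R M N"
  shows "submodule {x \<in> carrier M. f x = \<zero>\<^bsub>N\<^esub>} R M"
proof -
  interpret M: module R M by fact
  interpret N: module R N by fact
  show ?thesis
    by (rule M.submoduleI)
      (auto simp: linear_maps_zero[OF assms] linear_maps_minus[OF assms]
        linear_maps_add[OF assms(3)] linear_maps_smult[OF assms(3)])
qed

lemma regular_module_simps [simp]:
  "carrier (regular_module R) = carrier R" "zero (regular_module R) = zero R"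
  "add (regular_module R) = add R" "module.smult (regular_module R) = monoid.mult R"
  by (simp_all add: regular_module_def)

lemma module_regular_module: "cring R \<Longrightarrow> module R (regular_module R)"
proof -
  assume "cring R"
  interpret cring R by fact
  have "\<exists>y\<in>carrier R. y \<oplus>\<^bsub>R\<^esub> x = \<zero>\<^bsub>R\<^esub>" if "x \<in> carrier R" for x
    using l_neg that by blast
  thus ?thesis
    by (intro moduleI abelian_groupI)
      (auto simp: regular_module_def a_ac m_assoc l_distr r_distr intro: is_cring)
qed

section \<open>Free modules\<close>

lemma free_module_simps [simp]:
  "zero (free_module R S) = (\<lambda>s. \<zero>\<^bsub>R\<^esub>)"
  "add (free_module R S) = (\<lambda>f g s. f s \<oplus>\<^bsub>R\<^esub> g s)"
  "module.smult (free_module R S) = (\<lambda>a f s. a \<otimes>\<^bsub>R\<^esub> f s)"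
  by (simp_all add: free_module_def)

lemma free_module_carrier:
  "f \<in> carrier (free_module R S) \<longleftrightarrow>
    (\<forall>s. f s \<in> carrier R) \<and> finite {s. f s \<noteq> \<zero>\<^bsub>R\<^esub>} \<and> (\<forall>s. s \<notin> S \<longrightarrow> f s = \<zero>\<^bsub>R\<^esub>)"
  by (auto simp: free_module_def)

lemma module_free_module:
  assumes "cring R"
  shows "module R (free_module R S)"
proof -
  interpret cring R by fact
  have add: "(\<lambda>s. f s \<oplus>\<^bsub>R\<^esub> g s) \<in> carrier (free_module R S)"
    if "f \<in> carrier (free_module R S)" "g \<in> carrier (free_module R S)" for f g
  proof -
    have "{s. f s \<oplus>\<^bsub>R\<^esub> g s \<noteq> \<zero>\<^bsub>R\<^esub>} \<subseteq> {s. f s \<noteq> \<zero>\<^bsub>R\<^esub>} \<union> {s. g s \<noteq> \<zero>\<^bsub>R\<^esub>}"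
      using that by (auto simp: free_module_carrier)
    thus ?thesis using that finite_subset by (auto simp: free_module_carrier)
  qed
  have smult: "(\<lambda>s. a \<otimes>\<^bsub>R\<^esub> f s) \<in> carrier (free_module R S)"
    if "a \<in> carrier R" "f \<in> carrier (free_module R S)" for a f
  proof -
    have "{s. a \<otimes>\<^bsub>R\<^esub> f s \<noteq> \<zero>\<^bsub>R\<^esub>} \<subseteq> {s. f s \<noteq> \<zero>\<^bsub>R\<^esub>}" using that by auto
    thus ?thesis using that finite_subset by (auto simp: free_module_carrier)
  qed
  have neg: "\<exists>g\<in>carrier (free_module R S). (\<lambda>s. g s \<oplus>\<^bsub>R\<^esub> f s) = (\<lambda>s. \<zero>\<^bsub>R\<^esub>)"
    if "f \<in> carrier (free_module R S)" for f
    using smult[OF _ that, of "\<ominus>\<^bsub>R\<^esub> \<one>\<^bsub>R\<^esub>"] that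
    by (intro bexI[of _ "\<lambda>s. (\<ominus>\<^bsub>R\<^esub> \<one>\<^bsub>R\<^esub>) \<otimes>\<^bsub>R\<^esub> f s"]) (auto simp: free_module_carrier l_minus l_neg)
  show ?thesis
    by (intro moduleI abelian_groupI is_cring)
      (use add smult neg in \<open>auto simp: free_module_carrier fun_eq_iff a_ac m_assoc l_distr r_distr\<close>)
qed

lemma free_gen_closed:
  assumes "cring R" "s \<in> S"
  shows "free_gen R s \<in> carrier (free_module R S)"
proof -
  interpret cring R by fact
  have "{t. free_gen R s t \<noteq> \<zero>\<^bsub>R\<^esub>} \<subseteq> {s}" by (auto simp: free_gen_def)
  thus ?thesis using assms finite_subset by (auto simp: free_module_carrier free_gen_def)
qed

lemma free_module_induct [consumes 2, case_names zero add gen]: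
  assumes "cring R" "f \<in> carrier (free_module R S)"
    and zero: "P (\<lambda>s. \<zero>\<^bsub>R\<^esub>)"
    and add: "\<And>f g. f \<in> carrier (free_module R S) \<Longrightarrow> g \<in> carrier (free_module R S) \<Longrightarrow>
      P f \<Longrightarrow> P g \<Longrightarrow> P (\<lambda>s. f s \<oplus>\<^bsub>R\<^esub> g s)"
    and gen: "\<And>a s. a \<in> carrier R \<Longrightarrow> s \<in> S \<Longrightarrow> P (\<lambda>t. a \<otimes>\<^bsub>R\<^esub> free_gen R s t)"
  shows "P f"
proof -
  interpret cring R by fact
  interpret F: module R "free_module R S" by (rule module_free_module) fact
  have "finite A \<Longrightarrow> f \<in> carrier (free_module R S) \<Longrightarrow> {s. f s \<noteq> \<zero>\<^bsub>R\<^esub>} = A \<Longrightarrow> P f" for A f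
  proof (induction A arbitrary: f rule: finite_induct)
    case empty
    then have "f = (\<lambda>s. \<zero>\<^bsub>R\<^esub>)" by auto
    then show ?case using assms(3) by simp
  next
    case (insert s A)
    have f: "f s' \<in> carrier R" for s' using insert.prems by (auto simp: free_module_carrier)
    have s: "s \<in> S" using insert.prems by (auto simp: free_module_carrier)
    define g where "g = (\<lambda>t. f s \<otimes>\<^bsub>R\<^esub> free_gen R s t)"
    have g: "g \<in> carrier (free_module R S)"
      using F.smult_closed[OF f free_gen_closed[OF assms(1) s]] by (simp add: g_def)
    have supp: "{t. (f(s := \<zero>\<^bsub>R\<^esub>)) t \<noteq> \<zero>\<^bsub>R\<^esub>} = A" using insert by auto
    have "f(s := \<zero>\<^bsub>R\<^esub>) \<in> carrier (free_module R S)"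
      using insert.prems insert.hyps supp unfolding free_module_carrier by auto
    moreover from this have "P (f(s := \<zero>\<^bsub>R\<^esub>))" using supp by (rule insert.IH)
    moreover have "P g" unfolding g_def by (rule gen) (use f s in auto)
    ultimately have "P (\<lambda>t. (f(s := \<zero>\<^bsub>R\<^esub>)) t \<oplus>\<^bsub>R\<^esub> g t)" using g by (intro add)
    also have "(\<lambda>t. (f(s := \<zero>\<^bsub>R\<^esub>)) t \<oplus>\<^bsub>R\<^esub> g t) = f" using f by (auto simp: g_def free_gen_def)
    finally show ?case .
  qed
  from this[OF _ assms(2) refl] assms(2) show ?thesis by (auto simp: free_module_carrier)
qed

lemma free_module_lift:
  assumes "module R P" "\<And>s. s \<in> S \<Longrightarrow> b s \<in> carrier P"
  obtains f where "f \<in> linear_maps R (free_module R S) P"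
    and "\<And>s. s \<in> S \<Longrightarrow> f (free_gen R s) = b s"
proof
  interpret P: module R P by fact
  interpret F: module R "free_module R S" by (rule module_free_module) (rule P.is_cring)
  let ?L = "\<lambda>f A. \<Oplus>\<^bsub>P\<^esub>s\<in>A. f s \<odot>\<^bsub>P\<^esub> b s"
  define L where "L = (\<lambda>f. ?L f {s. f s \<noteq> \<zero>\<^bsub>R\<^esub>})"
  \<comment> \<open>A finite set larger than the support gives the same sum; this makes additivity a statement
    about sums over a common set.\<close>
  have L: "L f = ?L f A" if "f \<in> carrier (free_module R S)" "finite A" "{s. f s \<noteq> \<zero>\<^bsub>R\<^esub>} \<subseteq> A" "A \<subseteq> S" for f A
    unfolding L_def
    by (rule P.add.finprod_mono_neutral_cong_left) (use that assms in \<open>auto simp: free_module_carrier\<close>)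
  have Pi: "(\<lambda>s. f s \<odot>\<^bsub>P\<^esub> b s) \<in> A \<rightarrow> carrier P" if "f \<in> carrier (free_module R S)" "A \<subseteq> S" for f A
    using that assms by (auto simp: free_module_carrier)
  show "(\<lambda>f\<in>carrier (free_module R S). L f) \<in> linear_maps R (free_module R S) P"
  proof (rule linear_maps_restrictI)
    show "module R (free_module R S)" by (rule F.module_axioms)
  next
    fix f assume f: "f \<in> carrier (free_module R S)"
    show "L f \<in> carrier P" unfolding L_def
      by (rule P.finsum_closed) (use f assms in \<open>auto simp: free_module_carrier\<close>)
  next
    fix f g assume f: "f \<in> carrier (free_module R S)" and g: "g \<in> carrier (free_module R S)"
    define A where "A = {s. f s \<noteq> \<zero>\<^bsub>R\<^esub>} \<union> {s. g s \<noteq> \<zero>\<^bsub>R\<^esub>}"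
    have A: "finite A" "A \<subseteq> S" using f g by (auto simp: A_def free_module_carrier)
    have fg: "f \<oplus>\<^bsub>free_module R S\<^esub> g \<in> carrier (free_module R S)" using f g by (rule F.add.m_closed)
    have "L (f \<oplus>\<^bsub>free_module R S\<^esub> g) = ?L (f \<oplus>\<^bsub>free_module R S\<^esub> g) A"
      by (rule L[OF fg]) (use A f g in \<open>auto simp: A_def free_module_carrier\<close>)
    also have "\<dots> = (\<Oplus>\<^bsub>P\<^esub>s\<in>A. f s \<odot>\<^bsub>P\<^esub> b s \<oplus>\<^bsub>P\<^esub> g s \<odot>\<^bsub>P\<^esub> b s)"
      by (rule P.finsum_cong') (use f g A assms(2) in \<open>auto simp: free_module_carrier P.smult_l_distr subset_iff\<close>)
    also have "\<dots> = ?L f A \<oplus>\<^bsub>P\<^esub> ?L g A"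
      by (rule P.finsum_addf) (use Pi f g A in auto)
    also have "?L f A = L f" by (rule L[symmetric]) (use f A in \<open>auto simp: A_def\<close>)
    also have "?L g A = L g" by (rule L[symmetric]) (use g A in \<open>auto simp: A_def\<close>)
    finally show "L (f \<oplus>\<^bsub>free_module R S\<^esub> g) = L f \<oplus>\<^bsub>P\<^esub> L g" .
  next
    fix a f assume a: "a \<in> carrier R" and f: "f \<in> carrier (free_module R S)"
    define A where "A = {s. f s \<noteq> \<zero>\<^bsub>R\<^esub>}"
    have A: "finite A" "A \<subseteq> S" using f by (auto simp: A_def free_module_carrier)
    have af: "a \<odot>\<^bsub>free_module R S\<^esub> f \<in> carrier (free_module R S)" using a f by (rule F.smult_closed)
    have "L (a \<odot>\<^bsub>free_module R S\<^esub> f) = ?L (a \<odot>\<^bsub>free_module R S\<^esub> f) A"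
      by (rule L[OF af]) (use A a f in \<open>auto simp: A_def\<close>)
    also have "\<dots> = (\<Oplus>\<^bsub>P\<^esub>s\<in>A. a \<odot>\<^bsub>P\<^esub> (f s \<odot>\<^bsub>P\<^esub> b s))"
      by (rule P.finsum_cong') (use a f A assms(2) in \<open>auto simp: free_module_carrier P.smult_assoc1 subset_iff\<close>)
    also have "\<dots> = a \<odot>\<^bsub>P\<^esub> ?L f A"
      by (rule P.finsum_smult_ldistr[symmetric]) (use Pi f a A in auto)
    also have "?L f A = L f" by (simp add: L_def A_def)
    finally show "L (a \<odot>\<^bsub>free_module R S\<^esub> f) = a \<odot>\<^bsub>P\<^esub> L f" .
  qed
  fix s assume s: "s \<in> S"
  have gen: "free_gen R s \<in> carrier (free_module R S)" by (rule free_gen_closed[OF P.is_cring s])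
  have "L (free_gen R s) = ?L (free_gen R s) {s}"
    by (rule L[OF gen]) (use s in \<open>auto simp: free_gen_def\<close>)
  also have "\<dots> = b s" using s assms(2) by (simp add: free_gen_def)
  finally show "(\<lambda>f\<in>carrier (free_module R S). L f) (free_gen R s) = b s" using gen by simp
qed

section \<open>Quotient modules\<close>

lemma quotient_module_simps [simp]:
  "carrier (quotient_module M N) = a_rcosets\<^bsub>M\<^esub> N" "zero (quotient_module M N) = N"
  "add (quotient_module M N) = set_add M"
  "module.smult (quotient_module M N) = (\<lambda>a S. \<Union>v\<in>S. N +>\<^bsub>M\<^esub> (a \<odot>\<^bsub>M\<^esub> v))"
  by (simp_all add: quotient_module_def)

context
  fixes R (structure) and M (structure) and N
  assumes M: "module R M" and N: "submodule N R M"
begin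

interpretation module R M by (rule M)

interpretation N: abelian_subgroup N M
  using N by (intro abelian_subgroupI3 additive_subgroupI) (auto simp: submodule_def abelian_group_axioms)

lemma quotient_module_add: 
  "v \<in> carrier M \<Longrightarrow> w \<in> carrier M \<Longrightarrow> (N +>\<^bsub>M\<^esub> v) <+>\<^bsub>M\<^esub> (N +>\<^bsub>M\<^esub> w) = N +>\<^bsub>M\<^esub> (v \<oplus>\<^bsub>M\<^esub> w)"
  by (rule N.a_rcos_sum)

lemma quotient_module_eq_iff: 
  assumes "v \<in> carrier M" "w \<in> carrier M"
  shows "N +>\<^bsub>M\<^esub> v = N +>\<^bsub>M\<^esub> w \<longleftrightarrow> v \<ominus>\<^bsub>M\<^esub> w \<in> N"
proof -
  have "N +>\<^bsub>M\<^esub> v = N +>\<^bsub>M\<^esub> w \<longleftrightarrow> v \<in> N +>\<^bsub>M\<^esub> w"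
    using assms N.a_rcos_self[of v] N.a_repr_independence'[of v w] by auto
  also have "\<dots> \<longleftrightarrow> v \<ominus>\<^bsub>M\<^esub> w \<in> N"
    using assms by (simp add: N.a_rcos_module M.minus_eq)
  finally show ?thesis .
qed

text \<open>The scalar action on cosets is defined as a union over representatives; all of them contribute
  the same coset.\<close>

lemma quotient_module_smult:
  assumes "a \<in> carrier R" "v \<in> carrier M"
  shows "a \<odot>\<^bsub>quotient_module M N\<^esub> (N +>\<^bsub>M\<^esub> v) = N +>\<^bsub>M\<^esub> (a \<odot>\<^bsub>M\<^esub> v)"
proof -
  have "N +>\<^bsub>M\<^esub> (a \<odot>\<^bsub>M\<^esub> w) = N +>\<^bsub>M\<^esub> (a \<odot>\<^bsub>M\<^esub> v)" if w: "w \<in> N +>\<^bsub>M\<^esub> v" for w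
  proof -
    obtain n where n: "n \<in> N" "w = n \<oplus>\<^bsub>M\<^esub> v" using w unfolding a_r_coset_def' by auto
    have n': "n \<in> carrier M" using n N.a_subset by auto
    have "a \<odot>\<^bsub>M\<^esub> w \<ominus>\<^bsub>M\<^esub> a \<odot>\<^bsub>M\<^esub> v = a \<odot>\<^bsub>M\<^esub> n"
      using n n' assms by (simp add: smult_r_distr M.minus_eq M.a_assoc M.r_neg)
    also have "\<dots> \<in> N" using n assms N by (simp add: submodule.smult_closed)
    finally show ?thesis using assms n n' by (subst quotient_module_eq_iff) auto
  qed
  hence "a \<odot>\<^bsub>quotient_module M N\<^esub> (N +>\<^bsub>M\<^esub> v) =
      (\<Union>w\<in>N +>\<^bsub>M\<^esub> v. N +>\<^bsub>M\<^esub> (a \<odot>\<^bsub>M\<^esub> v))"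
    unfolding quotient_module_simps by (intro SUP_cong refl)
  also have "\<dots> = N +>\<^bsub>M\<^esub> (a \<odot>\<^bsub>M\<^esub> v)"
    using N.a_rcos_self[OF assms(2)] by auto
  finally show ?thesis .
qed

lemma quotient_module_cases:
  assumes "t \<in> carrier (quotient_module M N)"
  obtains v where "v \<in> carrier M" "t = N +>\<^bsub>M\<^esub> v"
  using assms that unfolding quotient_module_simps A_RCOSETS_def' by auto

lemma quotient_module_closed: "v \<in> carrier M \<Longrightarrow> N +>\<^bsub>M\<^esub> v \<in> carrier (quotient_module M N)"
  unfolding quotient_module_simps A_RCOSETS_def' by auto

lemma module_quotient_module: "module R (quotient_module M N)"
proof -
  note [simp del] = quotient_module_simps(4)
  have zero: "N = N +>\<^bsub>M\<^esub> \<zero>\<^bsub>M\<^esub>" by (simp add: N.a_subset)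
  show ?thesis
  proof (intro moduleI abelian_groupI R.is_cring)
    show "\<exists>y\<in>carrier (quotient_module M N). y \<oplus>\<^bsub>quotient_module M N\<^esub> t = \<zero>\<^bsub>quotient_module M N\<^esub>"
      if t: "t \<in> carrier (quotient_module M N)" for t
    proof -
      obtain v where v: "v \<in> carrier M" "t = N +>\<^bsub>M\<^esub> v" using quotient_module_cases[OF t] by blast
      show ?thesis using v
        by (intro bexI[of _ "N +>\<^bsub>M\<^esub> (\<ominus>\<^bsub>M\<^esub> v)"])
          (use zero quotient_module_closed in \<open>auto simp: quotient_module_add M.l_neg\<close>)
    qed
    show "\<zero>\<^bsub>quotient_module M N\<^esub> \<in> carrier (quotient_module M N)"
      using quotient_module_closed[of "\<zero>\<^bsub>M\<^esub>"] zero by simp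
    show "\<zero>\<^bsub>quotient_module M N\<^esub> \<oplus>\<^bsub>quotient_module M N\<^esub> t = t" if "t \<in> carrier (quotient_module M N)" for t
      using that by (elim quotient_module_cases) (subst zero, simp add: quotient_module_add)
  qed (use quotient_module_closed in \<open>auto elim!: quotient_module_cases
        simp: quotient_module_add quotient_module_smult smult_r_distr smult_l_distr smult_assoc1 M.a_ac
        simp del: quotient_module_simps(1)\<close>)
qed

lemma quotient_module_lift:
  assumes P: "module R P" and f: "f \<in> linear_maps R M P" and N0: "\<And>v. v \<in> N \<Longrightarrow> f v = \<zero>\<^bsub>P\<^esub>"
  obtains g where "g \<in> linear_maps R (quotient_module M N) P"
    and "\<And>v. v \<in> carrier M \<Longrightarrow> g (N +>\<^bsub>M\<^esub> v) = f v"
proof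
  interpret P: module R P by fact
  note [simp del] = quotient_module_simps
  define g where "g = (\<lambda>t\<in>carrier (quotient_module M N). f (SOME v. v \<in> carrier M \<and> t = N +>\<^bsub>M\<^esub> v))"
  show g: "g (N +>\<^bsub>M\<^esub> v) = f v" if v: "v \<in> carrier M" for v
  proof -
    define w where "w = (SOME w. w \<in> carrier M \<and> N +>\<^bsub>M\<^esub> v = N +>\<^bsub>M\<^esub> w)"
    have w: "w \<in> carrier M \<and> N +>\<^bsub>M\<^esub> v = N +>\<^bsub>M\<^esub> w"
      unfolding w_def by (rule someI[of _ v]) (use v in auto)
    hence "f (w \<oplus>\<^bsub>M\<^esub> \<ominus>\<^bsub>M\<^esub> v) = \<zero>\<^bsub>P\<^esub>" using v quotient_module_eq_iff[of w v] N0 by (simp add: M.minus_eq)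
    hence "f w \<oplus>\<^bsub>P\<^esub> \<ominus>\<^bsub>P\<^esub> f v = \<zero>\<^bsub>P\<^esub>"
      using v w by (simp add: linear_maps_add[OF f] linear_maps_minus[OF M P f])
    hence "f w = f v" using v w linear_maps_closed[OF f] P.minus_equality[of "f w" "\<ominus>\<^bsub>P\<^esub> f v"] by simp
    thus ?thesis using quotient_module_closed[OF v] by (simp add: g_def w_def)
  qed
  show "g \<in> linear_maps R (quotient_module M N) P"
  proof (rule linear_mapsI)
    fix t assume "t \<in> carrier (quotient_module M N)"
    thus "g t \<in> carrier P" by (elim quotient_module_cases) (auto simp: g linear_maps_closed[OF f])
  next
    fix t assume "t \<notin> carrier (quotient_module M N)"
    thus "g t = undefined" by (simp add: g_def)
  next
    fix s t assume "s \<in> carrier (quotient_module M N)" "t \<in> carrier (quotient_module M N)"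
    thus "g (s \<oplus>\<^bsub>quotient_module M N\<^esub> t) = g s \<oplus>\<^bsub>P\<^esub> g t"
      by (elim quotient_module_cases)
        (auto simp: quotient_module_simps(3) quotient_module_add g linear_maps_add[OF f])
  next
    fix a t assume "a \<in> carrier R" "t \<in> carrier (quotient_module M N)"
    thus "g (a \<odot>\<^bsub>quotient_module M N\<^esub> t) = a \<odot>\<^bsub>P\<^esub> g t"
      by (elim quotient_module_cases) (auto simp: quotient_module_smult g linear_maps_smult[OF f])
  qed
qed

end

section \<open>Tensor products\<close>

lemma tensor_lift_cong:
  assumes "\<And>m n. m \<in> carrier M \<Longrightarrow> n \<in> carrier N \<Longrightarrow> b m n = c m n"
  shows "tensor_lift R M N P b = tensor_lift R M N P c"
proof -
  have "(\<forall>m\<in>carrier M. \<forall>n\<in>carrier N. f (pure_tensor R M N m n) = b m n) \<longleftrightarrow>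
      (\<forall>m\<in>carrier M. \<forall>n\<in>carrier N. f (pure_tensor R M N m n) = c m n)" for f
    using assms by auto
  thus ?thesis by (simp add: tensor_lift_def)
qed

definition bilinear ::
  "('r, 'x) ring_scheme \<Rightarrow> ('r, 'a, 'y) module_scheme \<Rightarrow> ('r, 'b, 'z) module_scheme
    \<Rightarrow> ('r, 'c, 'w) module_scheme \<Rightarrow> ('a \<Rightarrow> 'b \<Rightarrow> 'c) \<Rightarrow> bool"
  where "bilinear R M N P b \<longleftrightarrow>
    (\<forall>m\<in>carrier M. \<forall>n\<in>carrier N. b m n \<in> carrier P) \<and>
    (\<forall>m\<in>carrier M. \<forall>m'\<in>carrier M. \<forall>n\<in>carrier N. b (m \<oplus>\<^bsub>M\<^esub> m') n = b m n \<oplus>\<^bsub>P\<^esub> b m' n) \<and>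
    (\<forall>m\<in>carrier M. \<forall>n\<in>carrier N. \<forall>n'\<in>carrier N. b m (n \<oplus>\<^bsub>N\<^esub> n') = b m n \<oplus>\<^bsub>P\<^esub> b m n') \<and>
    (\<forall>a\<in>carrier R. \<forall>m\<in>carrier M. \<forall>n\<in>carrier N. b (a \<odot>\<^bsub>M\<^esub> m) n = a \<odot>\<^bsub>P\<^esub> b m n) \<and>
    (\<forall>a\<in>carrier R. \<forall>m\<in>carrier M. \<forall>n\<in>carrier N. b m (a \<odot>\<^bsub>N\<^esub> n) = a \<odot>\<^bsub>P\<^esub> b m n)"

context
  fixes R (structure) and M (structure) and N
  assumes M: "module R M" and N: "module R N"
begin

interpretation M: module R M by (rule M)
interpretation N: module R N by (rule N)

private abbreviation "F \<equiv> free_module R (carrier M \<times> carrier N)"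

interpretation F: module R F by (rule module_free_module) (rule M.R.is_cring)

lemma tensor_relations_closed: "tensor_relations R M N \<subseteq> carrier F"
proof -
  have e: "free_gen R (m, n) \<in> carrier F" if "m \<in> carrier M" "n \<in> carrier N" for m n
    using that by (intro free_gen_closed M.R.is_cring) auto
  show ?thesis
    unfolding tensor_relations_def Let_def
    by (auto simp del: free_module_simps simp: e)
qed

lemma submodule_tensor_kernel: "submodule (tensor_kernel R M N) R F"
proof -
  let ?X = "{H. submodule H R F \<and> tensor_relations R M N \<subseteq> H}"
  have car: "carrier F \<in> ?X"
    using tensor_relations_closed F.carrier_is_submodule by auto
  show ?thesis unfolding tensor_kernel_def submodule_generated_def
  proof (rule F.submoduleI)
    show "\<Inter>?X \<subseteq> carrier F" using car by blast
    show "\<zero>\<^bsub>F\<^esub> \<in> \<Inter>?X" by (auto simp del: free_module_simps dest!: submodule.axioms(1) dest: subgroup.one_closed)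
  qed (auto simp del: free_module_simps simp: F.submoduleE)
qed

lemma tensor_kernel_least:
  assumes "submodule H R F" "tensor_relations R M N \<subseteq> H"
  shows "tensor_kernel R M N \<subseteq> H"
  using assms by (auto simp: tensor_kernel_def submodule_generated_def)

lemma tensor_relations_kernel: "tensor_relations R M N \<subseteq> tensor_kernel R M N"
  by (auto simp: tensor_kernel_def submodule_generated_def)

lemma module_tensor: "module R (tensor R M N)"
  unfolding tensor_def by (rule module_quotient_module[OF F.module_axioms submodule_tensor_kernel])

interpretation T: module R "tensor R M N" by (rule module_tensor)

lemma pure_tensor_bilinear: "bilinear R M N (tensor R M N) (pure_tensor R M N)"
proof -
  let ?e = "\<lambda>m n. free_gen R (m, n)" and ?q = "\<lambda>v. tensor_kernel R M N +>\<^bsub>F\<^esub> v"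
  have e: "?e m n \<in> carrier F" if "m \<in> carrier M" "n \<in> carrier N" for m n
    using that by (intro free_gen_closed M.R.is_cring) auto
  note simps = e pure_tensor_def tensor_def
    quotient_module_add[OF F.module_axioms submodule_tensor_kernel]
    quotient_module_smult[OF F.module_axioms submodule_tensor_kernel]
  have eq: "?q v = ?q w" if "v \<ominus>\<^bsub>F\<^esub> w \<in> tensor_relations R M N" "v \<in> carrier F" "w \<in> carrier F" for v w
    using that tensor_relations_kernel
    by (subst quotient_module_eq_iff[OF F.module_axioms submodule_tensor_kernel]) auto
  note [simp del] = free_module_simps quotient_module_simps(4)
  have "pure_tensor R M N m n \<in> carrier (tensor R M N)" if "m \<in> carrier M" "n \<in> carrier N" for m n
    unfolding pure_tensor_def tensor_def
    by (rule quotient_module_closed[OF F.module_axioms submodule_tensor_kernel]) (rule e[OF that])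
  moreover have "?q (?e (m \<oplus>\<^bsub>M\<^esub> m') n) = ?q (?e m n \<oplus>\<^bsub>F\<^esub> ?e m' n)"
    if "m \<in> carrier M" "m' \<in> carrier M" "n \<in> carrier N" for m m' n
    by (rule eq, unfold tensor_relations_def Let_def, use that in blast, use that e in auto)
  moreover have "?q (?e m (n \<oplus>\<^bsub>N\<^esub> n')) = ?q (?e m n \<oplus>\<^bsub>F\<^esub> ?e m n')"
    if "m \<in> carrier M" "n \<in> carrier N" "n' \<in> carrier N" for m n n'
    by (rule eq, unfold tensor_relations_def Let_def, use that in blast, use that e in auto)
  moreover have "?q (?e (a \<odot>\<^bsub>M\<^esub> m) n) = ?q (a \<odot>\<^bsub>F\<^esub> ?e m n)"
    if "a \<in> carrier R" "m \<in> carrier M" "n \<in> carrier N" for a m n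
    by (rule eq, unfold tensor_relations_def Let_def, use that in blast, use that e in auto)
  moreover have "?q (?e m (a \<odot>\<^bsub>N\<^esub> n)) = ?q (a \<odot>\<^bsub>F\<^esub> ?e m n)"
    if "a \<in> carrier R" "m \<in> carrier M" "n \<in> carrier N" for a m n
    by (rule eq, unfold tensor_relations_def Let_def, use that in blast, use that e in auto)
  ultimately show ?thesis
    unfolding bilinear_def by (simp add: simps)
qed

lemma pure_tensor_closed [simp]:
  "m \<in> carrier M \<Longrightarrow> n \<in> carrier N \<Longrightarrow> pure_tensor R M N m n \<in> carrier (tensor R M N)"
  and pure_tensor_add_left: "m \<in> carrier M \<Longrightarrow> m' \<in> carrier M \<Longrightarrow> n \<in> carrier N \<Longrightarrow>
    pure_tensor R M N (m \<oplus>\<^bsub>M\<^esub> m') n =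
      pure_tensor R M N m n \<oplus>\<^bsub>tensor R M N\<^esub> pure_tensor R M N m' n"
  and pure_tensor_add_right: "m \<in> carrier M \<Longrightarrow> n \<in> carrier N \<Longrightarrow> n' \<in> carrier N \<Longrightarrow>
    pure_tensor R M N m (n \<oplus>\<^bsub>N\<^esub> n') =
      pure_tensor R M N m n \<oplus>\<^bsub>tensor R M N\<^esub> pure_tensor R M N m n'"
  and pure_tensor_smult_left: "a \<in> carrier R \<Longrightarrow> m \<in> carrier M \<Longrightarrow> n \<in> carrier N \<Longrightarrow>
    pure_tensor R M N (a \<odot>\<^bsub>M\<^esub> m) n = a \<odot>\<^bsub>tensor R M N\<^esub> pure_tensor R M N m n"
  and pure_tensor_smult_right: "a \<in> carrier R \<Longrightarrow> m \<in> carrier M \<Longrightarrow> n \<in> carrier N \<Longrightarrow>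
    pure_tensor R M N m (a \<odot>\<^bsub>N\<^esub> n) = a \<odot>\<^bsub>tensor R M N\<^esub> pure_tensor R M N m n"
  using pure_tensor_bilinear unfolding bilinear_def by blast+

lemma tensor_induct [consumes 1, case_names zero add pure]:
  assumes t: "t \<in> carrier (tensor R M N)"
    and zero: "P \<zero>\<^bsub>tensor R M N\<^esub>"
    and add: "\<And>s t. s \<in> carrier (tensor R M N) \<Longrightarrow> t \<in> carrier (tensor R M N) \<Longrightarrow> P s \<Longrightarrow> P t \<Longrightarrow>
      P (s \<oplus>\<^bsub>tensor R M N\<^esub> t)"
    and pure: "\<And>m n. m \<in> carrier M \<Longrightarrow> n \<in> carrier N \<Longrightarrow> P (pure_tensor R M N m n)"
  shows "P t"
proof -
  let ?q = "\<lambda>v. tensor_kernel R M N +>\<^bsub>F\<^esub> v"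
  note sub = F.module_axioms submodule_tensor_kernel
  note [simp del] = quotient_module_simps(4)
  have closed: "?q v \<in> carrier (tensor R M N)" if "v \<in> carrier F" for v
    unfolding tensor_def by (rule quotient_module_closed[OF sub that])
  have "P (?q v)" if "v \<in> carrier F" for v
    using M.R.is_cring that
  proof (induction v rule: free_module_induct)
    case zero
    have "?q \<zero>\<^bsub>F\<^esub> = \<zero>\<^bsub>tensor R M N\<^esub>"
      using F.submoduleE(1)[OF submodule_tensor_kernel] 
      by (subst F.a_coset_add_zero) (auto simp: tensor_def)
    thus ?case using assms(2) by simp
  next
    case (add f g)
    have "?q (f \<oplus>\<^bsub>F\<^esub> g) = ?q f \<oplus>\<^bsub>tensor R M N\<^esub> ?q g"
      using quotient_module_add[OF sub add(1,2)] by (simp add: tensor_def)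
    thus ?case using assms(3)[OF closed[OF add(1)] closed[OF add(2)] add(3,4)] by simp
  next
    case (gen a s)
    then obtain m n where s: "s = (m, n)" and mn: "m \<in> carrier M" "n \<in> carrier N" by auto
    have "?q (a \<odot>\<^bsub>F\<^esub> free_gen R s) = a \<odot>\<^bsub>tensor R M N\<^esub> pure_tensor R M N m n"
      using quotient_module_smult[OF sub gen(1), of "free_gen R s"] free_gen_closed[OF M.R.is_cring gen(2)]
      by (simp add: tensor_def pure_tensor_def s)
    also have "\<dots> = pure_tensor R M N (a \<odot>\<^bsub>M\<^esub> m) n"
      using pure_tensor_smult_left gen mn by simp
    finally show ?case using assms(4) gen mn by simp
  qed
  moreover obtain v where "v \<in> carrier F" "t = ?q v"
    using quotient_module_cases[OF sub] t unfolding tensor_def by blast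
  ultimately show ?thesis by simp
qed

lemma linear_maps_tensor_eqI:
  assumes P: "module R P" and "f \<in> linear_maps R (tensor R M N) P" "g \<in> linear_maps R (tensor R M N) P"
    and "\<And>m n. m \<in> carrier M \<Longrightarrow> n \<in> carrier N \<Longrightarrow>
      f (pure_tensor R M N m n) = g (pure_tensor R M N m n)"
  shows "f = g"
proof (rule linear_maps_eqI[OF assms(2,3)])
  fix t assume "t \<in> carrier (tensor R M N)"
  thus "f t = g t"
    by (induction rule: tensor_induct)
      (simp_all add: assms(4) linear_maps_zero[OF module_tensor P assms(2)] linear_maps_zero[OF module_tensor P assms(3)]
        linear_maps_add[OF assms(2)] linear_maps_add[OF assms(3)])
qed

text \<open>The universal property. The extension of \<open>b\<close> to the free module on pairs kills the relations
  because \<open>b\<close> is bilinear; its kernel is a submodule, hence contains the submodule that they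
  generate.\<close>

lemma
  assumes P: "module R P" and b: "bilinear R M N P b"
  shows tensor_lift_linear: "tensor_lift R M N P b \<in> linear_maps R (tensor R M N) P"
    and tensor_lift_pure: "m \<in> carrier M \<Longrightarrow> n \<in> carrier N \<Longrightarrow>
      tensor_lift R M N P b (pure_tensor R M N m n) = b m n"
proof -
  interpret P: module R P by (rule P)
  let ?e = "\<lambda>m n. free_gen R (m, n)"
  have e: "?e m n \<in> carrier F" if "m \<in> carrier M" "n \<in> carrier N" for m n
    using that by (intro free_gen_closed M.R.is_cring) auto
  obtain f where f: "f \<in> linear_maps R F P"
    and fe: "\<And>s. s \<in> carrier M \<times> carrier N \<Longrightarrow> f (free_gen R s) = (case s of (m, n) \<Rightarrow> b m n)"
    using b by (auto simp: bilinear_def intro: free_module_lift[OF P, of "carrier M \<times> carrier N" "\<lambda>(m, n). b m n"])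
  note fs = linear_maps_add[OF f] linear_maps_minus[OF F.module_axioms P f] linear_maps_smult[OF f]
  note [simp del] = free_module_simps
  have "tensor_relations R M N \<subseteq> {v \<in> carrier F. f v = \<zero>\<^bsub>P\<^esub>}"
    using b unfolding tensor_relations_def Let_def bilinear_def
    by (auto simp: e fe fs F.minus_eq P.r_neg)
  hence "tensor_kernel R M N \<subseteq> {v \<in> carrier F. f v = \<zero>\<^bsub>P\<^esub>}"
    by (intro tensor_kernel_least submodule_kernel[OF F.module_axioms P f])
  then obtain g where g: "g \<in> linear_maps R (tensor R M N) P"
    and gq: "\<And>v. v \<in> carrier F \<Longrightarrow> g (tensor_kernel R M N +>\<^bsub>F\<^esub> v) = f v"
    using quotient_module_lift[OF F.module_axioms submodule_tensor_kernel P f]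
    unfolding tensor_def by blast
  have "\<exists>!f. f \<in> linear_maps R (tensor R M N) P \<and>
      (\<forall>m\<in>carrier M. \<forall>n\<in>carrier N. f (pure_tensor R M N m n) = b m n)"
  proof (rule ex1I[of _ g])
    show "g \<in> linear_maps R (tensor R M N) P \<and>
      (\<forall>m\<in>carrier M. \<forall>n\<in>carrier N. g (pure_tensor R M N m n) = b m n)"
      using g by (auto simp: pure_tensor_def gq e fe)
    fix h assume "h \<in> linear_maps R (tensor R M N) P \<and>
      (\<forall>m\<in>carrier M. \<forall>n\<in>carrier N. h (pure_tensor R M N m n) = b m n)"
    thus "h = g" using g by (intro linear_maps_tensor_eqI[OF P]) (auto simp: pure_tensor_def gq e fe)
  qed
  from theI'[OF this, folded tensor_lift_def]
  show "tensor_lift R M N P b \<in> linear_maps R (tensor R M N) P"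
    and "m \<in> carrier M \<Longrightarrow> n \<in> carrier N \<Longrightarrow> tensor_lift R M N P b (pure_tensor R M N m n) = b m n"
    by auto
qed

lemma tensor_lift_closed:
  "module R P \<Longrightarrow> bilinear R M N P b \<Longrightarrow> t \<in> carrier (tensor R M N) \<Longrightarrow> tensor_lift R M N P b t \<in> carrier P"
  by (rule linear_maps_closed[OF tensor_lift_linear])

lemma tensor_lift_eqI:
  assumes "module R P" "bilinear R M N P b" "f \<in> linear_maps R (tensor R M N) P"
    and "\<And>m n. m \<in> carrier M \<Longrightarrow> n \<in> carrier N \<Longrightarrow> f (pure_tensor R M N m n) = b m n"
  shows "tensor_lift R M N P b = f"
  by (rule linear_maps_tensor_eqI[OF assms(1) tensor_lift_linear[OF assms(1,2)] assms(3)])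
    (simp add: tensor_lift_pure[OF assms(1,2)] assms(4))

lemma bilinear_comp:
  assumes "bilinear R M N P b" "f \<in> linear_maps R P P'"
  shows "bilinear R M N P' (\<lambda>m n. f (b m n))"
  using assms(1)
  by (auto simp: bilinear_def linear_maps_closed[OF assms(2)] linear_maps_add[OF assms(2)]
      linear_maps_smult[OF assms(2)])

text \<open>Applied to an evaluation \<open>f\<close>, this moves the evaluation inside a lift and so turns identities
  between elements of tensor products into identities between values of functions.\<close>

lemma tensor_lift_comp:
  assumes P: "module R P" "module R P'" and b: "bilinear R M N P b" and f: "f \<in> linear_maps R P P'"
    and t: "t \<in> carrier (tensor R M N)"
  shows "f (tensor_lift R M N P b t) = tensor_lift R M N P' (\<lambda>m n. f (b m n)) t"
proof -
  have "tensor_lift R M N P' (\<lambda>m n. f (b m n)) =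
      (\<lambda>t\<in>carrier (tensor R M N). f (tensor_lift R M N P b t))"
    by (rule tensor_lift_eqI[OF P(2) bilinear_comp[OF b f]])
      (auto intro!: linear_maps_comp[OF T.module_axioms tensor_lift_linear[OF P(1) b] f]
        simp: tensor_lift_pure[OF P(1) b] pure_tensor_closed)
  thus ?thesis using t by simp
qed

lemma tensor_lift_sum:
  assumes P: "module R P" and b: "bilinear R M N P b" and c: "bilinear R M N P c" and d: "bilinear R M N P d"
    and sum: "\<And>m n. m \<in> carrier M \<Longrightarrow> n \<in> carrier N \<Longrightarrow> d m n = b m n \<oplus>\<^bsub>P\<^esub> c m n"
    and t: "t \<in> carrier (tensor R M N)"
  shows "tensor_lift R M N P d t = tensor_lift R M N P b t \<oplus>\<^bsub>P\<^esub> tensor_lift R M N P c t"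
proof -
  interpret P: module R P by (rule P)
  show ?thesis using t
    by (induction rule: tensor_induct)
      (simp_all add: linear_maps_zero[OF module_tensor P tensor_lift_linear[OF P]]
       linear_maps_add[OF tensor_lift_linear[OF P]] tensor_lift_pure[OF P] tensor_lift_closed[OF P] b c d sum P.a_ac)
qed

lemma tensor_lift_smult:
  assumes P: "module R P" and b: "bilinear R M N P b" and d: "bilinear R M N P d" and a: "a \<in> carrier R"
    and sum: "\<And>m n. m \<in> carrier M \<Longrightarrow> n \<in> carrier N \<Longrightarrow> d m n = a \<odot>\<^bsub>P\<^esub> b m n"
    and t: "t \<in> carrier (tensor R M N)"
  shows "tensor_lift R M N P d t = a \<odot>\<^bsub>P\<^esub> tensor_lift R M N P b t"
proof -
  interpret P: module R P by (rule P)
  show ?thesis using t a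
    by (induction rule: tensor_induct)
      (simp_all add: linear_maps_zero[OF module_tensor P tensor_lift_linear[OF P]]
       linear_maps_add[OF tensor_lift_linear[OF P]] tensor_lift_pure[OF P] tensor_lift_closed[OF P] b d sum P.smult_r_distr)
qed

end

text \<open>Two lemmas on nested lifts. A trilinear map, lifted along two of its arguments, is bilinear in
  the tensor and in the third argument; the associator has this form.\<close>

lemma bilinear_tensor_lift:
  assumes M: "module R M" and N: "module R N" and L: "module R L" and P: "module R P"
    and mn: "\<And>p. p \<in> carrier L \<Longrightarrow> bilinear R M N P (\<lambda>m n. b m n p)"
    and p: "\<And>m. m \<in> carrier M \<Longrightarrow> bilinear R N L P (\<lambda>n p. b m n p)"
  shows "bilinear R (tensor R M N) L P (\<lambda>t p. tensor_lift R M N P (\<lambda>m n. b m n p) t)"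
proof -
  interpret M: module R M by (rule M)
  interpret L: module R L by (rule L)
  note lin = tensor_lift_linear[OF M N P mn]
  show ?thesis
    unfolding bilinear_def
  proof (intro conjI ballI)
    fix t p q assume t: "t \<in> carrier (tensor R M N)" and pq: "p \<in> carrier L" "q \<in> carrier L"
    show "tensor_lift R M N P (\<lambda>m n. b m n (p \<oplus>\<^bsub>L\<^esub> q)) t =
      tensor_lift R M N P (\<lambda>m n. b m n p) t \<oplus>\<^bsub>P\<^esub> tensor_lift R M N P (\<lambda>m n. b m n q) t"
      by (rule tensor_lift_sum[OF M N P mn mn mn]) (use t pq p in \<open>auto simp: bilinear_def\<close>)
  next
    fix a t p assume a: "a \<in> carrier R" and t: "t \<in> carrier (tensor R M N)" and pq: "p \<in> carrier L"
    show "tensor_lift R M N P (\<lambda>m n. b m n (a \<odot>\<^bsub>L\<^esub> p)) t = a \<odot>\<^bsub>P\<^esub> tensor_lift R M N P (\<lambda>m n. b m n p) t"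
      by (rule tensor_lift_smult[OF M N P mn mn]) (use a t pq p in \<open>auto simp: bilinear_def\<close>)
  qed (auto simp: linear_maps_add[OF lin] linear_maps_smult[OF lin] linear_maps_closed[OF lin])
qed

text \<open>Here the tensor is fixed and the lifted bilinear map varies, as for one factor of the product
  of two tensors.\<close>

lemma bilinear_tensor_lift_parameter:
  assumes M: "module R M" and N: "module R N" and P: "module R P"
    and mn: "\<And>f g. f \<in> carrier A \<Longrightarrow> g \<in> carrier B \<Longrightarrow> bilinear R M N P (b f g)"
    and fg: "\<And>m n. m \<in> carrier M \<Longrightarrow> n \<in> carrier N \<Longrightarrow> bilinear R A B P (\<lambda>f g. b f g m n)"
    and A: "module R A" and B: "module R B" and t: "t \<in> carrier (tensor R M N)"
  shows "bilinear R A B P (\<lambda>f g. tensor_lift R M N P (b f g) t)"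
proof -
  interpret A: module R A by (rule A)
  interpret B: module R B by (rule B)
  show ?thesis
    unfolding bilinear_def
  proof (intro conjI ballI)
    fix f g assume "f \<in> carrier A" "g \<in> carrier B"
    thus "tensor_lift R M N P (b f g) t \<in> carrier P"
      by (intro tensor_lift_closed[OF M N P mn t])
  qed (rule tensor_lift_sum[OF M N P mn mn mn _ t] tensor_lift_smult[OF M N P mn mn _ _ t];
       use fg in \<open>auto simp: bilinear_def\<close>)+
qed

section \<open>Separating functionals on tensor products\<close>

primrec tensor_sum ::
  "('r, 'x) ring_scheme \<Rightarrow> ('r, 'a, 'y) module_scheme \<Rightarrow> ('r, 'b, 'z) module_scheme
    \<Rightarrow> ('a \<times> 'b) list \<Rightarrow> ('a \<times> 'b \<Rightarrow> 'r) set"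
  where
    "tensor_sum R M N [] = \<zero>\<^bsub>tensor R M N\<^esub>"
  | "tensor_sum R M N (p # ps) =
      pure_tensor R M N (fst p) (snd p) \<oplus>\<^bsub>tensor R M N\<^esub> tensor_sum R M N ps"

context
  fixes R (structure) and M (structure) and N
  assumes R: "field R" and M: "module R M" and N: "module R N"
begin

interpretation R: field R by (rule R)
interpretation M: module R M by (rule M)
interpretation N: module R N by (rule N)
interpretation T: module R "tensor R M N" by (rule module_tensor[OF M N])

private abbreviation "K \<equiv> regular_module R"

private lemma K: "module R K" by (rule module_regular_module) (rule R.is_cring)

lemma tensor_sum_closed:
  "set ps \<subseteq> carrier M \<times> carrier N \<Longrightarrow> tensor_sum R M N ps \<in> carrier (tensor R M N)"
  by (induction ps) (auto intro!: T.add.m_closed pure_tensor_closed[OF M N])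

lemma tensor_sum_append:
  "set ps \<subseteq> carrier M \<times> carrier N \<Longrightarrow> set qs \<subseteq> carrier M \<times> carrier N \<Longrightarrow>
    tensor_sum R M N (ps @ qs) = tensor_sum R M N ps \<oplus>\<^bsub>tensor R M N\<^esub> tensor_sum R M N qs"
  by (induction ps) (auto simp: tensor_sum_closed pure_tensor_closed[OF M N] T.a_assoc)

lemma tensor_as_sum:
  assumes "t \<in> carrier (tensor R M N)"
  obtains ps where "set ps \<subseteq> carrier M \<times> carrier N" "t = tensor_sum R M N ps"
proof -
  from assms have "\<exists>ps. set ps \<subseteq> carrier M \<times> carrier N \<and> t = tensor_sum R M N ps"
  proof (induction rule: tensor_induct[OF M N, consumes 1, case_names zero add pure])
    case zero
    show ?case by (rule exI[of _ "[]"]) simp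
  next
    case (add s t)
    then obtain ps qs where "set ps \<subseteq> carrier M \<times> carrier N" "s = tensor_sum R M N ps"
      "set qs \<subseteq> carrier M \<times> carrier N" "t = tensor_sum R M N qs" by blast
    thus ?case by (intro exI[of _ "ps @ qs"]) (auto simp: tensor_sum_append)
  next
    case (pure m n)
    thus ?case by (intro exI[of _ "[(m, n)]"]) (auto simp: pure_tensor_closed[OF M N])
  qed
  thus ?thesis using that by blast
qed

lemma bilinear_functionals:
  assumes "\<phi> \<in> linear_maps R M K" "\<psi> \<in> linear_maps R N K"
  shows "bilinear R M N K (\<lambda>m n. \<phi> m \<otimes> \<psi> n)"
  using linear_maps_closed[OF assms(1)] linear_maps_closed[OF assms(2)]
  by (auto simp: bilinear_def linear_maps_add[OF assms(1)] linear_maps_add[OF assms(2)]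
    linear_maps_smult[OF assms(1)] linear_maps_smult[OF assms(2)] R.l_distr R.r_distr R.m_ac)

text \<open>The linear map that this induces on the tensor product is \<open>\<phi> \<otimes> id\<close>, contraction of the left
  factor by \<open>\<phi>\<close>.\<close>

lemma bilinear_contraction:
  assumes "\<phi> \<in> linear_maps R M K"
  shows "bilinear R M N N (\<lambda>m n. \<phi> m \<odot>\<^bsub>N\<^esub> n)"
  using linear_maps_closed[OF assms]
  by (auto simp: bilinear_def linear_maps_add[OF assms] linear_maps_smult[OF assms]
    N.smult_l_distr N.smult_r_distr N.smult_assoc1 R.m_comm simp flip: N.smult_assoc1)

lemma functional_contraction:
  assumes "\<phi> \<in> linear_maps R M K" "\<psi> \<in> linear_maps R N K" "t \<in> carrier (tensor R M N)"
  shows "\<psi> (tensor_lift R M N N (\<lambda>m n. \<phi> m \<odot>\<^bsub>N\<^esub> n) t) = tensor_lift R M N K (\<lambda>m n. \<phi> m \<otimes> \<psi> n) t"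
proof -
  note b = bilinear_contraction[OF assms(1)]
  have "tensor_lift R M N K (\<lambda>m n. \<phi> m \<otimes> \<psi> n) =
      (\<lambda>t\<in>carrier (tensor R M N). \<psi> (tensor_lift R M N N (\<lambda>m n. \<phi> m \<odot>\<^bsub>N\<^esub> n) t))"
    by (rule tensor_lift_eqI[OF M N K bilinear_functionals[OF assms(1,2)]])
      (auto intro!: linear_maps_comp[OF T.module_axioms tensor_lift_linear[OF M N N b] assms(2)]
        simp: pure_tensor_closed[OF M N] tensor_lift_pure[OF M N N b] linear_maps_smult[OF assms(2)]
          linear_maps_closed[OF assms(1), simplified])
  thus ?thesis using assms(3) by simp
qed

text \<open>With \<open>a\<close> the inverse of \<open>\<phi> m\<close> this is an elimination step: every left factor loses the multiple
  of \<open>m\<close> that brings it into the kernel of \<open>\<phi>\<close>, and the correction is a multiple of \<open>m\<close> tensored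
  with the contraction of the sum.\<close>

lemma tensor_sum_eliminate:
  assumes phi: "\<phi> \<in> linear_maps R M K" and a: "a \<in> carrier R" and m: "m \<in> carrier M"
    and ps: "set ps \<subseteq> carrier M \<times> carrier N"
  shows "tensor_sum R M N (map (\<lambda>(m', n). (m' \<ominus>\<^bsub>M\<^esub> (a \<otimes> \<phi> m') \<odot>\<^bsub>M\<^esub> m, n)) ps) =
    tensor_sum R M N ps \<ominus>\<^bsub>tensor R M N\<^esub>
      a \<odot>\<^bsub>tensor R M N\<^esub> pure_tensor R M N m
        (tensor_lift R M N N (\<lambda>m n. \<phi> m \<odot>\<^bsub>N\<^esub> n) (tensor_sum R M N ps))"
proof -
  let ?T = "tensor R M N" and ?p = "pure_tensor R M N"
  let ?C = "tensor_lift R M N N (\<lambda>m n. \<phi> m \<odot>\<^bsub>N\<^esub> n)"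
  note bil = bilinear_contraction[OF phi]
  note C = linear_maps_zero[OF T.module_axioms N tensor_lift_linear[OF M N N bil]]
    linear_maps_add[OF tensor_lift_linear[OF M N N bil]] tensor_lift_pure[OF M N N bil]
    tensor_lift_closed[OF M N N bil]
  note p = pure_tensor_closed[OF M N] pure_tensor_add_left[OF M N] pure_tensor_add_right[OF M N]
    pure_tensor_smult_left[OF M N] pure_tensor_smult_right[OF M N]
  have phi_closed: "\<phi> m \<in> carrier R" if "m \<in> carrier M" for m
    using linear_maps_closed[OF phi that] by simp
  show ?thesis using ps
  proof (induction ps)
    case Nil
    have "?p m (\<zero> \<odot>\<^bsub>N\<^esub> \<zero>\<^bsub>N\<^esub>) = \<zero>\<^bsub>?T\<^esub>" using m by (simp only: p R.zero_closed N.zero_closed T.smult_l_null)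
    moreover have "\<zero>\<^bsub>?T\<^esub> \<ominus>\<^bsub>?T\<^esub> \<zero>\<^bsub>?T\<^esub> = \<zero>\<^bsub>?T\<^esub>"
      by (simp only: T.minus_eq T.r_neg T.zero_closed)
    ultimately show ?case using a by (simp add: C)
  next
    case (Cons q qs)
    obtain m' n where q: "q = (m', n)" by (cases q)
    have m': "m' \<in> carrier M" and n: "n \<in> carrier N" and qs: "set qs \<subseteq> carrier M \<times> carrier N"
      using Cons.prems by (auto simp: q)
    define S where "S = tensor_sum R M N qs"
    have S: "S \<in> carrier ?T" unfolding S_def by (rule tensor_sum_closed[OF qs])
    have CS: "?C S \<in> carrier N" using S by (rule C)
    have af: "a \<otimes> \<phi> m' \<in> carrier R" using a m' phi_closed by simp
    have "?p (m' \<ominus>\<^bsub>M\<^esub> (a \<otimes> \<phi> m') \<odot>\<^bsub>M\<^esub> m) n = ?p (m' \<oplus>\<^bsub>M\<^esub> (\<ominus> (a \<otimes> \<phi> m')) \<odot>\<^bsub>M\<^esub> m) n"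
      using m m' af by (simp add: M.minus_eq M.smult_l_minus)
    also have "\<dots> = ?p m' n \<ominus>\<^bsub>?T\<^esub> (a \<otimes> \<phi> m') \<odot>\<^bsub>?T\<^esub> ?p m n"
      using m m' n af by (simp add: p T.minus_eq T.smult_l_minus)
    finally have left: "?p (m' \<ominus>\<^bsub>M\<^esub> (a \<otimes> \<phi> m') \<odot>\<^bsub>M\<^esub> m) n =
      ?p m' n \<ominus>\<^bsub>?T\<^esub> (a \<otimes> \<phi> m') \<odot>\<^bsub>?T\<^esub> ?p m n" .
    have "a \<odot>\<^bsub>?T\<^esub> ?p m (?C (?p m' n \<oplus>\<^bsub>?T\<^esub> S)) = a \<odot>\<^bsub>?T\<^esub> ?p m (\<phi> m' \<odot>\<^bsub>N\<^esub> n \<oplus>\<^bsub>N\<^esub> ?C S)"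
      using m m' n S by (simp add: C p)
    also have "\<dots> = (a \<otimes> \<phi> m') \<odot>\<^bsub>?T\<^esub> ?p m n \<oplus>\<^bsub>?T\<^esub> a \<odot>\<^bsub>?T\<^esub> ?p m (?C S)"
      using m m' n CS a phi_closed[OF m'] by (simp add: p T.smult_r_distr T.smult_assoc1)
    finally have right: "a \<odot>\<^bsub>?T\<^esub> ?p m (?C (?p m' n \<oplus>\<^bsub>?T\<^esub> S)) =
      (a \<otimes> \<phi> m') \<odot>\<^bsub>?T\<^esub> ?p m n \<oplus>\<^bsub>?T\<^esub> a \<odot>\<^bsub>?T\<^esub> ?p m (?C S)" .
    have closed: "?p m' n \<in> carrier ?T" "(a \<otimes> \<phi> m') \<odot>\<^bsub>?T\<^esub> ?p m n \<in> carrier ?T" "a \<odot>\<^bsub>?T\<^esub> ?p m (?C S) \<in> carrier ?T"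
      using m m' n CS a af by (auto simp: p)
    show ?case
      using Cons.IH[OF qs] closed S
      by (simp add: q left right flip: S_def) (simp add: T.minus_eq T.minus_add T.a_ac)
  qed
qed

text \<open>Induction on the number of pure tensors in a sum for \<open>t\<close>. If every \<open>\<phi>\<close> vanishes on the first left
  factor \<open>m\<close>, that summand is zero. Otherwise choose \<open>\<phi>\<close> with \<open>\<phi> m\<close> nonzero. The contraction of
  \<open>t\<close> by \<open>\<phi>\<close> is zero because all \<open>\<psi>\<close> vanish on it, and this expresses the first right factor
  through the others. Substituting it turns \<open>t\<close> into a sum with one summand less.\<close>

theorem tensor_separating:
  assumes Phi: "\<And>m. m \<in> carrier M \<Longrightarrow> (\<And>\<phi>. \<phi> \<in> \<Phi> \<Longrightarrow> \<phi> m = \<zero>) \<Longrightarrow> m = \<zero>\<^bsub>M\<^esub>"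
    and Psi: "\<And>n. n \<in> carrier N \<Longrightarrow> (\<And>\<psi>. \<psi> \<in> \<Psi> \<Longrightarrow> \<psi> n = \<zero>) \<Longrightarrow> n = \<zero>\<^bsub>N\<^esub>"
    and lin: "\<Phi> \<subseteq> linear_maps R M K" "\<Psi> \<subseteq> linear_maps R N K"
    and t: "t \<in> carrier (tensor R M N)"
    and vanish: "\<And>\<phi> \<psi>. \<phi> \<in> \<Phi> \<Longrightarrow> \<psi> \<in> \<Psi> \<Longrightarrow> tensor_lift R M N K (\<lambda>m n. \<phi> m \<otimes> \<psi> n) t = \<zero>"
  shows "t = \<zero>\<^bsub>tensor R M N\<^esub>"
proof -
  have contraction: "tensor_lift R M N N (\<lambda>m n. \<phi> m \<odot>\<^bsub>N\<^esub> n) t = \<zero>\<^bsub>N\<^esub>"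
    if phi: "\<phi> \<in> \<Phi>" for \<phi>
  proof (rule Psi)
    have phi': "\<phi> \<in> linear_maps R M K" using phi lin by auto
    show "tensor_lift R M N N (\<lambda>m n. \<phi> m \<odot>\<^bsub>N\<^esub> n) t \<in> carrier N"
      by (rule tensor_lift_closed[OF M N N bilinear_contraction[OF phi'] t])
    show "\<psi> (tensor_lift R M N N (\<lambda>m n. \<phi> m \<odot>\<^bsub>N\<^esub> n) t) = \<zero>" if "\<psi> \<in> \<Psi>" for \<psi>
      using functional_contraction[OF phi' _ t] vanish[OF phi that] lin that by auto
  qed
  have "set ps \<subseteq> carrier M \<times> carrier N \<Longrightarrow> t = tensor_sum R M N ps \<Longrightarrow> t = \<zero>\<^bsub>tensor R M N\<^esub>" for ps
  proof (induction "length ps" arbitrary: ps rule: less_induct)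
    case less
    show ?case
    proof (cases ps)
      case Nil
      thus ?thesis using less by simp
    next
      case (Cons p qs)
      obtain m n where p: "p = (m, n)" by (cases p)
      have m: "m \<in> carrier M" and n: "n \<in> carrier N" and qs: "set qs \<subseteq> carrier M \<times> carrier N"
        using less(2) by (auto simp: Cons p)
      note qs' = tensor_sum_closed[OF qs]
      have t_eq: "t = pure_tensor R M N m n \<oplus>\<^bsub>tensor R M N\<^esub> tensor_sum R M N qs"
        using less(3) by (simp add: Cons p)
      show ?thesis
      proof (cases "\<forall>\<phi>\<in>\<Phi>. \<phi> m = \<zero>")
        case True
        hence "m = \<zero>\<^bsub>M\<^esub>" using Phi m by blast
        hence "pure_tensor R M N m n = pure_tensor R M N (\<zero> \<odot>\<^bsub>M\<^esub> m) n" using m by simp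
        also have "\<dots> = \<zero>\<^bsub>tensor R M N\<^esub>"
          using m n by (simp add: pure_tensor_smult_left[OF M N] pure_tensor_closed[OF M N] del: M.smult_l_null)
        finally have "t = tensor_sum R M N qs" using t_eq qs' by simp
        thus ?thesis using less(1)[of qs] qs by (simp add: Cons)
      next
        case False
        then obtain \<phi> where phi: "\<phi> \<in> \<Phi>" "\<phi> m \<noteq> \<zero>" by blast
        hence phi': "\<phi> \<in> linear_maps R M K" using lin by auto
        note bil = bilinear_contraction[OF phi']
        let ?C = "tensor_lift R M N N (\<lambda>m n. \<phi> m \<odot>\<^bsub>N\<^esub> n)"
        define a where "a = inv (\<phi> m)"
        have phim: "\<phi> m \<in> carrier R" using linear_maps_closed[OF phi' m] by simp
        have a: "a \<in> carrier R" "a \<otimes> \<phi> m = \<one>"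
          using phi(2) phim R.field_Units by (auto simp: a_def)
        define c where "c = ?C (tensor_sum R M N qs)"
        have c: "c \<in> carrier N" unfolding c_def by (rule tensor_lift_closed[OF M N N bil qs'])
        let ?T = "tensor R M N"
        have "\<zero>\<^bsub>N\<^esub> = \<phi> m \<odot>\<^bsub>N\<^esub> n \<oplus>\<^bsub>N\<^esub> c"
          using contraction[OF phi(1)] m n qs'
          by (simp add: t_eq c_def linear_maps_add[OF tensor_lift_linear[OF M N N bil]]
            tensor_lift_pure[OF M N N bil] pure_tensor_closed[OF M N])
        hence "a \<odot>\<^bsub>N\<^esub> \<zero>\<^bsub>N\<^esub> = n \<oplus>\<^bsub>N\<^esub> a \<odot>\<^bsub>N\<^esub> c"
          using a c n phim by (simp add: N.smult_r_distr flip: N.smult_assoc1 del: N.smult_r_null)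
        hence "n \<oplus>\<^bsub>N\<^esub> a \<odot>\<^bsub>N\<^esub> c = \<zero>\<^bsub>N\<^esub>" using a by simp
        hence "n = \<ominus>\<^bsub>N\<^esub> (a \<odot>\<^bsub>N\<^esub> c)" using n c a by (simp add: N.minus_equality N.add.inv_equality)
        also have "\<dots> = (\<ominus> a) \<odot>\<^bsub>N\<^esub> c" using a c by (simp add: N.smult_l_minus)
        finally have "pure_tensor R M N m n = (\<ominus> a) \<odot>\<^bsub>?T\<^esub> pure_tensor R M N m c"
          using a c m by (simp add: pure_tensor_smult_right[OF M N])
        also have "\<dots> = \<ominus>\<^bsub>?T\<^esub> (a \<odot>\<^bsub>?T\<^esub> pure_tensor R M N m c)"
          using a c m by (simp add: T.smult_l_minus pure_tensor_closed[OF M N])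
        finally have "t = tensor_sum R M N qs \<ominus>\<^bsub>?T\<^esub> a \<odot>\<^bsub>?T\<^esub> pure_tensor R M N m c"
          using qs' a c m n by (simp add: t_eq T.minus_eq T.a_comm pure_tensor_closed[OF M N])
        also have "\<dots> = tensor_sum R M N (map (\<lambda>(m', n). (m' \<ominus>\<^bsub>M\<^esub> (a \<otimes> \<phi> m') \<odot>\<^bsub>M\<^esub> m, n)) qs)"
          unfolding c_def by (rule tensor_sum_eliminate[OF phi' a(1) m qs, symmetric])
        finally have "t = tensor_sum R M N (map (\<lambda>(m', n). (m' \<ominus>\<^bsub>M\<^esub> (a \<otimes> \<phi> m') \<odot>\<^bsub>M\<^esub> m, n)) qs)" .
        moreover have "set (map (\<lambda>(m', n). (m' \<ominus>\<^bsub>M\<^esub> (a \<otimes> \<phi> m') \<odot>\<^bsub>M\<^esub> m, n)) qs) \<subseteq> carrier M \<times> carrier N"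
          using qs m a(1) linear_maps_closed[OF phi', simplified] by auto
        ultimately show ?thesis by (intro less(1)) (auto simp only: Cons length_map list.size)
      qed
    qed
  qed
  thus ?thesis using tensor_as_sum[OF t] by blast
qed

corollary tensor_eqI:
  assumes Phi: "\<And>m. m \<in> carrier M \<Longrightarrow> (\<And>\<phi>. \<phi> \<in> \<Phi> \<Longrightarrow> \<phi> m = \<zero>) \<Longrightarrow> m = \<zero>\<^bsub>M\<^esub>"
    and Psi: "\<And>n. n \<in> carrier N \<Longrightarrow> (\<And>\<psi>. \<psi> \<in> \<Psi> \<Longrightarrow> \<psi> n = \<zero>) \<Longrightarrow> n = \<zero>\<^bsub>N\<^esub>"
    and lin: "\<Phi> \<subseteq> linear_maps R M K" "\<Psi> \<subseteq> linear_maps R N K"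
    and s: "s \<in> carrier (tensor R M N)" and t: "t \<in> carrier (tensor R M N)"
    and eq: "\<And>\<phi> \<psi>. \<phi> \<in> \<Phi> \<Longrightarrow> \<psi> \<in> \<Psi> \<Longrightarrow>
      tensor_lift R M N K (\<lambda>m n. \<phi> m \<otimes> \<psi> n) s = tensor_lift R M N K (\<lambda>m n. \<phi> m \<otimes> \<psi> n) t"
  shows "s = t"
proof -
  have "s \<ominus>\<^bsub>tensor R M N\<^esub> t = \<zero>\<^bsub>tensor R M N\<^esub>"
  proof (rule tensor_separating[OF Phi Psi lin])
    fix \<phi> \<psi> assume *: "\<phi> \<in> \<Phi>" "\<psi> \<in> \<Psi>"
    hence b: "bilinear R M N K (\<lambda>m n. \<phi> m \<otimes> \<psi> n)" using lin by (intro bilinear_functionals) auto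
    note L = tensor_lift_linear[OF M N K b]
    have "tensor_lift R M N K (\<lambda>m n. \<phi> m \<otimes> \<psi> n) t \<in> carrier K" by (rule linear_maps_closed[OF L t])
    thus "tensor_lift R M N K (\<lambda>m n. \<phi> m \<otimes> \<psi> n) (s \<ominus>\<^bsub>tensor R M N\<^esub> t) = \<zero>"
      using s t module.axioms(2)[OF K, THEN abelian_group.r_neg]
      by (simp add: T.minus_eq linear_maps_add[OF L] linear_maps_minus[OF T.module_axioms K L] eq[OF *])
  qed (use s t in auto)
  hence "s = \<ominus>\<^bsub>tensor R M N\<^esub> (\<ominus>\<^bsub>tensor R M N\<^esub> t)"
    using s t T.minus_equality[of s "\<ominus>\<^bsub>tensor R M N\<^esub> t"] by (simp add: T.minus_eq)
  thus ?thesis using t by simp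
qed

end

section \<open>Hopf algebras of representative functions\<close>

lemma ring_of_type_algebra_simps [simp]:
  "carrier ring_of_type_algebra = UNIV" "zero ring_of_type_algebra = 0" "one ring_of_type_algebra = 1"
  "add ring_of_type_algebra = (+)" "monoid.mult ring_of_type_algebra = (*)"
  by (simp_all add: ring_of_type_algebra_def)

lemma function_algebra_simps [simp]:
  "carrier (function_algebra S) = S \<rightarrow>\<^sub>E UNIV" "zero (function_algebra S) = (\<lambda>s\<in>S. 0)"
  "one (function_algebra S) = (\<lambda>s\<in>S. 1)" "add (function_algebra S) = (\<lambda>f g. \<lambda>s\<in>S. f s + g s)"
  "monoid.mult (function_algebra S) = (\<lambda>f g. \<lambda>s\<in>S. f s * g s)"
  "module.smult (function_algebra S) = (\<lambda>a f. \<lambda>s\<in>S. a * f s)"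
  by (simp_all add: function_algebra_def)

text \<open>The assumptions say that \<open>C\<close> is a unital algebra of functions on \<open>S\<close> under pointwise operations.
  For such an algebra evaluations at points separate the elements of \<open>Q\<close>, hence evaluations at
  pairs and triples of points separate those of its tensor powers.\<close>

locale function_subalgebra =
  fixes S :: "'s set" and C :: "('s \<Rightarrow> 'k::field) set"
    and K Q QQ
  defines "K \<equiv> (ring_of_type_algebra :: 'k ring)"
    and "Q \<equiv> function_algebra S \<lparr>carrier := C\<rparr>"
    and "QQ \<equiv> tensor K Q Q"
  assumes C: "C \<subseteq> S \<rightarrow>\<^sub>E UNIV"
    and C_one: "(\<lambda>s\<in>S. 1) \<in> C"
    and C_add: "\<And>f g. f \<in> C \<Longrightarrow> g \<in> C \<Longrightarrow> (\<lambda>s\<in>S. f s + g s) \<in> C"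
    and C_mult: "\<And>f g. f \<in> C \<Longrightarrow> g \<in> C \<Longrightarrow> (\<lambda>s\<in>S. f s * g s) \<in> C"
    and C_smult: "\<And>a f. f \<in> C \<Longrightarrow> (\<lambda>s\<in>S. a * f s) \<in> C"
begin

text \<open>With this congruence rule the simplifier knows \<open>s \<in> S\<close> when it rewrites the body of a restricted
  function, which makes the algebra laws of \<open>Q\<close> pointwise computations.\<close>

lemma restrict_cong_on [cong]:
  "S = T \<Longrightarrow> (\<And>s. s \<in> T \<Longrightarrow> f s = g s) \<Longrightarrow> restrict f S = restrict g T"
  by auto

lemma K_simps [simp]:
  "carrier K = UNIV" "\<zero>\<^bsub>K\<^esub> = 0" "\<one>\<^bsub>K\<^esub> = 1" "a \<oplus>\<^bsub>K\<^esub> b = a + b" "a \<otimes>\<^bsub>K\<^esub> b = a * b"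
  by (simp_all add: K_def)

lemma Q_simps [simp]:
  "carrier Q = C" "\<zero>\<^bsub>Q\<^esub> = (\<lambda>s\<in>S. 0)" "\<one>\<^bsub>Q\<^esub> = (\<lambda>s\<in>S. 1)" "f \<oplus>\<^bsub>Q\<^esub> g = (\<lambda>s\<in>S. f s + g s)"
  "f \<otimes>\<^bsub>Q\<^esub> g = (\<lambda>s\<in>S. f s * g s)" "a \<odot>\<^bsub>Q\<^esub> f = (\<lambda>s\<in>S. a * f s)"
  by (simp_all add: Q_def)

lemma C_zero: "(\<lambda>s\<in>S. 0) \<in> C"
proof -
  have "(\<lambda>s\<in>S. 0 * (\<lambda>s\<in>S. 1) s) \<in> C" by (rule C_smult[OF C_one])
  also have "(\<lambda>s\<in>S. 0 * (\<lambda>s\<in>S. 1) s) = (\<lambda>s\<in>S. 0 :: 'k)" by simp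
  finally show ?thesis .
qed

lemma C_eqI: "f \<in> C \<Longrightarrow> g \<in> C \<Longrightarrow> (\<And>a. a \<in> S \<Longrightarrow> f a = g a) \<Longrightarrow> f = g"
  using C by (intro PiE_ext[of f S "\<lambda>_. UNIV" g]) auto

lemma C_restrict: "f \<in> C \<Longrightarrow> restrict f S = f"
  using C by (intro extensional_restrict) (auto simp: PiE_def)

lemma field_K: "field K"
  unfolding K_def by (rule field_from_type_algebra)

lemma cring_K: "cring K"
  unfolding K_def by (rule cring_from_type_algebra)

lemma abelian_group_Q: "abelian_group Q"
proof (rule abelian_groupI)
  fix f assume f: "f \<in> carrier Q"
  show "\<exists>g\<in>carrier Q. g \<oplus>\<^bsub>Q\<^esub> f = \<zero>\<^bsub>Q\<^esub>"
    using f C_smult[of f "- 1"] by (intro bexI[of _ "\<lambda>s\<in>S. - 1 * f s"]) auto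
qed (auto simp: C_zero C_add add_ac C_restrict)

lemma module_Q: "module K Q"
  by (intro moduleI cring_K abelian_group_Q)
    (auto simp: C_smult C_restrict algebra_simps)

lemma ring_Q: "ring Q"
  by (intro ringI abelian_group_Q monoidI) (auto simp: C_one C_mult C_restrict algebra_simps)

lemma assoc_algebra_Q: "assoc_algebra K Q"
  by (intro assoc_algebra.intro module_Q ring_Q assoc_algebra_axioms.intro) auto

abbreviation "KK \<equiv> regular_module K"

lemma module_KK: "module K KK" by (rule module_regular_module[OF cring_K])

lemma module_QQ: "module K QQ" unfolding QQ_def by (rule module_tensor[OF module_Q module_Q])

definition eval1 :: "'s \<Rightarrow> ('s \<Rightarrow> 'k) \<Rightarrow> 'k" where "eval1 a = (\<lambda>f\<in>C. f a)"

text \<open>The value of \<open>t \<in> Q \<otimes> Q\<close>, viewed as a function of two variables, at \<open>(a, b)\<close>.\<close>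

definition eval2 where "eval2 a b = tensor_lift K Q Q KK (\<lambda>g h. g a * h b)"

lemma eval1_linear: "a \<in> S \<Longrightarrow> eval1 a \<in> linear_maps K Q KK"
  using linear_maps_restrictI[OF module_Q, of "\<lambda>f. f a" KK] by (simp add: eval1_def)

lemma tensor_lift_eval: 
  "tensor_lift K Q Q KK (\<lambda>g h. eval1 a g \<otimes>\<^bsub>K\<^esub> eval1 b h) = eval2 a b"
  unfolding eval2_def by (rule tensor_lift_cong) (simp add: eval1_def)

lemma bilinear_eval2: "a \<in> S \<Longrightarrow> b \<in> S \<Longrightarrow> bilinear K Q Q KK (\<lambda>g h. g a * h b)"
  by (auto simp: bilinear_def algebra_simps)

lemma eval2_linear: "a \<in> S \<Longrightarrow> b \<in> S \<Longrightarrow> eval2 a b \<in> linear_maps K QQ KK"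
  unfolding eval2_def QQ_def by (rule tensor_lift_linear[OF module_Q module_Q module_KK bilinear_eval2])

lemma eval2_pure: "a \<in> S \<Longrightarrow> b \<in> S \<Longrightarrow> g \<in> C \<Longrightarrow> h \<in> C \<Longrightarrow> eval2 a b (pure_tensor K Q Q g h) = g a * h b"
  unfolding eval2_def by (subst tensor_lift_pure[OF module_Q module_Q module_KK bilinear_eval2]) auto

lemma eval2_finsum:
  assumes "a \<in> S" "b \<in> S" "finite I" "t \<in> I \<rightarrow> carrier QQ"
  shows "eval2 a b (\<Oplus>\<^bsub>QQ\<^esub>i\<in>I. t i) = (\<Sum>i\<in>I. eval2 a b (t i))"
proof -
  interpret KK: module K KK by (rule module_KK)
  have "(\<Oplus>\<^bsub>KK\<^esub>i\<in>I. f i) = (\<Sum>i\<in>I. f i)" for f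
    using assms(3) by (induction I rule: finite_induct) auto
  thus ?thesis
    using linear_maps_finsum[OF module_QQ module_KK eval2_linear[OF assms(1,2)] assms(3,4)] by simp
qed

lemma QQ_eqI:
  assumes "s \<in> carrier QQ" "t \<in> carrier QQ" "\<And>a b. a \<in> S \<Longrightarrow> b \<in> S \<Longrightarrow> eval2 a b s = eval2 a b t"
  shows "s = t"
proof (rule tensor_eqI[OF field_K module_Q module_Q, of "eval1 ` S" "eval1 ` S"])
  fix f assume f: "f \<in> carrier Q" "\<And>\<phi>. \<phi> \<in> eval1 ` S \<Longrightarrow> \<phi> f = \<zero>\<^bsub>K\<^esub>"
  hence "f a = 0" if "a \<in> S" for a using that f(2)[of "eval1 a"] by (simp add: eval1_def)
  thus "f = \<zero>\<^bsub>Q\<^esub>" using f C_zero by (intro C_eqI) auto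
  thus "f = \<zero>\<^bsub>Q\<^esub>" .
qed (use assms in \<open>auto simp: eval1_linear tensor_lift_eval simp flip: QQ_def simp del: K_simps\<close>)

definition eval3 where "eval3 a b c = tensor_lift K Q QQ KK (\<lambda>f t. f a * eval2 b c t)"

lemma bilinear_eval3: "a \<in> S \<Longrightarrow> b \<in> S \<Longrightarrow> c \<in> S \<Longrightarrow> bilinear K Q QQ KK (\<lambda>f t. f a * eval2 b c t)"
  by (auto simp: bilinear_def algebra_simps linear_maps_add[OF eval2_linear] linear_maps_smult[OF eval2_linear])

lemma eval3_linear: "a \<in> S \<Longrightarrow> b \<in> S \<Longrightarrow> c \<in> S \<Longrightarrow> eval3 a b c \<in> linear_maps K (tensor K Q QQ) KK"
  unfolding eval3_def by (rule tensor_lift_linear[OF module_Q module_QQ module_KK bilinear_eval3])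

lemma QQQ_eqI:
  assumes "s \<in> carrier (tensor K Q QQ)" "t \<in> carrier (tensor K Q QQ)"
    "\<And>a b c. a \<in> S \<Longrightarrow> b \<in> S \<Longrightarrow> c \<in> S \<Longrightarrow> eval3 a b c s = eval3 a b c t"
  shows "s = t"
proof (rule tensor_eqI[OF field_K module_Q module_QQ, of "eval1 ` S" "(\<lambda>(b, c). eval2 b c) ` (S \<times> S)"])
  fix f assume f: "f \<in> carrier Q" "\<And>\<phi>. \<phi> \<in> eval1 ` S \<Longrightarrow> \<phi> f = \<zero>\<^bsub>K\<^esub>"
  hence "f a = 0" if "a \<in> S" for a using that f(2)[of "eval1 a"] by (simp add: eval1_def)
  thus "f = \<zero>\<^bsub>Q\<^esub>" using f C_zero by (intro C_eqI) auto
next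
  interpret QQ: module K QQ by (rule module_QQ)
  fix t assume t: "t \<in> carrier QQ" "\<And>\<psi>. \<psi> \<in> (\<lambda>(b, c). eval2 b c) ` (S \<times> S) \<Longrightarrow> \<psi> t = \<zero>\<^bsub>K\<^esub>"
  show "t = \<zero>\<^bsub>QQ\<^esub>"
    by (rule QQ_eqI) (use t linear_maps_zero[OF module_QQ module_KK eval2_linear] in auto)
next
  fix \<phi> \<psi> assume "\<phi> \<in> eval1 ` S" "\<psi> \<in> (\<lambda>(b, c). eval2 b c) ` (S \<times> S)"
  then obtain a b c where abc: "a \<in> S" "b \<in> S" "c \<in> S" "\<phi> = eval1 a" "\<psi> = eval2 b c" by auto
  have "tensor_lift K Q QQ KK (\<lambda>m n. \<phi> m \<otimes>\<^bsub>K\<^esub> \<psi> n) = eval3 a b c"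
    unfolding eval3_def by (rule tensor_lift_cong) (simp add: abc eval1_def)
  thus "tensor_lift K Q QQ KK (\<lambda>m n. \<phi> m \<otimes>\<^bsub>K\<^esub> \<psi> n) s = tensor_lift K Q QQ KK (\<lambda>m n. \<phi> m \<otimes>\<^bsub>K\<^esub> \<psi> n) t"
    using assms(3) abc by simp
qed (use assms in \<open>auto simp: eval1_linear eval2_linear\<close>)

end

text \<open>The representative functions of a group form a Hopf algebra whose comultiplication, counit and
  antipode are composition with the product, evaluation at the unit and composition with the
  inverse. The group laws enter only through the values of functions in \<open>C\<close>, so it suffices that
  these functions cannot distinguish the two sides of a law. For loops this matters: concatenation
  with the reversed loop is never the trivial loop except for the trivial loop itself.\<close>

locale representative_functions = function_subalgebra S C
  for S :: "'s set" and C :: "('s \<Rightarrow> 'k::field) set" +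
  fixes prod :: "'s \<Rightarrow> 's \<Rightarrow> 's" and e :: 's and inverse :: "'s \<Rightarrow> 's"
  assumes prod_closed: "\<And>a b. a \<in> S \<Longrightarrow> b \<in> S \<Longrightarrow> prod a b \<in> S"
    and unit_closed: "e \<in> S"
    and inverse_closed: "\<And>a. a \<in> S \<Longrightarrow> inverse a \<in> S"
    and prod_assoc: "\<And>f a b c. f \<in> C \<Longrightarrow> a \<in> S \<Longrightarrow> b \<in> S \<Longrightarrow> c \<in> S \<Longrightarrow>
      f (prod (prod a b) c) = f (prod a (prod b c))"
    and prod_unit: "\<And>f a. f \<in> C \<Longrightarrow> a \<in> S \<Longrightarrow> f (prod e a) = f a"
      "\<And>f a. f \<in> C \<Longrightarrow> a \<in> S \<Longrightarrow> f (prod a e) = f a"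
    and prod_inverse: "\<And>f a. f \<in> C \<Longrightarrow> a \<in> S \<Longrightarrow> f (prod (inverse a) a) = f e"
      "\<And>f a. f \<in> C \<Longrightarrow> a \<in> S \<Longrightarrow> f (prod a (inverse a)) = f e"
    and representative: "\<And>f. f \<in> C \<Longrightarrow>
      \<exists>t\<in>carrier QQ. \<forall>a\<in>S. \<forall>b\<in>S. eval2 a b t = f (prod a b)"
    and C_inverse: "\<And>f. f \<in> C \<Longrightarrow> (\<lambda>a\<in>S. f (inverse a)) \<in> C"
begin

text \<open>The choice is unique by \<open>QQ_eqI\<close>.\<close>

definition comult :: "('s \<Rightarrow> 'k) \<Rightarrow> (('s \<Rightarrow> 'k) \<times> ('s \<Rightarrow> 'k) \<Rightarrow> 'k) set"
  where "comult = (\<lambda>f\<in>C. SOME t. t \<in> carrier QQ \<and> (\<forall>a\<in>S. \<forall>b\<in>S. eval2 a b t = f (prod a b)))"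

lemma comult_closed: "f \<in> C \<Longrightarrow> comult f \<in> carrier QQ"
  and eval2_comult: "f \<in> C \<Longrightarrow> a \<in> S \<Longrightarrow> b \<in> S \<Longrightarrow> eval2 a b (comult f) = f (prod a b)"
proof -
  have "comult f \<in> carrier QQ \<and> (\<forall>a\<in>S. \<forall>b\<in>S. eval2 a b (comult f) = f (prod a b))" if f: "f \<in> C"
    unfolding comult_def restrict_apply'[OF f]
    by (rule someI_ex) (use representative[OF f] in auto)
  thus "f \<in> C \<Longrightarrow> comult f \<in> carrier QQ"
    "f \<in> C \<Longrightarrow> a \<in> S \<Longrightarrow> b \<in> S \<Longrightarrow> eval2 a b (comult f) = f (prod a b)" by auto
qed

lemma comult_linear: "comult \<in> linear_maps K Q QQ"
proof (rule linear_mapsI)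
  interpret QQ: module K QQ by (rule module_QQ)
  fix f g assume f: "f \<in> carrier Q" and g: "g \<in> carrier Q"
  show "comult (f \<oplus>\<^bsub>Q\<^esub> g) = comult f \<oplus>\<^bsub>QQ\<^esub> comult g"
    by (rule QQ_eqI)
      (use f g in \<open>auto simp: comult_closed eval2_comult C_add linear_maps_add[OF eval2_linear] prod_closed
        intro!: QQ.add.m_closed\<close>)
next
  interpret QQ: module K QQ by (rule module_QQ)
  fix a f assume a: "a \<in> carrier K" and f: "f \<in> carrier Q"
  show "comult (a \<odot>\<^bsub>Q\<^esub> f) = a \<odot>\<^bsub>QQ\<^esub> comult f"
    by (rule QQ_eqI)
      (use a f in \<open>auto simp: comult_closed eval2_comult C_smult linear_maps_smult[OF eval2_linear] prod_closed
        intro!: QQ.smult_closed\<close>)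
qed (simp add: comult_closed, simp add: comult_def)

definition counit :: "('s \<Rightarrow> 'k) \<Rightarrow> 'k" where "counit = eval1 e"

lemma counit_eq: "f \<in> C \<Longrightarrow> counit f = f e"
  by (simp add: counit_def eval1_def)

definition antipode :: "('s \<Rightarrow> 'k) \<Rightarrow> 's \<Rightarrow> 'k" where "antipode = (\<lambda>f\<in>C. \<lambda>a\<in>S. f (inverse a))"

lemma antipode_closed: "f \<in> C \<Longrightarrow> antipode f \<in> C"
  and antipode_apply: "f \<in> C \<Longrightarrow> a \<in> S \<Longrightarrow> antipode f a = f (inverse a)"
  by (simp_all add: antipode_def C_inverse)

lemma antipode_linear: "antipode \<in> linear_maps K Q Q"
proof -
  have "(\<lambda>f\<in>carrier Q. \<lambda>a\<in>S. f (inverse a)) \<in> linear_maps K Q Q"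
    by (rule linear_maps_restrictI[OF module_Q]) (auto simp: C_inverse inverse_closed)
  thus ?thesis by (simp add: antipode_def)
qed

text \<open>At a triple \<open>(a, b, c)\<close> the two sides take the values \<open>f ((a b) c)\<close> and \<open>f (a (b c))\<close>.\<close>

lemma comult_coassoc:
  assumes f: "f \<in> C"
  shows "tensor_assoc K Q Q Q (tensor_map K Q Q QQ Q comult (\<lambda>y. y) (comult f)) =
    tensor_map K Q Q Q QQ (\<lambda>y. y) comult (comult f)"
proof -
  have R: "module K (tensor K Q QQ)" and L: "module K (tensor K QQ Q)"
    by (intro module_tensor module_Q module_QQ)+
  note pQQ_Q = pure_tensor_closed[OF module_QQ module_Q] pure_tensor_add_left[OF module_QQ module_Q]
    pure_tensor_add_right[OF module_QQ module_Q] pure_tensor_smult_left[OF module_QQ module_Q]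
    pure_tensor_smult_right[OF module_QQ module_Q]
  note pQ_QQ = pure_tensor_closed[OF module_Q module_QQ] pure_tensor_add_left[OF module_Q module_QQ]
    pure_tensor_add_right[OF module_Q module_QQ] pure_tensor_smult_left[OF module_Q module_QQ]
    pure_tensor_smult_right[OF module_Q module_QQ]
  note pQQ = pure_tensor_closed[OF module_Q module_Q, folded QQ_def] pure_tensor_add_left[OF module_Q module_Q, folded QQ_def]
    pure_tensor_add_right[OF module_Q module_Q, folded QQ_def] pure_tensor_smult_left[OF module_Q module_Q, folded QQ_def]
    pure_tensor_smult_right[OF module_Q module_Q, folded QQ_def]
  note \<Delta> = linear_maps_add[OF comult_linear] linear_maps_smult[OF comult_linear]
  have b1: "bilinear K Q Q (tensor K QQ Q) (\<lambda>m n. pure_tensor K QQ Q (comult m) n)"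
    unfolding bilinear_def by (auto simp: pQQ_Q \<Delta> comult_closed simp del: Q_simps(2-) K_simps(2-))
  have b2: "bilinear K Q Q (tensor K Q QQ) (\<lambda>m n. pure_tensor K Q QQ m (comult n))"
    unfolding bilinear_def by (auto simp: pQ_QQ \<Delta> comult_closed simp del: Q_simps(2-) K_simps(2-))
  have b3: "bilinear K Q Q (tensor K Q QQ) (\<lambda>m n. pure_tensor K Q QQ m (pure_tensor K Q Q n p))" if "p \<in> C" for p
    unfolding bilinear_def using that by (auto simp: pQ_QQ pQQ simp del: Q_simps(2-) K_simps(2-))
  have b4: "bilinear K Q Q (tensor K Q QQ) (\<lambda>n p. pure_tensor K Q QQ m (pure_tensor K Q Q n p))" if "m \<in> C" for m
    unfolding bilinear_def using that by (auto simp: pQ_QQ pQQ simp del: Q_simps(2-) K_simps(2-))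
  let ?g = "\<lambda>t p. tensor_lift K Q Q (tensor K Q QQ) (\<lambda>m n. pure_tensor K Q QQ m (pure_tensor K Q Q n p)) t"
  have b5: "bilinear K QQ Q (tensor K Q QQ) ?g"
    unfolding QQ_def
    by (rule bilinear_tensor_lift[OF module_Q module_Q module_Q R[unfolded QQ_def]])
      (use b3 b4 in \<open>auto simp flip: QQ_def\<close>)
  have assoc: "tensor_assoc K Q Q Q = tensor_lift K QQ Q (tensor K Q QQ) ?g"
    by (simp add: tensor_assoc_def QQ_def)
  note \<Delta>f = comult_closed[OF f, unfolded QQ_def]
  have left: "tensor_map K Q Q QQ Q comult (\<lambda>y. y) (comult f) \<in> carrier (tensor K QQ Q)"
    unfolding tensor_map_def by (rule tensor_lift_closed[OF module_Q module_Q L b1 \<Delta>f])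
  show ?thesis
  proof (rule QQQ_eqI)
    show "tensor_map K Q Q Q QQ (\<lambda>y. y) comult (comult f) \<in> carrier (tensor K Q QQ)"
      unfolding tensor_map_def by (rule tensor_lift_closed[OF module_Q module_Q R b2 \<Delta>f])
    show "tensor_assoc K Q Q Q (tensor_map K Q Q QQ Q comult (\<lambda>y. y) (comult f)) \<in> carrier (tensor K Q QQ)"
      unfolding assoc by (rule tensor_lift_closed[OF module_QQ module_Q R b5 left])
    fix a b c assume abc: "a \<in> S" "b \<in> S" "c \<in> S"
    note e3 = eval3_linear[OF abc]
    have e3_pure: "eval3 a b c (pure_tensor K Q QQ m t) = m a * eval2 b c t" if "m \<in> C" "t \<in> carrier QQ" for m t
      unfolding eval3_def using that abc
      by (subst tensor_lift_pure[OF module_Q module_QQ module_KK bilinear_eval3]) auto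
    have b6: "bilinear K QQ Q KK (\<lambda>t p. eval2 a b t * p c)"
      using abc by (auto simp: bilinear_def algebra_simps linear_maps_add[OF eval2_linear] linear_maps_smult[OF eval2_linear])
    have inner: "eval3 a b c (?g t p) = eval2 a b t * p c" if t: "t \<in> carrier QQ" and p: "p \<in> C" for t p
    proof -
      have "eval3 a b c (?g t p) =
          tensor_lift K Q Q KK (\<lambda>m n. eval3 a b c (pure_tensor K Q QQ m (pure_tensor K Q Q n p))) t"
        by (rule tensor_lift_comp[OF module_Q module_Q R module_KK b3[OF p] e3 t[unfolded QQ_def]])
      also have "\<dots> = tensor_lift K Q Q KK (\<lambda>m n. p c * (m a * n b)) t"
        by (rule fun_cong[OF tensor_lift_cong]) (use abc p in \<open>simp add: e3_pure pQQ eval2_pure\<close>)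
      also have "\<dots> = p c \<odot>\<^bsub>KK\<^esub> eval2 a b t"
        unfolding eval2_def
        by (rule tensor_lift_smult[OF module_Q module_Q module_KK bilinear_eval2[OF abc(1,2)] _ _ _ t[unfolded QQ_def]])
          (use abc in \<open>auto simp: bilinear_def algebra_simps\<close>)
      finally show ?thesis by simp
    qed
    have "eval3 a b c (tensor_assoc K Q Q Q (tensor_map K Q Q QQ Q comult (\<lambda>y. y) (comult f))) =
        tensor_lift K QQ Q KK (\<lambda>t p. eval3 a b c (?g t p)) (tensor_map K Q Q QQ Q comult (\<lambda>y. y) (comult f))"
      unfolding assoc by (rule tensor_lift_comp[OF module_QQ module_Q R module_KK b5 e3 left])
    also have "\<dots> = tensor_lift K QQ Q KK (\<lambda>t p. eval2 a b t * p c) (tensor_map K Q Q QQ Q comult (\<lambda>y. y) (comult f))"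
      by (rule fun_cong[OF tensor_lift_cong]) (use inner in auto)
    also have "\<dots> = tensor_lift K Q Q KK (\<lambda>m n. tensor_lift K QQ Q KK (\<lambda>t p. eval2 a b t * p c)
        (pure_tensor K QQ Q (comult m) n)) (comult f)"
      unfolding tensor_map_def
      by (rule tensor_lift_comp[OF module_Q module_Q L module_KK b1 tensor_lift_linear[OF module_QQ module_Q module_KK b6] \<Delta>f])
    also have "\<dots> = eval2 (prod a b) c (comult f)"
      unfolding eval2_def[of "prod a b" c] using abc
      by (intro fun_cong[OF tensor_lift_cong])
        (simp add: tensor_lift_pure[OF module_QQ module_Q module_KK b6] comult_closed eval2_comult)
    also have "\<dots> = eval2 a (prod b c) (comult f)"
      using f abc by (simp add: eval2_comult prod_closed prod_assoc)
    also have "\<dots> = tensor_lift K Q Q KK (\<lambda>m n. eval3 a b c (pure_tensor K Q QQ m (comult n))) (comult f)"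
      unfolding eval2_def[of a "prod b c"] using abc
      by (intro fun_cong[OF tensor_lift_cong]) (simp add: e3_pure comult_closed eval2_comult)
    also have "\<dots> = eval3 a b c (tensor_map K Q Q Q QQ (\<lambda>y. y) comult (comult f))"
      unfolding tensor_map_def
      by (rule tensor_lift_comp[OF module_Q module_Q R module_KK b2 e3 \<Delta>f, symmetric])
    finally show "eval3 a b c (tensor_assoc K Q Q Q (tensor_map K Q Q QQ Q comult (\<lambda>y. y) (comult f))) =
      eval3 a b c (tensor_map K Q Q Q QQ (\<lambda>y. y) comult (comult f))" .
  qed
qed

text \<open>If the values of \<open>b g h\<close> at \<open>s\<close> are products of values of \<open>g\<close> and \<open>h\<close>, then the lift evaluates \<open>t\<close>
  at a pair. The counit and antipode axioms are instances, with pairs such as \<open>(e, s)\<close> and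
  \<open>(s\<inverse>, s)\<close>.\<close>

lemma tensor_lift_apply:
  assumes b: "bilinear K Q Q Q b" and t: "t \<in> carrier QQ" and s: "s \<in> S"
    and eq: "\<And>g h. g \<in> C \<Longrightarrow> h \<in> C \<Longrightarrow> b g h s = g a * h c"
  shows "tensor_lift K Q Q Q b t s = eval2 a c t"
proof -
  have "tensor_lift K Q Q Q b t \<in> C"
    using tensor_lift_closed[OF module_Q module_Q module_Q b] t by (simp add: QQ_def)
  hence "tensor_lift K Q Q Q b t s = eval1 s (tensor_lift K Q Q Q b t)"
    by (simp add: eval1_def)
  also have "\<dots> = tensor_lift K Q Q KK (\<lambda>g h. eval1 s (b g h)) t"
    by (rule tensor_lift_comp[OF module_Q module_Q module_Q module_KK b eval1_linear[OF s] t[unfolded QQ_def]])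
  also have "\<dots> = eval2 a c t"
    unfolding eval2_def
    by (rule fun_cong[OF tensor_lift_cong]) (use b in \<open>auto simp: eval1_def eq bilinear_def\<close>)
  finally show ?thesis .
qed

lemma comult_counit:
  assumes f: "f \<in> C"
  shows "tensor_lift K Q Q Q (\<lambda>y z. counit y \<odot>\<^bsub>Q\<^esub> z) (comult f) = f"
    and "tensor_lift K Q Q Q (\<lambda>y z. counit z \<odot>\<^bsub>Q\<^esub> y) (comult f) = f"
proof -
  have "(\<lambda>s\<in>S. m s * n e) \<in> C" if "m \<in> C" for m n :: "'s \<Rightarrow> 'k"
    using C_smult[OF that, of "n e"] by (simp add: mult.commute)
  note [simp] = this
  have b1: "bilinear K Q Q Q (\<lambda>y z. counit y \<odot>\<^bsub>Q\<^esub> z)"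
    by (auto simp: bilinear_def counit_eq C_add C_smult unit_closed algebra_simps)
  have b2: "bilinear K Q Q Q (\<lambda>y z. counit z \<odot>\<^bsub>Q\<^esub> y)"
    by (auto simp: bilinear_def counit_eq C_add C_smult unit_closed algebra_simps)
  note closed = tensor_lift_closed[OF module_Q module_Q module_Q _ comult_closed[OF f, unfolded QQ_def]]
  show "tensor_lift K Q Q Q (\<lambda>y z. counit y \<odot>\<^bsub>Q\<^esub> z) (comult f) = f"
  proof (rule C_eqI)
    fix a assume a: "a \<in> S"
    have "tensor_lift K Q Q Q (\<lambda>y z. counit y \<odot>\<^bsub>Q\<^esub> z) (comult f) a = eval2 e a (comult f)"
      by (rule tensor_lift_apply[OF b1 comult_closed[OF f] a]) (simp add: a counit_eq)
    thus "tensor_lift K Q Q Q (\<lambda>y z. counit y \<odot>\<^bsub>Q\<^esub> z) (comult f) a = f a"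
      using f a by (simp add: eval2_comult unit_closed prod_unit)
  qed (use f closed[OF b1] in auto)
  show "tensor_lift K Q Q Q (\<lambda>y z. counit z \<odot>\<^bsub>Q\<^esub> y) (comult f) = f"
  proof (rule C_eqI)
    fix a assume a: "a \<in> S"
    have "tensor_lift K Q Q Q (\<lambda>y z. counit z \<odot>\<^bsub>Q\<^esub> y) (comult f) a = eval2 a e (comult f)"
      by (rule tensor_lift_apply[OF b2 comult_closed[OF f] a]) (simp add: a counit_eq)
    thus "tensor_lift K Q Q Q (\<lambda>y z. counit z \<odot>\<^bsub>Q\<^esub> y) (comult f) a = f a"
      using f a by (simp add: eval2_comult unit_closed prod_unit)
  qed (use f closed[OF b2] in auto)
qed

lemma comult_antipode:
  assumes f: "f \<in> C"
  shows "tensor_lift K Q Q Q (\<lambda>y z. antipode y \<otimes>\<^bsub>Q\<^esub> z) (comult f) = counit f \<odot>\<^bsub>Q\<^esub> \<one>\<^bsub>Q\<^esub>"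
    and "tensor_lift K Q Q Q (\<lambda>y z. y \<otimes>\<^bsub>Q\<^esub> antipode z) (comult f) = counit f \<odot>\<^bsub>Q\<^esub> \<one>\<^bsub>Q\<^esub>"
proof -
  have "(\<lambda>s\<in>S. n s * m (inverse s)) \<in> C" "(\<lambda>s\<in>S. m (inverse s) * n s) \<in> C" if "m \<in> C" "n \<in> C" for m n
    using C_mult[OF that(2) antipode_closed[OF that(1)]] that by (simp_all add: antipode_apply mult.commute)
  note [simp] = this
  have b1: "bilinear K Q Q Q (\<lambda>y z. antipode y \<otimes>\<^bsub>Q\<^esub> z)"
    unfolding bilinear_def
    by (auto simp: antipode_apply antipode_closed C_add C_smult C_mult inverse_closed algebra_simps)
  have b2: "bilinear K Q Q Q (\<lambda>y z. y \<otimes>\<^bsub>Q\<^esub> antipode z)"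
    unfolding bilinear_def
    by (auto simp: antipode_apply antipode_closed C_add C_smult C_mult inverse_closed algebra_simps)
  note closed = tensor_lift_closed[OF module_Q module_Q module_Q _ comult_closed[OF f, unfolded QQ_def]]
  have one: "counit f \<odot>\<^bsub>Q\<^esub> \<one>\<^bsub>Q\<^esub> \<in> C" by (simp add: C_smult C_one del: restrict_apply)
  show "tensor_lift K Q Q Q (\<lambda>y z. antipode y \<otimes>\<^bsub>Q\<^esub> z) (comult f) = counit f \<odot>\<^bsub>Q\<^esub> \<one>\<^bsub>Q\<^esub>"
  proof (rule C_eqI[OF _ one])
    fix a assume a: "a \<in> S"
    have "tensor_lift K Q Q Q (\<lambda>y z. antipode y \<otimes>\<^bsub>Q\<^esub> z) (comult f) a = eval2 (inverse a) a (comult f)"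
      by (rule tensor_lift_apply[OF b1 comult_closed[OF f] a]) (simp add: a antipode_apply)
    thus "tensor_lift K Q Q Q (\<lambda>y z. antipode y \<otimes>\<^bsub>Q\<^esub> z) (comult f) a = (counit f \<odot>\<^bsub>Q\<^esub> \<one>\<^bsub>Q\<^esub>) a"
      using f a by (simp add: eval2_comult inverse_closed prod_inverse counit_eq)
  qed (use f closed[OF b1] in auto)
  show "tensor_lift K Q Q Q (\<lambda>y z. y \<otimes>\<^bsub>Q\<^esub> antipode z) (comult f) = counit f \<odot>\<^bsub>Q\<^esub> \<one>\<^bsub>Q\<^esub>"
  proof (rule C_eqI[OF _ one])
    fix a assume a: "a \<in> S"
    have "tensor_lift K Q Q Q (\<lambda>y z. y \<otimes>\<^bsub>Q\<^esub> antipode z) (comult f) a = eval2 a (inverse a) (comult f)"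
      by (rule tensor_lift_apply[OF b2 comult_closed[OF f] a]) (simp add: a antipode_apply)
    thus "tensor_lift K Q Q Q (\<lambda>y z. y \<otimes>\<^bsub>Q\<^esub> antipode z) (comult f) a = (counit f \<odot>\<^bsub>Q\<^esub> \<one>\<^bsub>Q\<^esub>) a"
      using f a by (simp add: eval2_comult inverse_closed prod_inverse counit_eq)
  qed (use f closed[OF b2] in auto)
qed

text \<open>Multiplication in \<open>Q \<otimes> Q\<close> is pointwise multiplication of functions of two variables.\<close>

lemma tensor_mult:
  assumes s: "s \<in> carrier QQ" and t: "t \<in> carrier QQ"
  shows tensor_mult_closed: "s \<otimes>\<^bsub>tensor_algebra K Q Q\<^esub> t \<in> carrier QQ"
    and eval2_tensor_mult: "a \<in> S \<Longrightarrow> b \<in> S \<Longrightarrow>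
      eval2 a b (s \<otimes>\<^bsub>tensor_algebra K Q Q\<^esub> t) = eval2 a b s * eval2 a b t"
proof -
  note pQQ = pure_tensor_closed[OF module_Q module_Q, folded QQ_def] pure_tensor_add_left[OF module_Q module_Q, folded QQ_def]
    pure_tensor_add_right[OF module_Q module_Q, folded QQ_def] pure_tensor_smult_left[OF module_Q module_Q, folded QQ_def]
    pure_tensor_smult_right[OF module_Q module_Q, folded QQ_def]
  interpret Q: ring Q by (rule ring_Q)
  interpret A: assoc_algebra K Q by (rule assoc_algebra_Q)
  let ?m = "\<lambda>f g c d. pure_tensor K Q Q (f \<otimes>\<^bsub>Q\<^esub> c) (g \<otimes>\<^bsub>Q\<^esub> d)"
  have b1: "bilinear K Q Q QQ (?m f g)" if "f \<in> carrier Q" "g \<in> carrier Q" for f g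
    using that unfolding bilinear_def
    by (auto simp: pQQ Q.r_distr A.smult_mult_right simp del: Q_simps K_simps)
  have b2: "bilinear K Q Q QQ (\<lambda>f g. ?m f g c d)" if "c \<in> carrier Q" "d \<in> carrier Q" for c d
    using that unfolding bilinear_def
    by (auto simp: pQQ Q.l_distr A.smult_mult_left simp del: Q_simps K_simps)
  let ?g = "\<lambda>f g. tensor_lift K Q Q QQ (?m f g) t"
  have b3: "bilinear K Q Q QQ ?g"
    by (rule bilinear_tensor_lift_parameter[OF module_Q module_Q module_QQ b1 b2 module_Q module_Q t[unfolded QQ_def]])
  have eq: "s \<otimes>\<^bsub>tensor_algebra K Q Q\<^esub> t = tensor_lift K Q Q QQ ?g s"
    by (simp add: tensor_algebra_def QQ_def)
  show "s \<otimes>\<^bsub>tensor_algebra K Q Q\<^esub> t \<in> carrier QQ"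
    unfolding eq by (rule tensor_lift_closed[OF module_Q module_Q module_QQ b3 s[unfolded QQ_def]])
  assume ab: "a \<in> S" "b \<in> S"
  note e2 = eval2_linear[OF ab]
  have inner: "eval2 a b (?g f g) = eval2 a b t * (f a * g b)" if fg: "f \<in> carrier Q" "g \<in> carrier Q" for f g
  proof -
    have "eval2 a b (?g f g) = tensor_lift K Q Q KK (\<lambda>c d. eval2 a b (?m f g c d)) t"
      by (rule tensor_lift_comp[OF module_Q module_Q module_QQ module_KK b1[OF fg] e2 t[unfolded QQ_def]])
    also have "\<dots> = tensor_lift K Q Q KK (\<lambda>c d. (f a * g b) * (c a * d b)) t"
      by (rule fun_cong[OF tensor_lift_cong]) (use ab fg in \<open>simp add: eval2_pure C_mult\<close>)
    also have "\<dots> = (f a * g b) \<odot>\<^bsub>KK\<^esub> eval2 a b t"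
      unfolding eval2_def
      by (rule tensor_lift_smult[OF module_Q module_Q module_KK bilinear_eval2[OF ab] _ _ _ t[unfolded QQ_def]])
        (use ab in \<open>auto simp: bilinear_def algebra_simps\<close>)
    finally show ?thesis by simp
  qed
  have "eval2 a b (s \<otimes>\<^bsub>tensor_algebra K Q Q\<^esub> t) = tensor_lift K Q Q KK (\<lambda>f g. eval2 a b (?g f g)) s"
    unfolding eq by (rule tensor_lift_comp[OF module_Q module_Q module_QQ module_KK b3 e2 s[unfolded QQ_def]])
  also have "\<dots> = tensor_lift K Q Q KK (\<lambda>f g. eval2 a b t * (f a * g b)) s"
    by (rule fun_cong[OF tensor_lift_cong]) (use inner in auto)
  also have "\<dots> = eval2 a b t \<odot>\<^bsub>KK\<^esub> eval2 a b s"
    unfolding eval2_def[of a b]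
    by (rule tensor_lift_smult[OF module_Q module_Q module_KK bilinear_eval2[OF ab] _ _ _ s[unfolded QQ_def]])
      (use ab in \<open>auto simp: bilinear_def algebra_simps\<close>)
  finally show "eval2 a b (s \<otimes>\<^bsub>tensor_algebra K Q Q\<^esub> t) = eval2 a b s * eval2 a b t" by simp
qed

lemma comult_ring_hom: "comult \<in> ring_hom Q (tensor_algebra K Q Q)"
proof (rule ring_hom_memI)
  interpret QQ: module K QQ by (rule module_QQ)
  have add: "add (tensor_algebra K Q Q) = add QQ" and car: "carrier (tensor_algebra K Q Q) = carrier QQ"
    and one: "\<one>\<^bsub>tensor_algebra K Q Q\<^esub> = pure_tensor K Q Q \<one>\<^bsub>Q\<^esub> \<one>\<^bsub>Q\<^esub>"
    by (simp_all add: tensor_algebra_def QQ_def)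
  fix f g assume f: "f \<in> carrier Q"
  thus "comult f \<in> carrier (tensor_algebra K Q Q)" by (simp add: car comult_closed)
  assume g: "g \<in> carrier Q"
  show "comult (f \<oplus>\<^bsub>Q\<^esub> g) = comult f \<oplus>\<^bsub>tensor_algebra K Q Q\<^esub> comult g"
    unfolding add by (rule linear_maps_add[OF comult_linear f g])
  show "comult (f \<otimes>\<^bsub>Q\<^esub> g) = comult f \<otimes>\<^bsub>tensor_algebra K Q Q\<^esub> comult g"
    by (rule QQ_eqI)
      (use f g in \<open>auto simp: comult_closed tensor_mult_closed eval2_tensor_mult eval2_comult C_mult prod_closed\<close>)
next
  have one: "\<one>\<^bsub>tensor_algebra K Q Q\<^esub> = pure_tensor K Q Q \<one>\<^bsub>Q\<^esub> \<one>\<^bsub>Q\<^esub>"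
    by (simp add: tensor_algebra_def)
  show "comult \<one>\<^bsub>Q\<^esub> = \<one>\<^bsub>tensor_algebra K Q Q\<^esub>"
    unfolding one
    by (rule QQ_eqI)
      (auto simp: comult_closed eval2_comult C_one prod_closed eval2_pure pure_tensor_closed[OF module_Q module_Q, folded QQ_def])
qed

theorem hopf_algebra_representative_functions: "hopf_algebra K Q comult counit antipode"
proof -
  have "coalgebra K Q comult counit"
    by (intro coalgebra.intro module_Q coalgebra_axioms.intro)
      (auto simp: comult_linear[unfolded QQ_def] counit_def eval1_linear unit_closed
        comult_coassoc[unfolded QQ_def] comult_counit[unfolded counit_def, simplified])
  moreover have "counit \<in> ring_hom Q K"
    by (rule ring_hom_memI) (auto simp: counit_eq unit_closed C_add C_mult C_one)
  ultimately have "bialgebra K Q comult counit"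
    by (intro bialgebra.intro assoc_algebra_Q bialgebra_axioms.intro comult_ring_hom)
  thus ?thesis
    by (intro hopf_algebra.intro hopf_algebra_axioms.intro antipode_linear)
      (use comult_antipode in auto)
qed

end

section \<open>Convolution of functions on words\<close>

text \<open>The product dual to deconcatenation of words. Functions on words with this product are the
  noncommutative power series in the letters.\<close>

definition conv :: "('w list \<Rightarrow> 'k::comm_ring_1) \<Rightarrow> ('w list \<Rightarrow> 'k) \<Rightarrow> 'w list \<Rightarrow> 'k"
  where "conv F G w = (\<Sum>i\<le>length w. F (take i w) * G (drop i w))"

definition conv_unit :: "'w list \<Rightarrow> 'k::comm_ring_1"
  where "conv_unit w = (if w = [] then 1 else 0)"

text \<open>The antipode of the dual of the shuffle algebra: an antihomomorphism for \<open>conv\<close> that inverts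
  exponentials.\<close>

definition signed_rev :: "('w list \<Rightarrow> 'k::comm_ring_1) \<Rightarrow> 'w list \<Rightarrow> 'k"
  where "signed_rev F w = (- 1) ^ length w * F (rev w)"

lemma conv_Nil [simp]: "conv F G [] = F [] * G []"
  by (simp add: conv_def)

lemma conv_Cons: "conv F G (a # w) = F [] * G (a # w) + conv (\<lambda>u. F (a # u)) G w"
  by (simp add: conv_def sum.atMost_Suc_shift del: sum.atMost_Suc)

lemma conv_add_left: "conv (\<lambda>u. F u + F' u) G w = conv F G w + conv F' G w"
  by (simp add: conv_def algebra_simps sum.distrib)

lemma conv_scale_left: "conv (\<lambda>u. c * F u) G w = c * conv F G w"
  by (simp add: conv_def algebra_simps sum_distrib_left)

text \<open>Induction on the word works for all \<open>F\<close> at once, since removing the first letter \<open>a\<close> replaces \<open>F\<close>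
  by \<open>\<lambda>u. F (a # u)\<close>.\<close>

lemma conv_assoc: "conv (conv F G) H = conv F (conv G H)"
proof
  show "conv (conv F G) H w = conv F (conv G H) w" for w
    by (induction w arbitrary: F)
      (simp_all add: conv_Cons conv_add_left conv_scale_left algebra_simps)
qed

lemma conv_unit_left [simp]: "conv conv_unit F = F"
proof
  show "conv conv_unit F w = F w" for w
    by (cases w) (simp_all add: conv_Cons conv_unit_def, simp add: conv_def)
qed

lemma conv_unit_right [simp]: "conv F conv_unit = F"
proof
  show "conv F conv_unit w = F w" for w
    by (induction w arbitrary: F) (simp_all add: conv_Cons conv_unit_def)
qed

lemma signed_rev_conv: "signed_rev (conv F G) = conv (signed_rev G) (signed_rev F)"
proof
  fix w :: "'a list"
  let ?n = "length w"
  have "conv (signed_rev G) (signed_rev F) w =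
      (\<Sum>i\<le>?n. (- 1) ^ ?n * (F (take (?n - i) (rev w)) * G (drop (?n - i) (rev w))))"
    unfolding conv_def signed_rev_def
  proof (rule sum.cong[OF refl])
    fix i assume i: "i \<in> {..?n}"
    have "(- 1 :: 'b) ^ ?n = (- 1) ^ i * (- 1) ^ (?n - i)" using i by (simp flip: power_add)
    thus "(- 1) ^ length (take i w) * G (rev (take i w)) * ((- 1) ^ length (drop i w) * F (rev (drop i w))) =
        (- 1) ^ ?n * (F (take (?n - i) (rev w)) * G (drop (?n - i) (rev w)))"
      using i by (simp add: take_rev drop_rev min_absorb2)
  qed
  also have "\<dots> = (\<Sum>i\<le>?n. (- 1) ^ ?n * (F (take i (rev w)) * G (drop i (rev w))))"
    by (rule sum.reindex_bij_witness[of _ "\<lambda>i. ?n - i" "\<lambda>i. ?n - i"]) auto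
  also have "\<dots> = signed_rev (conv F G) w"
    by (simp add: signed_rev_def conv_def sum_distrib_left)
  finally show "signed_rev (conv F G) w = conv (signed_rev G) (signed_rev F) w" ..
qed

lemma signed_rev_unit [simp]: "signed_rev conv_unit = conv_unit"
  by (auto simp: signed_rev_def conv_unit_def)

section \<open>Exponentials and their products\<close>

text \<open>The exponential series of \<open>\<Sum>x. p x \<cdot> x\<close>. It is the iterated integral over a single step of a
  line: all indices coincide there, so that the multiplicity factor is the factorial of the length.\<close>

definition exp_word :: "('w \<Rightarrow> 'k::field_char_0) \<Rightarrow> 'w list \<Rightarrow> 'k"
  where "exp_word p w = prod_list (map p w) / fact (length w)"

lemma signed_rev_exp_word: "signed_rev (exp_word p) = exp_word (\<lambda>x. - p x)"
proof
  fix w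
  have "prod_list (map (\<lambda>x. - p x) w) = (- 1) ^ length w * prod_list (map p w)"
    by (induction w) auto
  moreover have "prod_list (map p (rev w)) = prod_list (map p w)"
    by (simp flip: rev_map)
  ultimately show "signed_rev (exp_word p) w = exp_word (\<lambda>x. - p x) w"
    by (simp add: signed_rev_def exp_word_def)
qed

text \<open>The coefficient at a word of length \<open>n\<close> is a multiple of the alternating sum of the binomial
  coefficients \<open>n\<close> over \<open>i\<close>, which vanishes for \<open>n > 0\<close>.\<close>

lemma exp_word_inverse: "conv (exp_word (\<lambda>x. - p x)) (exp_word p) = conv_unit"
proof
  fix w :: "'a list"
  let ?n = "length w"
  have "conv (exp_word (\<lambda>x. - p x)) (exp_word p) w =
      (\<Sum>i\<le>?n. prod_list (map p w) / fact ?n * ((- 1) ^ i * of_nat (?n choose i)))"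
    unfolding conv_def
  proof (rule sum.cong[OF refl])
    fix i assume i: "i \<in> {..?n}"
    have neg: "prod_list (map (\<lambda>x. - p x) v) = (- 1) ^ length v * prod_list (map p v)" for v
      by (induction v) auto
    have "prod_list (map p w) = prod_list (map p (take i w)) * prod_list (map p (drop i w))"
      by (simp flip: prod_list.append map_append)
    thus "exp_word (\<lambda>x. - p x) (take i w) * exp_word p (drop i w) =
        prod_list (map p w) / fact ?n * ((- 1) ^ i * of_nat (?n choose i))"
      using i by (simp add: exp_word_def neg binomial_fact min_absorb2)
  qed
  also have "\<dots> = prod_list (map p w) / fact ?n * (\<Sum>i\<le>?n. (- 1) ^ i * of_nat (?n choose i))"
    by (simp add: sum_distrib_left)
  also have "\<dots> = conv_unit w"
    using choose_alternating_sum[of ?n, where 'a = 'b] by (auto simp: conv_unit_def)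
  finally show "conv (exp_word (\<lambda>x. - p x)) (exp_word p) w = conv_unit w" .
qed

text \<open>The indices \<open>t\<close> run from \<open>1\<close>, as the steps of a line do.\<close>

primrec chen :: "(nat \<Rightarrow> 'w \<Rightarrow> 'k::field_char_0) \<Rightarrow> nat \<Rightarrow> 'w list \<Rightarrow> 'k" where
  "chen p 0 = conv_unit"
| "chen p (Suc n) = conv (chen p n) (exp_word (p (Suc n)))"

lemma chen_cong: "(\<And>t. 1 \<le> t \<Longrightarrow> t \<le> n \<Longrightarrow> p t = q t) \<Longrightarrow> chen p n = chen q n"
  by (induction n) auto

lemma chen_add: "chen p (m + n) = conv (chen p m) (chen (\<lambda>t. p (m + t)) n)"
  by (induction n) (simp_all add: conv_assoc)

text \<open>Reversing a line reverses the order of its steps and changes the sign of every pairing.\<close>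

lemma chen_reverse: "chen (\<lambda>t x. - p (n + 1 - t) x) n = signed_rev (chen p n)"
proof (induction n)
  case 0
  show ?case by simp
next
  case (Suc n)
  let ?q = "\<lambda>t x. - p (Suc n + 1 - t) x"
  have "chen ?q (Suc 0) = exp_word (\<lambda>x. - p (Suc n) x)" by simp
  hence "chen ?q (Suc n) = conv (exp_word (\<lambda>x. - p (Suc n) x)) (chen (\<lambda>t x. - p (n + 1 - t) x) n)"
    using chen_add[of ?q "Suc 0" n] by (simp del: chen.simps(2))
  also have "\<dots> = signed_rev (chen p (Suc n))"
    by (simp add: Suc[simplified] signed_rev_conv signed_rev_exp_word)
  finally show ?case .
qed

text \<open>The product of a path of exponentials with its reverse telescopes from the middle. For the two
  orders of the factors the middle is the last or the first step, whence the two inductions.\<close>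

lemma chen_inverse:
  "conv (signed_rev (chen p n)) (chen p n) = conv_unit"
  "conv (chen p n) (signed_rev (chen p n)) = conv_unit"
proof -
  have right: "conv (exp_word p) (exp_word (\<lambda>x. - p x)) = conv_unit" for p :: "'a \<Rightarrow> 'b"
    using exp_word_inverse[of "\<lambda>x. - p x"] by simp
  show "conv (chen p n) (signed_rev (chen p n)) = conv_unit"
  proof (induction n)
    case (Suc n)
    have "conv (chen p (Suc n)) (signed_rev (chen p (Suc n))) =
      conv (chen p n) (conv (conv (exp_word (p (Suc n))) (exp_word (\<lambda>x. - p (Suc n) x))) (signed_rev (chen p n)))"
      by (simp add: signed_rev_conv signed_rev_exp_word conv_assoc)
    thus ?case by (simp add: right Suc)
  qed simp
  have "conv (signed_rev (chen p n)) (chen p n) = conv_unit" for p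
  proof (induction n arbitrary: p)
    case (Suc n)
    define q where "q = (\<lambda>t. p (1 + t))"
    have c: "chen p (Suc n) = conv (exp_word (p 1)) (chen q n)"
      using chen_add[of p 1 n] by (simp add: q_def)
    have "conv (signed_rev (chen p (Suc n))) (chen p (Suc n)) =
      conv (signed_rev (chen q n)) (conv (conv (exp_word (\<lambda>x. - p 1 x)) (exp_word (p 1))) (chen q n))"
      unfolding c by (simp add: signed_rev_conv signed_rev_exp_word conv_assoc)
    thus ?case by (simp add: exp_word_inverse Suc)
  qed simp
  thus "conv (signed_rev (chen p n)) (chen p n) = conv_unit" .
qed

section \<open>Shuffles\<close>

text \<open>Unlike the set \<^const>\<open>shuffles\<close>, a list records how often a word arises as a shuffle.\<close>

fun shuffle :: "'w list \<Rightarrow> 'w list \<Rightarrow> 'w list list" where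
  "shuffle [] v = [v]"
| "shuffle u [] = [u]"
| "shuffle (a # u) (b # v) = map ((#) a) (shuffle u (b # v)) @ map ((#) b) (shuffle (a # u) v)"

lemma shuffle_Nil_right [simp]: "shuffle u [] = [u]"
  by (cases u) auto

lemma set_shuffle: "set (shuffle u v) = shuffles u v"
  by (induction u v rule: shuffle.induct) auto

lemma length_shuffle: "length (shuffle u v) = (length u + length v) choose length u"
  by (induction u v rule: shuffle.induct) auto

definition shuffle_sum :: "('w list \<Rightarrow> 'k::comm_ring_1) \<Rightarrow> 'w list \<Rightarrow> 'w list \<Rightarrow> 'k"
  where "shuffle_sum F u v = (\<Sum>w\<leftarrow>shuffle u v. F w)"

lemma shuffle_sum_Nil [simp]: "shuffle_sum F [] v = F v" "shuffle_sum F u [] = F u"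
  by (simp_all add: shuffle_sum_def)

lemma shuffle_sum_Cons:
  "shuffle_sum F (a # u) (b # v) =
    shuffle_sum (\<lambda>w. F (a # w)) u (b # v) + shuffle_sum (\<lambda>w. F (b # w)) (a # u) v"
  by (simp add: shuffle_sum_def o_def)

lemma shuffle_sum_linear:
  "shuffle_sum (\<lambda>w. c * F w + G w) u v = c * shuffle_sum F u v + shuffle_sum G u v"
  by (simp add: shuffle_sum_def sum_list_addf sum_list_const_mult)

text \<open>Deconcatenation is multiplicative for the shuffle product: to cut a shuffle of \<open>u\<close> and \<open>v\<close> in two
  is to cut \<open>u\<close> and \<open>v\<close> and to shuffle the left and the right parts.\<close>

lemma shuffle_sum_conv:
  "shuffle_sum (conv F G) u v = (\<Sum>i\<le>length u. \<Sum>j\<le>length v.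
    shuffle_sum F (take i u) (take j v) * shuffle_sum G (drop i u) (drop j v))"
proof (induction u v arbitrary: F rule: shuffle.induct)
  case (1 v)
  show ?case by (simp add: conv_def)
next
  case (2 a u)
  show ?case by (simp add: conv_def)
next
  case (3 a u b v)
  have "shuffle_sum (conv F G) (a # u) (b # v) =
      F [] * shuffle_sum (\<lambda>w. G (a # w)) u (b # v) + shuffle_sum (conv (\<lambda>w. F (a # w)) G) u (b # v) +
      (F [] * shuffle_sum (\<lambda>w. G (b # w)) (a # u) v + shuffle_sum (conv (\<lambda>w. F (b # w)) G) (a # u) v)"
    by (simp add: shuffle_sum_Cons conv_Cons shuffle_sum_linear)
  also have "\<dots> = F [] * shuffle_sum G (a # u) (b # v) +
      shuffle_sum (conv (\<lambda>w. F (a # w)) G) u (b # v) + shuffle_sum (conv (\<lambda>w. F (b # w)) G) (a # u) v"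
    by (simp add: shuffle_sum_Cons algebra_simps)
  finally show ?case
    by (simp add: 3 sum.atMost_Suc_shift shuffle_sum_Cons sum.distrib algebra_simps del: sum.atMost_Suc)
qed

definition shuffle_character :: "('w list \<Rightarrow> 'k::comm_ring_1) \<Rightarrow> bool"
  where "shuffle_character F \<longleftrightarrow> (\<forall>u v. F u * F v = shuffle_sum F u v)"

lemma shuffle_character_conv:
  assumes "shuffle_character F" "shuffle_character G"
  shows "shuffle_character (conv F G)"
proof -
  have "conv F G u * conv F G v = (\<Sum>i\<le>length u. \<Sum>j\<le>length v.
      (F (take i u) * F (take j v)) * (G (drop i u) * G (drop j v)))" for u v
    by (simp add: conv_def sum_product mult_ac)
  thus ?thesis using assms by (simp add: shuffle_character_def shuffle_sum_conv)
qed

lemma shuffle_character_unit: "shuffle_character conv_unit"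
proof -
  have "shuffle_sum conv_unit u v = (conv_unit u * conv_unit v :: 'b)" for u v :: "'a list"
  proof (cases "u = [] \<or> v = []")
    case False
    then obtain a u' b v' where "u = a # u'" "v = b # v'" by (auto simp: neq_Nil_conv)
    thus ?thesis by (simp add: shuffle_sum_Cons conv_unit_def) (simp add: shuffle_sum_def)
  qed (auto simp: conv_unit_def)
  thus ?thesis by (simp add: shuffle_character_def)
qed

text \<open>All shuffles of \<open>u\<close> and \<open>v\<close> have the same coefficient, and their number \<open>(|u| + |v|)! / (|u|! |v|!)\<close>
  turns the factorial in the denominator into those of \<open>u\<close> and \<open>v\<close>.\<close>

lemma shuffle_character_exp_word: "shuffle_character (exp_word p)"
proof -
  have "shuffle_sum (exp_word p) u v = exp_word p u * exp_word p v" for u v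
  proof -
    have "exp_word p w = prod_list (map p u) * prod_list (map p v) / fact (length u + length v)"
      if "w \<in> set (shuffle u v)" for w
    proof -
      have "mset w = mset u + mset v" using that by (simp add: set_shuffle mset_shuffles)
      hence "mset (map p w) = mset (map p (u @ v))" by simp
      hence "prod_list (map p w) = prod_list (map p (u @ v))" by (metis prod_mset_prod_list)
      thus ?thesis using that by (simp add: exp_word_def set_shuffle length_shuffles)
    qed
    hence "shuffle_sum (exp_word p) u v = (\<Sum>w\<leftarrow>shuffle u v.
        prod_list (map p u) * prod_list (map p v) / fact (length u + length v))"
      unfolding shuffle_sum_def by (intro arg_cong[of _ _ sum_list] map_cong refl)
    thus ?thesis
      by (simp add: sum_list_triv length_shuffle binomial_fact exp_word_def)
  qed
  thus ?thesis by (simp add: shuffle_character_def)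
qed

lemma shuffle_character_chen: "shuffle_character (chen p n)"
  by (induction n) (simp_all add: shuffle_character_unit shuffle_character_conv shuffle_character_exp_word)

section \<open>Iterated sums\<close>

lemma multiplicity_factor_append_replicate:
  assumes "N \<notin> set ts"
  shows "multiplicity_factor (ts @ replicate k N) = multiplicity_factor ts * fact k"
proof (cases "k = 0")
  case False
  have rep: "count_list (replicate k N) x = 0" if "x \<noteq> N" for x
    using that by (simp add: count_list_0_iff)
  have "(\<Prod>x\<in>set ts. fact (count_list (ts @ replicate k N) x)) = (\<Prod>x\<in>set ts. fact (count_list ts x) :: nat)"
    by (rule prod.cong[OF refl], subst count_list_append, subst rep) (use assms in auto)
  moreover have "count_list (replicate k N) N = k" by (induction k) auto
  ultimately show ?thesis
    using assms False by (simp add: multiplicity_factor_def count_list_0_iff mult.commute)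
qed simp

text \<open>A nondecreasing index list with entries up to \<open>n + 1\<close> is a list with entries up to \<open>n\<close> followed by
  a block of copies of \<open>n + 1\<close>. The block contributes a factorial to the multiplicity factor, hence
  a value of the exponential for step \<open>n + 1\<close>; its starting position is the summation index of the
  convolution.\<close>

lemma iterated_sum_eq_chen:
  fixes p :: "nat \<Rightarrow> 'w \<Rightarrow> 'k::field_char_0"
  shows "(\<Sum>ts | length ts = length ws \<and> sorted ts \<and> set ts \<subseteq> {1..n}.
      (\<Prod>i<length ws. p (ts ! i) (ws ! i)) / of_nat (multiplicity_factor ts)) = chen p n ws"
proof (induction n arbitrary: ws)
  case 0
  have "{ts. length ts = length ws \<and> sorted ts \<and> set ts \<subseteq> {1..0::nat}} = (if ws = [] then {[]} else {})"
    by auto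
  thus ?case by (simp add: conv_unit_def multiplicity_factor_def)
next
  case (Suc n)
  let ?r = "length ws"
  let ?A = "\<lambda>n r. {ts. length ts = r \<and> sorted ts \<and> set ts \<subseteq> {1..n::nat}}"
  let ?g = "\<lambda>ws ts. (\<Prod>i<length ws. p (ts ! i) (ws ! i)) / of_nat (multiplicity_factor ts)"
  have fin: "finite (?A n r)" for n r
    by (rule finite_subset[OF _ finite_lists_length_eq[of "{1..n}" r]]) auto
  have "chen p (Suc n) ws = (\<Sum>i\<le>?r. \<Sum>ts\<in>?A n i. ?g (take i ws) ts * exp_word (p (Suc n)) (drop i ws))"
    by (simp add: conv_def sum_distrib_right min_absorb2 flip: Suc)
  also have "\<dots> = (\<Sum>(i, ts)\<in>Sigma {..?r} (?A n). ?g (take i ws) ts * exp_word (p (Suc n)) (drop i ws))"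
    by (rule sum.Sigma) (use fin in auto)
  also have "\<dots> = (\<Sum>ts\<in>?A (Suc n) ?r. ?g ws ts)"
  proof (rule sum.reindex_bij_witness[where
      j = "\<lambda>(i, ts). ts @ replicate (?r - i) (Suc n)" and
      i = "\<lambda>ts. (length (filter (\<lambda>t. t \<le> n) ts), filter (\<lambda>t. t \<le> n) ts)"])
    fix x assume "x \<in> Sigma {..?r} (?A n)"
    then obtain i ts where x: "x = (i, ts)" "i \<le> ?r" "length ts = i" "sorted ts" "set ts \<subseteq> {1..n}" by auto
    have f: "filter (\<lambda>t. t \<le> n) ts = ts" using x by (auto simp: filter_id_conv)
    show "(length (filter (\<lambda>t. t \<le> n) (case x of (i, ts) \<Rightarrow> ts @ replicate (?r - i) (Suc n))),
       filter (\<lambda>t. t \<le> n) (case x of (i, ts) \<Rightarrow> ts @ replicate (?r - i) (Suc n))) = x"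
      using x f by simp
    show "(case x of (i, ts) \<Rightarrow> ts @ replicate (?r - i) (Suc n)) \<in> ?A (Suc n) ?r"
      using x by (auto simp: sorted_append)
    have prod: "(\<Prod>k<i + j. f k) = (\<Prod>k<i. f k) * (\<Prod>k<j. f (i + k))" for i j and f :: "nat \<Rightarrow> 'k"
      by (induction j) (auto simp: mult.assoc)
    have "(\<Prod>k<i + (?r - i). p ((ts @ replicate (?r - i) (Suc n)) ! k) (ws ! k)) =
        (\<Prod>k<i. p (ts ! k) (take i ws ! k)) * (\<Prod>k<?r - i. p (Suc n) (drop i ws ! k))"
      unfolding prod using x by (intro arg_cong2[of _ _ _ _ "(*)"] prod.cong) (auto simp: nth_append)
    moreover have "prod_list (map (p (Suc n)) (drop i ws)) = (\<Prod>k<?r - i. p (Suc n) (drop i ws ! k))"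
      by (simp add: prod.list_conv_set_nth atLeast0LessThan)
    moreover have "multiplicity_factor (ts @ replicate (?r - i) (Suc n)) = multiplicity_factor ts * fact (?r - i)"
      using x by (intro multiplicity_factor_append_replicate) auto
    ultimately show "?g ws (case x of (i, ts) \<Rightarrow> ts @ replicate (?r - i) (Suc n)) =
        (case x of (i, ts) \<Rightarrow> ?g (take i ws) ts * exp_word (p (Suc n)) (drop i ws))"
      using x by (simp add: exp_word_def min_absorb2)
  next
    fix ts assume ts: "ts \<in> ?A (Suc n) ?r"
    show "(length (filter (\<lambda>t. t \<le> n) ts), filter (\<lambda>t. t \<le> n) ts) \<in> Sigma {..?r} (?A n)"
      using ts length_filter_le[of "\<lambda>t. t \<le> n" ts] by (auto simp: sorted_filter[of id, simplified])
    let ?k = "length (filter (\<lambda>t. \<not> t \<le> n) ts)"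
    have rep: "filter (\<lambda>t. \<not> t \<le> n) ts = replicate ?k (Suc n)"
      by (rule replicate_eqI) (use ts in auto)
    have "sorted (filter (\<lambda>t. t \<le> n) ts @ replicate ?k (Suc n))"
      using ts by (auto simp: sorted_append sorted_filter[of id, simplified])
    moreover have "mset (filter (\<lambda>t. t \<le> n) ts @ replicate ?k (Suc n)) = mset ts"
      unfolding rep[symmetric] by (simp add: mset_filter)
    ultimately have "filter (\<lambda>t. t \<le> n) ts @ replicate ?k (Suc n) = ts"
      using ts properties_for_sort[of "filter (\<lambda>t. t \<le> n) ts @ replicate ?k (Suc n)" ts] by (simp add: sorted_sort_id)
    moreover have "?k = ?r - length (filter (\<lambda>t. t \<le> n) ts)"
      using ts sum_length_filter_compl[of "\<lambda>t. t \<le> n" ts] by simp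
    ultimately show "(case (length (filter (\<lambda>t. t \<le> n) ts), filter (\<lambda>t. t \<le> n) ts) of
        (i, ts) \<Rightarrow> ts @ replicate (?r - i) (Suc n)) = ts" by simp
  qed
  finally show ?case by simp
qed

section \<open>Integrals along loops\<close>

text \<open>Induction over sets of restricted functions can leave eta-expanded goals, in which the default
  rule would unfold the restriction; the conditional rule leaves it intact.\<close>

declare restrict_apply [simp del] restrict_apply' [simp]

lemma line_integral_eq_chen:
  "(\<lambda>ws. line_integral ws \<alpha>) = chen (\<lambda>t \<omega>. form_pairing \<omega> \<alpha> t) (len \<alpha>)"
  by (rule ext) (simp add: line_integral_def flip: iterated_sum_eq_chen)

definition concat_loops :: "'v line_map \<Rightarrow> 'v line_map \<Rightarrow> 'v line_map"
  where "concat_loops \<alpha> \<beta> =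
    \<lparr>len = len \<alpha> + len \<beta>,
     line = \<lparr>pverts = {0..len \<alpha> + len \<beta>},
       parcs = parcs (line \<alpha>) \<union> {(len \<alpha> + i, len \<alpha> + j) | i j. (i, j) \<in> parcs (line \<beta>)}\<rparr>,
     vertex = (\<lambda>i\<in>{0..len \<alpha> + len \<beta>}. if i \<le> len \<alpha> then vertex \<alpha> i else vertex \<beta> (i - len \<alpha>))\<rparr>"

text \<open>The arrow \<open>i \<rightarrow> j\<close> of the line goes to \<open>n - i \<rightarrow> n - j\<close>, so that a step that was followed along its
  arrow is now followed against it.\<close>

definition reverse_loop :: "'v line_map \<Rightarrow> 'v line_map"
  where "reverse_loop \<alpha> =
    \<lparr>len = len \<alpha>,
     line = \<lparr>pverts = {0..len \<alpha>},
       parcs = {(i, j). i \<le> len \<alpha> \<and> j \<le> len \<alpha> \<and> (len \<alpha> - i, len \<alpha> - j) \<in> parcs (line \<alpha>)}\<rparr>,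
     vertex = (\<lambda>i\<in>{0..len \<alpha>}. vertex \<alpha> (len \<alpha> - i))\<rparr>"

lemma line_digraph_arcs:
  assumes "line_digraph n I" "(i, j) \<in> parcs I"
  shows "i \<le> n \<and> j \<le> n \<and> (j = i + 1 \<or> i = j + 1)"
  using assms by (auto simp: line_digraph_def)

lemma line_digraphI:
  assumes "pverts I = {0..n}"
    and "\<And>i j. (i, j) \<in> parcs I \<Longrightarrow> i \<le> n \<and> j \<le> n \<and> (j = i + 1 \<or> i = j + 1)"
    and "\<And>i. i < n \<Longrightarrow> (i, i + 1) \<in> parcs I \<longleftrightarrow> (i + 1, i) \<notin> parcs I"
  shows "line_digraph n I"
  using assms by (fastforce simp: line_digraph_def)

lemma line_digraph_arc_iff:
  assumes "line_digraph n I" "i < n"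
  shows "(i, Suc i) \<in> parcs I \<longleftrightarrow> (Suc i, i) \<notin> parcs I"
  using assms by (simp add: line_digraph_def)

lemma loopsI:
  assumes "line_digraph (len \<alpha>) (line \<alpha>)" "vertex \<alpha> \<in> extensional {0..len \<alpha>}"
    and "\<And>i. i \<le> len \<alpha> \<Longrightarrow> vertex \<alpha> i \<in> pverts G"
    and "\<And>i j. (i, j) \<in> parcs (line \<alpha>) \<Longrightarrow>
      vertex \<alpha> i = vertex \<alpha> j \<or> (vertex \<alpha> i, vertex \<alpha> j) \<in> parcs G"
    and "vertex \<alpha> 0 = x" "vertex \<alpha> (len \<alpha>) = x"
  shows "\<alpha> \<in> loops G x"
proof -
  have "pverts (line \<alpha>) = {0..len \<alpha>}" using assms(1) by (simp add: line_digraph_def)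
  thus ?thesis using assms by (auto simp: loops_def digraph_maps_def PiE_def)
qed

lemma loopsD:
  assumes "\<alpha> \<in> loops G x"
  shows "line_digraph (len \<alpha>) (line \<alpha>)" "vertex \<alpha> 0 = x" "vertex \<alpha> (len \<alpha>) = x"
    and "\<And>i. i \<le> len \<alpha> \<Longrightarrow> vertex \<alpha> i \<in> pverts G"
    and "\<And>i j. (i, j) \<in> parcs (line \<alpha>) \<Longrightarrow>
      vertex \<alpha> i = vertex \<alpha> j \<or> (vertex \<alpha> i, vertex \<alpha> j) \<in> parcs G"
proof -
  show line: "line_digraph (len \<alpha>) (line \<alpha>)" using assms by (simp add: loops_def)
  hence "pverts (line \<alpha>) = {0..len \<alpha>}" by (simp add: line_digraph_def)
  thus "vertex \<alpha> 0 = x" "vertex \<alpha> (len \<alpha>) = x" "\<And>i. i \<le> len \<alpha> \<Longrightarrow> vertex \<alpha> i \<in> pverts G"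
    "\<And>i j. (i, j) \<in> parcs (line \<alpha>) \<Longrightarrow> vertex \<alpha> i = vertex \<alpha> j \<or> (vertex \<alpha> i, vertex \<alpha> j) \<in> parcs G"
    using assms by (auto simp: loops_def digraph_maps_def PiE_def Pi_def)
qed

lemma trivial_loop_in_loops: "x \<in> pverts G \<Longrightarrow> trivial_loop x \<in> loops G x"
  by (rule loopsI) (auto simp: trivial_loop_def line_digraph_def)

lemma concat_loops_in_loops:
  assumes a: "\<alpha> \<in> loops G x" and b: "\<beta> \<in> loops G x"
  shows "concat_loops \<alpha> \<beta> \<in> loops G x"
proof (rule loopsI)
  let ?m = "len \<alpha>" and ?n = "len \<beta>"
  note a' = loopsD[OF a] and b' = loopsD[OF b]
  note arcs = line_digraph_arcs[OF a'(1)] line_digraph_arcs[OF b'(1)]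
  show "line_digraph (len (concat_loops \<alpha> \<beta>)) (line (concat_loops \<alpha> \<beta>))"
  proof (rule line_digraphI)
    fix i assume i: "i < len (concat_loops \<alpha> \<beta>)"
    show "(i, i + 1) \<in> parcs (line (concat_loops \<alpha> \<beta>)) \<longleftrightarrow> (i + 1, i) \<notin> parcs (line (concat_loops \<alpha> \<beta>))"
    proof (cases "i < ?m")
      case True
      thus ?thesis using line_digraph_arc_iff[OF a'(1), of i] by (auto simp: concat_loops_def)
    next
      case False
      then obtain k where k: "i = ?m + k" by (auto simp: not_less le_iff_add)
      hence "(i, i + 1) \<notin> parcs (line \<alpha>)" "(i + 1, i) \<notin> parcs (line \<alpha>)" using arcs(1) by fastforce+
      thus ?thesis using line_digraph_arc_iff[OF b'(1), of k] i k by (auto simp: concat_loops_def)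
    qed
  qed (auto simp: concat_loops_def dest!: arcs)
  show "vertex (concat_loops \<alpha> \<beta>) i = vertex (concat_loops \<alpha> \<beta>) j \<or>
      (vertex (concat_loops \<alpha> \<beta>) i, vertex (concat_loops \<alpha> \<beta>) j) \<in> parcs G"
    if ij: "(i, j) \<in> parcs (line (concat_loops \<alpha> \<beta>))" for i j
  proof (cases "(i, j) \<in> parcs (line \<alpha>)")
    case True
    thus ?thesis using arcs(1)[OF True] a'(5)[OF True] by (simp add: concat_loops_def)
  next
    case False
    then obtain k l where kl: "i = ?m + k" "j = ?m + l" "(k, l) \<in> parcs (line \<beta>)"
      using ij by (auto simp: concat_loops_def)
    have v: "vertex (concat_loops \<alpha> \<beta>) (?m + k) = vertex \<beta> k" if "k \<le> ?n" for k
      using that a'(3) b'(2) by (cases k) (simp_all add: concat_loops_def)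
    show ?thesis using b'(5)[OF kl(3)] arcs(2)[OF kl(3)] by (simp add: kl(1,2) v)
  qed
qed (use loopsD[OF a] loopsD[OF b] in \<open>auto simp: concat_loops_def\<close>)

lemma reverse_loop_in_loops:
  assumes a: "\<alpha> \<in> loops G x"
  shows "reverse_loop \<alpha> \<in> loops G x"
proof (rule loopsI)
  note a' = loopsD[OF a] and arcs = line_digraph_arcs[OF loopsD(1)[OF a]]
  show "line_digraph (len (reverse_loop \<alpha>)) (line (reverse_loop \<alpha>))"
  proof (rule line_digraphI)
    fix i assume "i < len (reverse_loop \<alpha>)"
    hence i: "i < len \<alpha>" by (simp add: reverse_loop_def)
    have "len \<alpha> - i = Suc (len \<alpha> - Suc i)" using i by simp
    thus "(i, i + 1) \<in> parcs (line (reverse_loop \<alpha>)) \<longleftrightarrow> (i + 1, i) \<notin> parcs (line (reverse_loop \<alpha>))"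
      using line_digraph_arc_iff[OF a'(1), of "len \<alpha> - Suc i"] i by (simp add: reverse_loop_def)
  next
    fix i j assume "(i, j) \<in> parcs (line (reverse_loop \<alpha>))"
    hence ij: "i \<le> len \<alpha>" "j \<le> len \<alpha>" "(len \<alpha> - i, len \<alpha> - j) \<in> parcs (line \<alpha>)"
      by (auto simp: reverse_loop_def)
    show "i \<le> len (reverse_loop \<alpha>) \<and> j \<le> len (reverse_loop \<alpha>) \<and> (j = i + 1 \<or> i = j + 1)"
      using arcs[OF ij(3)] ij(1,2) by (auto simp: reverse_loop_def)
  qed (simp add: reverse_loop_def)
qed (use loopsD[OF a] in \<open>auto simp: reverse_loop_def\<close>)

lemma line_integral_trivial_loop: "(\<lambda>ws. line_integral ws (trivial_loop x)) = conv_unit"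
  by (simp add: line_integral_eq_chen trivial_loop_def)

lemma line_integral_concat:
  fixes \<alpha> \<beta> :: "'v line_map"
  assumes a: "\<alpha> \<in> loops G x" and b: "\<beta> \<in> loops G x"
  shows "(\<lambda>ws. line_integral ws (concat_loops \<alpha> \<beta>) :: 'k::field_char_0) =
    conv (\<lambda>ws. line_integral ws \<alpha>) (\<lambda>ws. line_integral ws \<beta>)"
proof -
  note a' = loopsD[OF a] and b' = loopsD[OF b]
  note arcs = line_digraph_arcs[OF a'(1)] line_digraph_arcs[OF b'(1)]
  have 1: "form_pairing \<omega> (concat_loops \<alpha> \<beta>) t = form_pairing \<omega> \<alpha> t"
    if t: "1 \<le> t" "t \<le> len \<alpha>" for t and \<omega> :: "'v \<times> 'v \<Rightarrow> 'k"
  proof -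
    have "(t - 1, t) \<in> parcs (line (concat_loops \<alpha> \<beta>)) \<longleftrightarrow> (t - 1, t) \<in> parcs (line \<alpha>)"
      using t by (auto simp: concat_loops_def)
    moreover have "vertex (concat_loops \<alpha> \<beta>) t = vertex \<alpha> t"
      "vertex (concat_loops \<alpha> \<beta>) (t - 1) = vertex \<alpha> (t - 1)"
      using t by (auto simp: concat_loops_def)
    ultimately show ?thesis by (simp add: form_pairing_def)
  qed
  have 2: "form_pairing \<omega> (concat_loops \<alpha> \<beta>) (len \<alpha> + t) = form_pairing \<omega> \<beta> t"
    if t: "1 \<le> t" "t \<le> len \<beta>" for t and \<omega> :: "'v \<times> 'v \<Rightarrow> 'k"
  proof -
    have v: "vertex (concat_loops \<alpha> \<beta>) (len \<alpha> + k) = vertex \<beta> k" if "k \<le> len \<beta>" for k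
      using that a'(3) b'(2) by (cases k) (simp_all add: concat_loops_def)
    have "(len \<alpha> + (t - 1), len \<alpha> + t) \<notin> parcs (line \<alpha>)" using arcs(1) t by fastforce
    hence "(len \<alpha> + (t - 1), len \<alpha> + t) \<in> parcs (line (concat_loops \<alpha> \<beta>)) \<longleftrightarrow> (t - 1, t) \<in> parcs (line \<beta>)"
      by (auto simp: concat_loops_def)
    moreover have "len \<alpha> + t - 1 = len \<alpha> + (t - 1)" using t by simp
    ultimately show ?thesis using t by (simp add: form_pairing_def v del: add_diff_assoc)
  qed
  have "chen (\<lambda>t \<omega> :: _ \<Rightarrow> 'k. form_pairing \<omega> (concat_loops \<alpha> \<beta>) t) (len \<alpha>) =
      chen (\<lambda>t \<omega>. form_pairing \<omega> \<alpha> t) (len \<alpha>)"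
    by (rule chen_cong) (simp add: 1)
  moreover have "chen (\<lambda>t \<omega> :: _ \<Rightarrow> 'k. form_pairing \<omega> (concat_loops \<alpha> \<beta>) (len \<alpha> + t)) (len \<beta>) =
      chen (\<lambda>t \<omega>. form_pairing \<omega> \<beta> t) (len \<beta>)"
    by (rule chen_cong) (simp add: 2)
  moreover have "len (concat_loops \<alpha> \<beta>) = len \<alpha> + len \<beta>" by (simp add: concat_loops_def)
  ultimately show ?thesis by (simp add: line_integral_eq_chen chen_add)
qed

lemma line_integral_reverse:
  fixes \<alpha> :: "'v line_map"
  assumes a: "\<alpha> \<in> loops G x"
  shows "(\<lambda>ws. line_integral ws (reverse_loop \<alpha>) :: 'k::field_char_0) = signed_rev (\<lambda>ws. line_integral ws \<alpha>)"
proof -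
  let ?n = "len \<alpha>"
  have "form_pairing \<omega> (reverse_loop \<alpha>) t = - form_pairing \<omega> \<alpha> (?n + 1 - t)"
    if t: "1 \<le> t" "t \<le> ?n" for t and \<omega> :: "'v \<times> 'v \<Rightarrow> 'k"
  proof -
    define s where "s = ?n - t"
    have s: "?n + 1 - t = Suc s" "s < ?n" "?n - (t - 1) = Suc s" using t by (auto simp: s_def)
    have v: "vertex (reverse_loop \<alpha>) t = vertex \<alpha> s" "vertex (reverse_loop \<alpha>) (t - 1) = vertex \<alpha> (Suc s)"
      using t s by (auto simp: reverse_loop_def s_def)
    have "(t - 1, t) \<in> parcs (line (reverse_loop \<alpha>)) \<longleftrightarrow> (Suc s, s) \<in> parcs (line \<alpha>)"
      using t s by (auto simp: reverse_loop_def s_def)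
    hence "(t - 1, t) \<in> parcs (line (reverse_loop \<alpha>)) \<longleftrightarrow> (s, Suc s) \<notin> parcs (line \<alpha>)"
      using line_digraph_arc_iff[OF loopsD(1)[OF a] s(2)] by simp
    thus ?thesis unfolding form_pairing_def v s(1) by simp
  qed
  hence "chen (\<lambda>t \<omega> :: _ \<Rightarrow> 'k. form_pairing \<omega> (reverse_loop \<alpha>) t) ?n = chen (\<lambda>t \<omega>. - form_pairing \<omega> \<alpha> (?n + 1 - t)) ?n"
    by (intro chen_cong ext)
  moreover have "len (reverse_loop \<alpha>) = ?n" by (simp add: reverse_loop_def)
  ultimately show ?thesis using chen_reverse[of "\<lambda>t \<omega> :: _ \<Rightarrow> 'k. form_pairing \<omega> \<alpha> t" ?n] by (simp add: line_integral_eq_chen)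
qed

lemma line_integral_shuffle:
  fixes u v :: "('v \<times> 'v \<Rightarrow> 'k::field_char_0) list"
  shows "line_integral u \<alpha> * line_integral v \<alpha> = (\<Sum>w\<leftarrow>shuffle u v. line_integral w \<alpha>)"
  using shuffle_character_chen[of "\<lambda>t \<omega> :: _ \<Rightarrow> 'k. form_pairing \<omega> \<alpha> t" "len \<alpha>"]
  unfolding shuffle_character_def shuffle_sum_def line_integral_eq_chen[symmetric] by simp

section \<open>The algebra of iterated loop integrals\<close>

text \<open>The linear span of the integrals of words. That it is closed under products is the shuffle
  formula; hence it is all of the loop algebra, and linear maps on the loop algebra are determined
  by their values on words.\<close>

inductive_set word_span :: "'v pair_pre_digraph \<Rightarrow> 'v \<Rightarrow> ('v line_map \<Rightarrow> 'k::field_char_0) set"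
  for G x where
  word: "ws \<in> lists (one_forms G) \<Longrightarrow> loop_integral G x ws \<in> word_span G x"
| add: "f \<in> word_span G x \<Longrightarrow> g \<in> word_span G x \<Longrightarrow> (\<lambda>\<alpha>\<in>loops G x. f \<alpha> + g \<alpha>) \<in> word_span G x"
| smult: "f \<in> word_span G x \<Longrightarrow> (\<lambda>\<alpha>\<in>loops G x. a * f \<alpha>) \<in> word_span G x"

lemma loop_integral_apply: "\<alpha> \<in> loops G x \<Longrightarrow> loop_integral G x ws \<alpha> = line_integral ws \<alpha>"
  by (simp add: loop_integral_def)

lemma line_integral_Nil [simp]: "line_integral [] \<alpha> = 1"
proof -
  have "{ts. length ts = length ([] :: 'a list) \<and> sorted ts \<and> set ts \<subseteq> {1..len \<alpha>}} = {[]}" for \<alpha> :: "'b line_map"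
    by auto
  thus ?thesis by (simp add: line_integral_def multiplicity_factor_def)
qed

lemma word_span_zero: "(\<lambda>\<alpha>\<in>loops G x. 0 :: 'k::field_char_0) \<in> word_span G x"
proof -
  have "(\<lambda>\<alpha>\<in>loops G x. 0 * loop_integral G x [] \<alpha> :: 'k) \<in> word_span G x"
    by (intro word_span.smult word_span.word) auto
  thus ?thesis by (simp only: mult_zero_left)
qed

lemma word_span_extensional: "f \<in> word_span G x \<Longrightarrow> f \<in> extensional (loops G x)"
  by (cases rule: word_span.cases) (auto simp: loop_integral_def)

lemma word_span_sum_list:
  "set W \<subseteq> lists (one_forms G) \<Longrightarrow> (\<lambda>\<alpha>\<in>loops G x. \<Sum>w\<leftarrow>W. line_integral w \<alpha>) \<in> word_span G x"
proof (induction W)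
  case Nil
  show ?case by (simp add: word_span_zero)
next
  case (Cons w W)
  have "(\<lambda>\<alpha>\<in>loops G x. loop_integral G x w \<alpha> + (\<lambda>\<alpha>\<in>loops G x. \<Sum>w\<leftarrow>W. line_integral w \<alpha>) \<alpha>) \<in> word_span G x"
    using Cons by (intro word_span.add word_span.word) auto
  also have "(\<lambda>\<alpha>\<in>loops G x. loop_integral G x w \<alpha> + (\<lambda>\<alpha>\<in>loops G x. \<Sum>w\<leftarrow>W. line_integral w \<alpha>) \<alpha>) =
      (\<lambda>\<alpha>\<in>loops G x. \<Sum>w\<leftarrow>w # W. line_integral w \<alpha>)"
    by (rule restrict_ext) (simp add: loop_integral_apply)
  finally show ?case .
qed

lemma word_span_mult:
  assumes f: "f \<in> word_span G x" and g: "g \<in> word_span G x"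
  shows "(\<lambda>\<alpha>\<in>loops G x. f \<alpha> * g \<alpha>) \<in> word_span G x"
  using f
proof induction
  case (word u)
  show ?case using g
  proof induction
    case (word v)
    have "set (shuffle u v) \<subseteq> lists (one_forms G)"
      using \<open>u \<in> lists (one_forms G)\<close> word by (auto simp: set_shuffle set_shuffles in_lists_conv_set)
    from word_span_sum_list[OF this, of x]
    have "(\<lambda>\<alpha>\<in>loops G x. line_integral u \<alpha> * line_integral v \<alpha>) \<in> word_span G x"
      by (simp only: line_integral_shuffle)
    also have "(\<lambda>\<alpha>\<in>loops G x. line_integral u \<alpha> * line_integral v \<alpha>) =
        (\<lambda>\<alpha>\<in>loops G x. loop_integral G x u \<alpha> * loop_integral G x v \<alpha>)"
      by (rule restrict_ext) (simp add: loop_integral_apply)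
    finally show ?case .
  next
    case (add f g)
    from word_span.add[OF add.IH] show ?case
      by (rule back_subst[of "\<lambda>h. h \<in> word_span G x"]) (auto simp: algebra_simps intro!: restrict_ext)
  next
    case (smult f a)
    from word_span.smult[OF smult.IH, of a] show ?case
      by (rule back_subst[of "\<lambda>h. h \<in> word_span G x"]) (auto simp: algebra_simps intro!: restrict_ext)
  qed
next
  case (add f g')
  from word_span.add[OF add.IH] show ?case
    by (rule back_subst[of "\<lambda>h. h \<in> word_span G x"]) (auto simp: algebra_simps intro!: restrict_ext)
next
  case (smult f a)
  from word_span.smult[OF smult.IH, of a] show ?case
    by (rule back_subst[of "\<lambda>h. h \<in> word_span G x"]) (auto simp: algebra_simps intro!: restrict_ext)
qed

lemma loop_integral_Nil: "loop_integral G x [] = (\<lambda>\<alpha>\<in>loops G x. 1)"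
  by (rule ext) (simp add: loop_integral_def restrict_def)

lemma carrier_loop_algebra:
  "carrier (loop_algebra G x) = (word_span G x :: ('v line_map \<Rightarrow> 'k::field_char_0) set)"
proof (intro equalityI subsetI)
  fix f :: "_ \<Rightarrow> 'k" assume "f \<in> carrier (loop_algebra G x)"
  hence "f \<in> subalgebra_generated ring_of_type_algebra (function_algebra (loops G x))
      {loop_integral G x ws | ws. ws \<in> lists (one_forms G) \<and> ws \<noteq> []}"
    by (simp add: loop_algebra_def)
  thus "f \<in> word_span G x"
  proof induction
    case one
    have "(loop_integral G x [] :: _ \<Rightarrow> 'k) \<in> word_span G x" by (rule word_span.word) simp
    thus ?case by (simp only: loop_integral_Nil function_algebra_simps)
  qed (auto intro: word_span.intros word_span_mult)
next
  fix f :: "_ \<Rightarrow> 'k" assume "f \<in> word_span G x"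
  hence "f \<in> subalgebra_generated ring_of_type_algebra (function_algebra (loops G x))
      {loop_integral G x ws | ws. ws \<in> lists (one_forms G) \<and> ws \<noteq> []}"
  proof induction
    case (word ws)
    show ?case
    proof (cases "ws = []")
      case True
      thus ?thesis by (simp only: loop_integral_Nil flip: function_algebra_simps(3)) (rule subalgebra_generated.one)
    qed (use word in \<open>blast intro: subalgebra_generated.generator\<close>)
  next
    case (add f g)
    from subalgebra_generated.add[OF add.IH] show ?case by simp
  next
    case (smult f a)
    from subalgebra_generated.smult[OF _ smult.IH, of a] show ?case by simp
  qed
  thus "f \<in> carrier (loop_algebra G x)" by (simp add: loop_algebra_def)
qed

lemma loop_algebra_eq:
  "loop_algebra G x =
    function_algebra (loops G x) \<lparr>carrier := word_span G x :: ('v line_map \<Rightarrow> 'k::field_char_0) set\<rparr>"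
  using carrier_loop_algebra[of G x, where 'k = 'k] by (simp add: loop_algebra_def)

lemma linear_maps_loop_algebra_eqI:
  fixes f g :: "('v line_map \<Rightarrow> 'k::field_char_0) \<Rightarrow> 'c"
  assumes "f \<in> linear_maps ring_of_type_algebra (loop_algebra G x) M"
    and "g \<in> linear_maps ring_of_type_algebra (loop_algebra G x) M"
    and "\<And>ws. ws \<in> lists (one_forms G) \<Longrightarrow> f (loop_integral G x ws) = g (loop_integral G x ws)"
  shows "f = g"
proof (rule linear_maps_eqI[OF assms(1,2)])
  fix h :: "'v line_map \<Rightarrow> 'k" assume "h \<in> carrier (loop_algebra G x)"
  hence "h \<in> word_span G x" by (simp add: carrier_loop_algebra)
  thus "f h = g h"
  proof induction
    case (add h k)
    hence "h \<in> carrier (loop_algebra G x)" "k \<in> carrier (loop_algebra G x)" by (simp_all add: carrier_loop_algebra)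
    from linear_maps_add[OF assms(1) this] linear_maps_add[OF assms(2) this] add.IH
    show ?case by (simp add: loop_algebra_eq)
  next
    case (smult h a)
    hence "h \<in> carrier (loop_algebra G x)" by (simp add: carrier_loop_algebra)
    from linear_maps_smult[OF assms(1) _ this, of a] linear_maps_smult[OF assms(2) _ this, of a] smult.IH
    show ?case by (simp add: loop_algebra_eq)
  qed (rule assms(3))
qed

text \<open>This reduces the laws of concatenation and reversal, which the loops themselves need not satisfy,
  to identities between values of \<open>conv\<close> and \<open>signed_rev\<close>.\<close>

lemma word_span_apply_cong:
  assumes "f \<in> word_span G x" "\<alpha> \<in> loops G x" "\<beta> \<in> loops G x"
    and "(\<lambda>ws. line_integral ws \<alpha> :: 'k::field_char_0) = (\<lambda>ws. line_integral ws \<beta>)"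
  shows "f \<alpha> = (f \<beta> :: 'k)"
  using assms(1)
  by induction (use assms(2,3) fun_cong[OF assms(4)] in \<open>auto simp: loop_integral_apply\<close>)

lemma word_span_reverse:
  assumes "f \<in> word_span G x"
  shows "(\<lambda>\<alpha>\<in>loops G x. f (reverse_loop \<alpha>)) \<in> word_span G x"
  using assms
proof induction
  case (word ws)
  hence "rev ws \<in> lists (one_forms G)" by (simp add: in_lists_conv_set)
  from word_span.smult[OF word_span.word[OF this, of x], of "(- 1) ^ length ws"] show ?case
    by (rule back_subst[of "\<lambda>h. h \<in> word_span G x"])
      (auto intro!: restrict_ext simp: loop_integral_apply reverse_loop_in_loops
        fun_cong[OF line_integral_reverse] signed_rev_def)
next
  case (add f g)
  from word_span.add[OF add.IH] show ?case
    by (rule back_subst[of "\<lambda>h. h \<in> word_span G x"]) (auto intro!: restrict_ext simp: reverse_loop_in_loops)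
next
  case (smult f a)
  from word_span.smult[OF smult.IH, of a] show ?case
    by (rule back_subst[of "\<lambda>h. h \<in> word_span G x"]) (auto intro!: restrict_ext simp: reverse_loop_in_loops)
qed

section \<open>The Hopf algebra of iterated loop integrals\<close>

context
  fixes G :: "'v pair_pre_digraph" and x :: 'v and K :: "'k::field_char_0 ring" and Q and QQ
  defines "K \<equiv> ring_of_type_algebra"
    and "Q \<equiv> function_algebra (loops G x) \<lparr>carrier := word_span G x :: ('v line_map \<Rightarrow> 'k) set\<rparr>"
    and "QQ \<equiv> tensor K Q Q"
  assumes x: "x \<in> pverts G"
begin

interpretation function_subalgebra "loops G x" "word_span G x :: ('v line_map \<Rightarrow> 'k) set" K Q QQ
proof unfold_locales
  show "word_span G x \<subseteq> loops G x \<rightarrow>\<^sub>E UNIV" by (auto simp: PiE_def dest: word_span_extensional)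
  show "(\<lambda>s\<in>loops G x. 1) \<in> word_span G x"
    using word_span.word[of "[]" G x] by (simp add: loop_integral_Nil)
qed (auto simp: K_def Q_def QQ_def intro: word_span.intros word_span_mult)

text \<open>The tensor prescribed for \<open>\<Delta> (\<oint> ws)\<close>, viewed as a function of two loops, is the integral over their
  concatenation.\<close>

lemma deconcatenation:
  fixes ws :: "('v \<times> 'v \<Rightarrow> 'k) list"
  assumes ws: "ws \<in> lists (one_forms G)"
  defines "t \<equiv> \<Oplus>\<^bsub>QQ\<^esub> i\<in>{0..length ws}.
    pure_tensor K Q Q (loop_integral G x (take i ws)) (loop_integral G x (drop i ws))"
  shows "t \<in> carrier QQ"
    and "\<alpha> \<in> loops G x \<Longrightarrow> \<beta> \<in> loops G x \<Longrightarrow> eval2 \<alpha> \<beta> t = line_integral ws (concat_loops \<alpha> \<beta>)"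
proof -
  interpret QQ: module K QQ by (rule module_QQ)
  have span: "loop_integral G x (take i ws) \<in> word_span G x" "loop_integral G x (drop i ws) \<in> word_span G x" for i
    using ws by (auto intro!: word_span.word dest: in_set_takeD in_set_dropD simp: in_lists_conv_set)
  hence closed: "(\<lambda>i. pure_tensor K Q Q (loop_integral G x (take i ws)) (loop_integral G x (drop i ws)))
      \<in> {0..length ws} \<rightarrow> carrier QQ"
    using pure_tensor_closed[OF module_Q module_Q] by (auto simp: QQ_def)
  show "t \<in> carrier QQ" unfolding t_def by (rule QQ.finsum_closed[OF closed])
  assume ab: "\<alpha> \<in> loops G x" "\<beta> \<in> loops G x"
  have "eval2 \<alpha> \<beta> t = (\<Sum>i=0..length ws. line_integral (take i ws) \<alpha> * line_integral (drop i ws) \<beta>)"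
    unfolding t_def using ab closed span by (simp add: eval2_finsum eval2_pure loop_integral_apply)
  also have "\<dots> = line_integral ws (concat_loops \<alpha> \<beta>)"
    using fun_cong[OF line_integral_concat[OF ab], of ws] by (simp add: conv_def atLeast0AtMost)
  finally show "eval2 \<alpha> \<beta> t = line_integral ws (concat_loops \<alpha> \<beta>)" .
qed

lemma concatenation_representative:
  assumes "f \<in> word_span G x"
  shows "\<exists>t\<in>carrier QQ. \<forall>a\<in>loops G x. \<forall>b\<in>loops G x. eval2 a b t = f (concat_loops a b)"
  using assms
proof induction
  case (word ws)
  from deconcatenation[OF this] show ?case
    by (intro bexI ballI) (simp_all add: loop_integral_apply concat_loops_in_loops)
next
  case (add f g)
  interpret QQ: module K QQ by (rule module_QQ)
  from add.IH obtain s t where "s \<in> carrier QQ" "t \<in> carrier QQ"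
    "\<forall>a\<in>loops G x. \<forall>b\<in>loops G x. eval2 a b s = f (concat_loops a b)"
    "\<forall>a\<in>loops G x. \<forall>b\<in>loops G x. eval2 a b t = g (concat_loops a b)" by blast
  thus ?case
    by (intro bexI[of _ "s \<oplus>\<^bsub>QQ\<^esub> t"]) (auto simp: linear_maps_add[OF eval2_linear] concat_loops_in_loops)
next
  case (smult f c)
  interpret QQ: module K QQ by (rule module_QQ)
  from smult.IH obtain t where "t \<in> carrier QQ"
    "\<forall>a\<in>loops G x. \<forall>b\<in>loops G x. eval2 a b t = f (concat_loops a b)" by blast
  thus ?case
    by (intro bexI[of _ "c \<odot>\<^bsub>QQ\<^esub> t"]) (auto simp: linear_maps_smult[OF eval2_linear] concat_loops_in_loops)
qed

interpretation representative_functions K Q QQ "loops G x" "word_span G x :: ('v line_map \<Rightarrow> 'k) set"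
  concat_loops "trivial_loop x" reverse_loop
proof unfold_locales
  fix f :: "'v line_map \<Rightarrow> 'k" assume f: "f \<in> word_span G x"
  note closed = concat_loops_in_loops reverse_loop_in_loops trivial_loop_in_loops[OF x]
  note integrals = line_integral_concat[where G = G and x = x] line_integral_reverse[where G = G and x = x]
    line_integral_trivial_loop closed
  show "f (concat_loops (concat_loops a b) c) = f (concat_loops a (concat_loops b c))"
    if "a \<in> loops G x" "b \<in> loops G x" "c \<in> loops G x" for a b c
    by (rule word_span_apply_cong[OF f]) (use that in \<open>simp_all add: integrals conv_assoc\<close>)
  fix a assume a: "a \<in> loops G x"
  show "f (concat_loops (trivial_loop x) a) = f a" "f (concat_loops a (trivial_loop x)) = f a"
    by (rule word_span_apply_cong[OF f]; use a in \<open>simp add: integrals\<close>)+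
  show "f (concat_loops (reverse_loop a) a) = f (trivial_loop x)"
    "f (concat_loops a (reverse_loop a)) = f (trivial_loop x)"
    by (rule word_span_apply_cong[OF f];
        use a in \<open>simp add: integrals line_integral_eq_chen[of a] chen_inverse\<close>)+
qed (auto simp: concat_loops_in_loops reverse_loop_in_loops trivial_loop_in_loops x word_span_reverse
    concatenation_representative[unfolded K_def Q_def QQ_def] K_def Q_def)

text \<open>The maps given by concatenation, trivial loop and reversal take the prescribed values on words,
  and a linear map is determined by these values.\<close>

lemma loop_structure_maps:
  shows "is_loop_counit G x \<epsilon> \<longleftrightarrow> \<epsilon> = counit"
    and "is_loop_comult G x \<Delta> \<longleftrightarrow> \<Delta> = comult"
    and "is_loop_antipode G x j \<longleftrightarrow> j = antipode"
    and "hopf_algebra ring_of_type_algebra (loop_algebra G x) comult counit antipode"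
proof -
  have Q: "loop_algebra G x = Q" by (simp add: loop_algebra_eq Q_def)
  note unique = linear_maps_loop_algebra_eqI[where 'k = 'k and G = G and x = x, folded K_def, unfolded Q]
  have word: "loop_integral G x ws \<in> word_span G x" if "ws \<in> lists (one_forms G)" for ws :: "('v \<times> 'v \<Rightarrow> 'k) list"
    using that by (rule word_span.word)
  have linear: "counit \<in> linear_maps K Q (regular_module K)"
    unfolding counit_def by (rule eval1_linear[OF unit_closed])
  have counit: "counit (loop_integral G x ws) = line_integral ws (trivial_loop x)"
    if "ws \<in> lists (one_forms G)" for ws
    using word[OF that] by (simp add: counit_eq loop_integral_apply unit_closed)
  show "is_loop_counit G x \<epsilon> \<longleftrightarrow> \<epsilon> = counit"
    unfolding is_loop_counit_def Q K_def[symmetric] 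
    by (rule iffI, rule unique[of \<epsilon> "regular_module K" counit]) (simp_all add: linear counit)
  have comult: "comult (loop_integral G x ws) = (\<Oplus>\<^bsub>QQ\<^esub> i\<in>{0..length ws}.
      pure_tensor K Q Q (loop_integral G x (take i ws)) (loop_integral G x (drop i ws)))"
    if ws: "ws \<in> lists (one_forms G)" for ws
    by (rule QQ_eqI)
      (use word[OF ws] deconcatenation[OF ws] in
        \<open>auto simp: comult_closed eval2_comult loop_integral_apply concat_loops_in_loops\<close>)
  show "is_loop_comult G x \<Delta> \<longleftrightarrow> \<Delta> = comult"
    unfolding is_loop_comult_def Q K_def[symmetric] QQ_def[symmetric] Let_def
    by (rule iffI, rule unique[of \<Delta> QQ comult]) (simp_all add: comult_linear comult)
  have antipode: "antipode (loop_integral G x ws) = (- 1) ^ length ws \<odot>\<^bsub>Q\<^esub> loop_integral G x (rev ws)"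
    if ws: "ws \<in> lists (one_forms G)" for ws
  proof (rule C_eqI)
    have rev: "loop_integral G x (rev ws) \<in> word_span G x" using ws by (intro word) (simp add: in_lists_conv_set)
    show "antipode (loop_integral G x ws) \<in> word_span G x" by (rule antipode_closed[OF word[OF ws]])
    show "(- 1) ^ length ws \<odot>\<^bsub>Q\<^esub> loop_integral G x (rev ws) \<in> word_span G x"
      using C_smult[OF rev] by simp
    fix \<alpha> assume a: "\<alpha> \<in> loops G x"
    show "antipode (loop_integral G x ws) \<alpha> = ((- 1) ^ length ws \<odot>\<^bsub>Q\<^esub> loop_integral G x (rev ws)) \<alpha>"
      using a by (simp add: antipode_apply[OF word[OF ws]] loop_integral_apply reverse_loop_in_loops
          fun_cong[OF line_integral_reverse[OF a]] signed_rev_def)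
  qed
  show "is_loop_antipode G x j \<longleftrightarrow> j = antipode"
    unfolding is_loop_antipode_def Q K_def[symmetric] 
    by (rule iffI, rule unique[of j Q antipode]) (simp_all add: antipode_linear antipode del: Q_simps)
  show "hopf_algebra ring_of_type_algebra (loop_algebra G x) comult counit antipode"
    unfolding Q K_def[symmetric] by (rule hopf_algebra_representative_functions)
qed

end

theorem proposition4p4:
  fixes G :: "'v pair_pre_digraph" and x :: 'v
  assumes "pair_digraph G" and "x \<in> pverts G"
  shows "(\<exists>!\<epsilon> :: ('v line_map \<Rightarrow> 'k::field_char_0) \<Rightarrow> 'k. is_loop_counit G x \<epsilon>) \<and>
    (\<exists>!\<Delta> :: ('v line_map \<Rightarrow> 'k) \<Rightarrow> (('v line_map \<Rightarrow> 'k) \<times> ('v line_map \<Rightarrow> 'k) \<Rightarrow> 'k) set.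
      is_loop_comult G x \<Delta>) \<and>
    (\<exists>!j :: ('v line_map \<Rightarrow> 'k) \<Rightarrow> ('v line_map \<Rightarrow> 'k). is_loop_antipode G x j) \<and>
    (\<forall>(\<epsilon> :: ('v line_map \<Rightarrow> 'k) \<Rightarrow> 'k) \<Delta> j.
      is_loop_counit G x \<epsilon> \<longrightarrow> is_loop_comult G x \<Delta> \<longrightarrow> is_loop_antipode G x j \<longrightarrow>
      hopf_algebra ring_of_type_algebra (loop_algebra G x) \<Delta> \<epsilon> j)"
  unfolding loop_structure_maps(1-3)[OF assms(2)]
  using loop_structure_maps(4)[OF assms(2)] by simp

end
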